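(* Let $\Theta$ be a meromorphic inner function and let $\omega=\exp(-\Omega):\mathbb{R}\to(0,1]$ be a measurable positive function. Suppose that (i) $\Omega\in L^1(\mathbb{P})$, where $d\mathbb{P}(t)=(1+t^2)^{-1}dt$; (ii) $\widetilde\Omega\in C^1(\mathbb{R})$; (iii) the function $\alpha=\arg\Theta+2\widetilde\Omega$ is a regular locally doubling weight satisfying $$1\lesssim\alpha'(x)\lesssim\langle x\rangle^{K_0}\quad\text{for some }K_0\ge0.$$ Then $\omega$ is an admissible majorant for $K_\Theta$; that is, there exists a non-trivial (not identically zero) function $f\in K_\Theta$ such that $$|f(x)|\le\omega(x)\quad\text{for almost every }x\in\mathbb{R}.$$
   Context: Notation: $\langle x\rangle=(1+x^2)^{1/2}$; for nonnegative functions $f,g$, $f\lesssim g$ means there is a constant $C>0$, independent of the variable, with $f\le Cg$. For $u\in L^1(\mathbb{P})$ the Hilbert transform (real conjugation) is $$\tilde u(x)=\frac1\pi\,\mathrm{p.v.}\!\int_{\mathbb{R}}\left(\frac1{x-t}+\frac t{1+t^2}\right)u(t)\,dt .$$ An inner function is a holomorphic map $\Theta:\mathbb{C}_+\to\mathbb{D}$ from the upper half-plane to the unit disc with $\lim_{y\to0^+}|\Theta(x+iy)|=1$ for almost every $x\in\mathbb{R}$; it is a meromorphic inner function if it extends to a meromorphic function on $\mathbb{C}$. Then $\Theta(x)=e^{i\arg\Theta(x)}$ on $\mathbb{R}$ with $\arg\Theta$ a continuous (in fact real-analytic, increasing) branch of the argument; the choice of branch, i.e. of the additive constant, is immaterial.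 The model space is $K_\Theta=H^2\ominus\Theta H^2$, the orthogonal complement of $\Theta H^2$ in the Hardy space $H^2$ of $\mathbb{C}_+$; elements are identified with their boundary functions on $\mathbb{R}$. A smooth strictly increasing map $\alpha:\mathbb{R}\to\mathbb{R}$ is a regular locally doubling weight if, with $d_\alpha(x,y)=|\alpha(x)-\alpha(y)|$: (i) there are constants $M,m>0$ and $R>0$ with $m\alpha'(y)\le\alpha'(x)\le M\alpha'(y)$ for all $x,y$ with $d_\alpha(x,y)\le1$ and $|x|,|y|\ge R$; and (ii) there are constants $C>0$ and $R>0$ with $|\alpha''(x)|\le C\alpha'(x)^2$ for $|x|\ge R$. *)

theory Defs
  imports "HOL-Complex_Analysis.Complex_Analysis"
begin

definition upper_half_plane :: "complex set" where
  "upper_half_plane = {z. Im z > 0}"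

definition poisson_measure :: "real measure" where
  "poisson_measure = density lebesgue (\<lambda>t. ennreal (1 / (1 + t\<^sup>2)))"

definition japanese_bracket :: "real \<Rightarrow> real" where
  "japanese_bracket x = sqrt (1 + x\<^sup>2)"

text \<open>
  The principal value is taken at \<open>t = x\<close> only: away from \<open>x\<close> the kernel equals
  \<open>(1 + x t) / ((x - t) (1 + t\<^sup>2))\<close> and is \<open>O(1 / (1 + t\<^sup>2))\<close>, so the truncated integrals
  converge absolutely whenever \<open>u\<close> is integrable with respect to \<^const>\<open>poisson_measure\<close>.
\<close>

definition has_hilbert_transform_at :: "(real \<Rightarrow> real) \<Rightarrow> real \<Rightarrow> real \<Rightarrow> bool" where
  "has_hilbert_transform_at u v x \<longleftrightarrow>
     ((\<lambda>e. 1 / pi * (LINT t:{t. e < \<bar>x - t\<bar>}|lebesgue. (1 / (x - t) + t / (1 + t\<^sup>2)) * u t))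
        \<longlongrightarrow> v) (at_right 0)"

text \<open>
  The principal value of a function in \<open>L\<^sup>1\<close> of the Poisson measure exists almost everywhere,
  so the transform is determined only up to null sets.
\<close>

definition is_hilbert_transform :: "(real \<Rightarrow> real) \<Rightarrow> (real \<Rightarrow> real) \<Rightarrow> bool" where
  "is_hilbert_transform u v \<longleftrightarrow> (AE x in lebesgue. has_hilbert_transform_at u (v x) x)"

definition smooth_real :: "(real \<Rightarrow> real) \<Rightarrow> bool" where
  "smooth_real f \<longleftrightarrow> (\<forall>n. (deriv ^^ n) f differentiable_on UNIV)"

definition regular_locally_doubling :: "(real \<Rightarrow> real) \<Rightarrow> bool" where
  "regular_locally_doubling \<alpha> \<longleftrightarrow>
     smooth_real \<alpha> \<and> strict_mono \<alpha> \<and>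
     (\<exists>M m R. M > 0 \<and> m > 0 \<and> R > 0 \<and>
        (\<forall>x y. \<bar>\<alpha> x - \<alpha> y\<bar> \<le> 1 \<and> \<bar>x\<bar> \<ge> R \<and> \<bar>y\<bar> \<ge> R \<longrightarrow>
           m * deriv \<alpha> y \<le> deriv \<alpha> x \<and> deriv \<alpha> x \<le> M * deriv \<alpha> y)) \<and>
     (\<exists>C R. C > 0 \<and> R > 0 \<and>
        (\<forall>x. \<bar>x\<bar> \<ge> R \<longrightarrow> \<bar>deriv (deriv \<alpha>) x\<bar> \<le> C * (deriv \<alpha> x)\<^sup>2))"

text \<open>
  Functions on the upper half-plane are represented by total functions whose values outside
  it are irrelevant.
\<close>

definition inner_function :: "(complex \<Rightarrow> complex) \<Rightarrow> bool" where
  "inner_function \<Theta> \<longleftrightarrow>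
     \<Theta> holomorphic_on upper_half_plane \<and>
     \<Theta> ` upper_half_plane \<subseteq> ball 0 1 \<and>
     (AE x in lebesgue. ((\<lambda>y. cmod (\<Theta> (Complex x y))) \<longlongrightarrow> 1) (at_right 0))"

definition meromorphic_inner_function :: "(complex \<Rightarrow> complex) \<Rightarrow> bool" where
  "meromorphic_inner_function \<Theta> \<longleftrightarrow>
     inner_function \<Theta> \<and>
     (\<exists>F. F meromorphic_on UNIV \<and> (\<forall>z\<in>upper_half_plane. F z = \<Theta> z))"

text \<open>
  Being bounded by 1 on the upper half-plane, the meromorphic extension has no pole on the real
  line, so its value at a real point is the limit from the upper half-plane.
\<close>

definition is_boundary_argument :: "(complex \<Rightarrow> complex) \<Rightarrow> (real \<Rightarrow> real) \<Rightarrow> bool" where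
  "is_boundary_argument \<Theta> \<phi> \<longleftrightarrow>
     continuous_on UNIV \<phi> \<and>
     (\<forall>x. (\<Theta> \<longlongrightarrow> exp (\<i> * of_real (\<phi> x))) (at (of_real x) within upper_half_plane))"

definition hardy2 :: "(complex \<Rightarrow> complex) set" where
  "hardy2 = {F. F holomorphic_on upper_half_plane \<and>
     (SUP y\<in>{0<..}. \<integral>\<^sup>+ x. ennreal ((cmod (F (Complex x y)))\<^sup>2) \<partial>lebesgue) < \<infinity>}"

definition has_boundary_function :: "(complex \<Rightarrow> complex) \<Rightarrow> (real \<Rightarrow> complex) \<Rightarrow> bool" where
  "has_boundary_function F f \<longleftrightarrow>
     f \<in> borel_measurable lebesgue \<and>
     (AE x in lebesgue. ((\<lambda>y. F (Complex x y)) \<longlongrightarrow> f x) (at_right 0))"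

definition hardy2_boundary :: "(real \<Rightarrow> complex) set" where
  "hardy2_boundary = {f. \<exists>F\<in>hardy2. has_boundary_function F f}"

definition inner_hardy2_boundary :: "(complex \<Rightarrow> complex) \<Rightarrow> (real \<Rightarrow> complex) set" where
  "inner_hardy2_boundary \<Theta> = {h. \<exists>G\<in>hardy2. has_boundary_function (\<lambda>z. \<Theta> z * G z) h}"

text \<open>
  Boundary functions of \<open>H\<^sup>2\<close> are square integrable and the \<open>H\<^sup>2\<close> inner product is the
  \<open>L\<^sup>2\<close> inner product of boundary functions.
\<close>

definition l2_inner :: "(real \<Rightarrow> complex) \<Rightarrow> (real \<Rightarrow> complex) \<Rightarrow> complex" where
  "l2_inner f g = (LINT x|lebesgue. f x * cnj (g x))"

definition model_space :: "(complex \<Rightarrow> complex) \<Rightarrow> (real \<Rightarrow> complex) set" where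
  "model_space \<Theta> = {f \<in> hardy2_boundary. \<forall>h\<in>inner_hardy2_boundary \<Theta>. l2_inner f h = 0}"

text \<open>
  Elements of a space of boundary functions are not identified when they agree almost
  everywhere, so being non-trivial means not vanishing almost everywhere.
\<close>

definition admissible_majorant :: "(real \<Rightarrow> real) \<Rightarrow> (real \<Rightarrow> complex) set \<Rightarrow> bool" where
  "admissible_majorant \<omega> K \<longleftrightarrow>
     (\<exists>f\<in>K. \<not> (AE x in lebesgue. f x = 0) \<and> (AE x in lebesgue. cmod (f x) \<le> \<omega> x))"

end

theory Submission
  imports Defs
begin

text \<open>
  For \<open>u\<close> integrable against the Poisson measure let \<open>S u\<close> be its Schwarz integral, with boundary
  values \<open>u + \<i> u~\<close>. The idea is to take \<open>F = \<kappa> exp (- S \<Omega> + (\<i>/2) S \<beta>) / (z + \<i> a)\<^sup>2\<^sup>m\<close> with a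
  bounded \<open>\<beta>\<close> such that \<open>\<alpha>(x) - 4 m arctan (x/a) - \<beta>(x)\<close> takes values in \<open>2\<pi>\<int>\<close>: then the boundary
  function satisfies \<open>f / cnj f = \<Theta>\<close> and \<open>f\<close> is orthogonal to \<open>\<Theta> H\<^sup>2\<close> as soon as \<open>F\<close> decays. For
  large \<open>a\<close> the function \<open>\<gamma>(x) = \<alpha>(x) - 4 m arctan (x/a)\<close> is still increasing because \<open>\<alpha>'\<close> is bounded
  below, and \<open>\<beta>\<close> is its sawtooth \<open>\<gamma> - 2\<pi> \<lfloor>\<gamma> / 2\<pi>\<rfloor>\<close>. All jumps of \<open>\<beta>\<close> go down, so
  \<open>\<beta>(x + s) - \<beta>(x - s)\<close> is bounded above by \<open>O((2 + \<bar>x\<bar>)\<^sup>K s)\<close>; this one-sided bound near the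
  diagonal and the boundedness of \<open>\<beta>\<close> away from it give
  \<open>\<bar>exp ((\<i>/2) S \<beta>)\<bar> \<le> C (2 + \<bar>z\<bar>)\<^sup>A\<close> with \<open>A = 4 + 2 K\<close> independent of \<open>m\<close>. Choosing \<open>2 m \<ge> A + 2\<close>
  yields \<open>\<bar>F\<bar> \<le> exp (- Re (S \<Omega>)) / (1 + \<bar>z\<bar>)\<^sup>2\<close>, hence \<open>F \<in> H\<^sup>2\<close> and \<open>\<bar>f\<bar> \<le> \<omega>\<close>.
\<close>

section \<open>Lebesgue points and the Poisson kernel\<close>

text \<open>The condition \<open>f / cnj f\<close> = \<Theta> sees only twice the argument of f, so
  \<beta> is free up to multiples of 2 pi. This freedom is essential: \<gamma> increases at least
  linearly, hence is not integrable against the Poisson measure and has no Schwarz integral, while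
  its reduction modulo 2 pi is bounded. The price is the jumps. At a jump by -2 pi the conjugate
  function of \<beta> tends to plus infinity like -2 times the logarithm of the distance, so the
  modulus of \<open>exp ((\<i>/2) S \<beta>)\<close> vanishes there to first order; an upward jump
  would produce a pole instead. Hence the monotonicity of \<gamma> matters, and an upper bound for
  symmetric increments takes the place of a Lipschitz condition. The choices are not circular
  although m depends on the growth exponent and \<beta> on m: subtracting an increasing arctan only
  lowers increments, and the sawtooth is bounded by 2 pi for every m and a. The even power 2m makes
  the constant part of the argument of the denominator a multiple of pi, which
  \<open>f / cnj f\<close> does not see.\<close>

definition poisson_integrable :: "(real \<Rightarrow> real) \<Rightarrow> bool" where
  "poisson_integrable u \<longleftrightarrow> u \<in> borel_measurable borel \<and> integrable lborel (\<lambda>t. u t / (1 + t\<^sup>2))"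

definition is_lebesgue_point :: "(real \<Rightarrow> real) \<Rightarrow> real \<Rightarrow> bool" where
  "is_lebesgue_point u x \<longleftrightarrow> (\<forall>e>0. \<exists>d>0. \<forall>h. 0 < h \<and> h \<le> d \<longrightarrow>
     (LBINT t:{x-h..x+h}. \<bar>u t - u x\<bar>) \<le> e * h)"

lemma one_plus_square_pos: "0 < 1 + (t::real)\<^sup>2"
  by (smt (verit) zero_le_power2)

lemma poisson_integrable_abs_bound:
  assumes "poisson_integrable u" "g \<in> borel_measurable borel"
    and "\<And>t. norm (g t) \<le> C / (1 + t\<^sup>2) * \<bar>u t\<bar>"
  shows "integrable lborel (g :: real \<Rightarrow> 'b::{banach, second_countable_topology})"
proof (rule Bochner_Integration.integrable_bound)
  show "integrable lborel (\<lambda>t. \<bar>C\<bar> * \<bar>u t / (1 + t\<^sup>2)\<bar>)"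
    using assms(1) unfolding poisson_integrable_def by (intro integrable_mult_right integrable_abs) simp
  show "AE t in lborel. norm (g t) \<le> norm (\<bar>C\<bar> * \<bar>u t / (1 + t\<^sup>2)\<bar>)"
  proof (rule AE_I2)
    fix t
    have "C / (1 + t\<^sup>2) * \<bar>u t\<bar> \<le> \<bar>C\<bar> * \<bar>u t / (1 + t\<^sup>2)\<bar>"
      using one_plus_square_pos[of t]
      by (simp add: abs_mult divide_simps mult_right_mono)
    then show "norm (g t) \<le> norm (\<bar>C\<bar> * \<bar>u t / (1 + t\<^sup>2)\<bar>)"
      using assms(3)[of t] by (simp add: abs_mult)
  qed
qed (use assms(2) in simp)

lemma integrable_cauchy: "integrable lborel (\<lambda>t::real. 1 / (1 + t\<^sup>2))"
  and integral_cauchy: "(LBINT t. 1 / (1 + (t::real)\<^sup>2)) = pi"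
proof -
  have d: "DERIV arctan x :> 1 / (1 + x\<^sup>2)" for x
    using DERIV_arctan[of x] by (simp add: inverse_eq_divide)
  have c: "isCont (\<lambda>t::real. 1 / (1 + t\<^sup>2)) x" for x
    using one_plus_square_pos[of x] by (intro continuous_intros) simp
  note FTC = interval_integral_FTC_nonneg[where a = "-\<infinity>" and b = "\<infinity>" and F = arctan
      and f = "\<lambda>t::real. 1 / (1 + t\<^sup>2)" and A = "-(pi/2)" and B = "pi/2", OF _ d c]
  have t: "((arctan \<circ> real_of_ereal) \<longlongrightarrow> - (pi / 2)) (at_right (- \<infinity>))"
    "((arctan \<circ> real_of_ereal) \<longlongrightarrow> pi / 2) (at_left \<infinity>)"
    using tendsto_arctan_at_bot tendsto_arctan_at_top by (simp_all add: ereal_tendsto_simps)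
  have n: "AE x in lborel. - \<infinity> < ereal x \<longrightarrow> ereal x < \<infinity> \<longrightarrow> 0 \<le> 1 / (1 + x\<^sup>2)"
    using one_plus_square_pos by (intro AE_I2) (simp add: less_imp_le)
  show "integrable lborel (\<lambda>t::real. 1 / (1 + t\<^sup>2))"
    using FTC(1)[OF _ n t] by (simp add: set_integrable_def)
  show "(LBINT t. 1 / (1 + (t::real)\<^sup>2)) = pi"
    using FTC(2)[OF _ n t] by (simp add: interval_lebesgue_integral_def set_lebesgue_integral_def)
qed

lemma poisson_integrable_locally:
  assumes "poisson_integrable u"
  shows "set_integrable lborel {a..b} u"
proof -
  have "integrable lborel (\<lambda>t. indicator {a..b} t *\<^sub>R u t)"
  proof (rule poisson_integrable_abs_bound[OF assms, where C = "1 + (\<bar>a\<bar> + \<bar>b\<bar>)\<^sup>2"])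
    show "(\<lambda>t. indicator {a..b} t *\<^sub>R u t) \<in> borel_measurable borel"
      using assms by (auto simp: poisson_integrable_def)
    show "norm (indicator {a..b} t *\<^sub>R u t) \<le> (1 + (\<bar>a\<bar> + \<bar>b\<bar>)\<^sup>2) / (1 + t\<^sup>2) * \<bar>u t\<bar>" for t
    proof (cases "t \<in> {a..b}")
      case True
      then have "t\<^sup>2 \<le> (\<bar>a\<bar> + \<bar>b\<bar>)\<^sup>2" by (intro power2_le_iff_abs_le[THEN iffD2]) auto
      then have "1 \<le> (1 + (\<bar>a\<bar> + \<bar>b\<bar>)\<^sup>2) / (1 + t\<^sup>2)"
        using one_plus_square_pos[of t] by (simp add: divide_simps)
      from mult_right_mono[OF this abs_ge_zero[of "u t"]] True show ?thesis by simp
    qed (simp add: one_plus_square_pos less_imp_le)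
  qed
  then show ?thesis by (simp add: set_integrable_def)
qed

lemma poisson_integrable_const: "poisson_integrable (\<lambda>_. c)"
  using integrable_cauchy by (simp add: poisson_integrable_def divide_inverse)

lemma poisson_integrable_diff:
  "poisson_integrable u \<Longrightarrow> poisson_integrable v \<Longrightarrow> poisson_integrable (\<lambda>t. u t - v t)"
  by (auto simp: poisson_integrable_def diff_divide_distrib)

lemma poisson_integrable_abs:
  "poisson_integrable u \<Longrightarrow> poisson_integrable (\<lambda>t. \<bar>u t\<bar>)"
  unfolding poisson_integrable_def
  using integrable_abs[of lborel "\<lambda>t. u t / (1 + t\<^sup>2)"] one_plus_square_pos
  by (auto simp: less_imp_le intro: borel_measurable_abs)

lemma poisson_integrable_reflect:
  assumes "poisson_integrable u"
  shows "poisson_integrable (\<lambda>t. u (- t))"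
proof -
  have "integrable lborel (\<lambda>t. u (0 + (-1) * t) / (1 + (0 + (-1) * t)\<^sup>2))"
    using lborel_integrable_real_affine[of "\<lambda>t. u t / (1 + t\<^sup>2)" "-1" 0] assms
    by (simp add: poisson_integrable_def)
  moreover have "(\<lambda>t. u (- t)) \<in> borel_measurable borel"
    using assms unfolding poisson_integrable_def
    by (intro measurable_compose[where f = uminus and N = borel and g = u]) auto
  ultimately show ?thesis by (simp add: poisson_integrable_def)
qed

section \<open>Lebesgue differentiation on the line\<close>

lemma right_averages:
  assumes "poisson_integrable u"
  shows "AE x in lborel. \<forall>e>0. \<exists>d>0. \<forall>h. 0 < h \<and> h < d \<longrightarrow>
     \<bar>(LBINT t:{x..x+h}. u t) / h - u x\<bar> < e"
proof -
  have loc: "u integrable_on cbox a b" for a b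
    using set_borel_integral_eq_integral(1)[OF poisson_integrable_locally[OF assms, of a b]] by simp
  obtain N where N: "negligible N"
       "\<And>x e. \<lbrakk>x \<notin> N; 0 < e\<rbrakk> \<Longrightarrow> \<exists>d>0. \<forall>h. 0 < h \<and> h < d \<longrightarrow>
            norm(integral (cbox x (x + h *\<^sub>R One)) u /\<^sub>R h ^ DIM(real) - u x) < e"
    using integrable_ccontinuous_explicit[OF loc] by metis
  have "AE x in lebesgue. x \<notin> N"
    using N(1) by (auto simp: negligible_iff_null_sets intro: AE_not_in)
  then have "AE x in lborel. x \<notin> N" by (simp add: AE_completion_iff)
  then show ?thesis
  proof eventually_elim
    case (elim x)
    show ?case
      using N(2)[OF elim]
      by (simp add: set_borel_integral_eq_integral(2)[OF poisson_integrable_locally[OF assms]]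
          divide_inverse mult.commute)
  qed
qed

text \<open>The differentiation theorem behind \<open>right_averages\<close> uses intervals with x
  as their left endpoint; averages on the other side come from reflecting u at the origin.\<close>

lemma left_averages:
  assumes "poisson_integrable u"
  shows "AE x in lborel. \<forall>e>0. \<exists>d>0. \<forall>h. 0 < h \<and> h < d \<longrightarrow>
     \<bar>(LBINT t:{x-h..x}. u t) / h - u x\<bar> < e"
proof -
  have eq: "(LBINT t:{-x..-x+h}. u (-t)) = (LBINT t:{x-h..x}. u t)" for x h
  proof -
    have "(LBINT t. indicator {x-h..x} t *\<^sub>R u t)
       = (LBINT t. indicator {x-h..x} (0 + (-1)*t) *\<^sub>R u (0 + (-1)*t))"
      using lborel_integral_real_affine[of "-1" "\<lambda>t. indicator {x-h..x} t *\<^sub>R u t" 0] by simp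
    also have "\<dots> = (LBINT t. indicator {-x..-x+h} t *\<^sub>R u (-t))"
      by (intro Bochner_Integration.integral_cong) (auto simp: indicator_def)
    finally show ?thesis by (simp add: set_lebesgue_integral_def)
  qed
  have "AE x in distr lborel borel uminus. \<forall>e>0. \<exists>d>0. \<forall>h. 0 < h \<and> h < d \<longrightarrow>
     \<bar>(LBINT t:{x..x+h}. u (-t)) / h - u (-x)\<bar> < e"
    using right_averages[OF poisson_integrable_reflect[OF assms]]
    by (subst lborel_distr_uminus)
  then have "AE x in lborel. \<forall>e>0. \<exists>d>0. \<forall>h. 0 < h \<and> h < d \<longrightarrow>
     \<bar>(LBINT t:{-x..-x+h}. u (-t)) / h - u (- (-x))\<bar> < e"
    by (rule AE_distrD[rotated]) simp
  then show ?thesis unfolding eq by simp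
qed

lemma poisson_integrable_affine_abs:
  assumes "poisson_integrable u"
  shows "poisson_integrable (\<lambda>t. \<bar>u t - c\<bar>)"
  using poisson_integrable_abs[OF poisson_integrable_diff[OF assms poisson_integrable_const]] .

text \<open>The function to be averaged depends on the point through \<open>u x\<close>.
  Differentiating \<bar>u - q\<bar> for all rational q at once costs only countably many null sets,
  and \<open>u x\<close> is then approximated by a rational.\<close>

lemma lebesgue_points:
  assumes "poisson_integrable u"
  shows "AE x in lborel. is_lebesgue_point u x"
proof -
  let ?g = "\<lambda>q t. \<bar>u t - q\<bar>"
  have "AE x in lborel. \<forall>q\<in>\<rat>. (\<forall>e>0. \<exists>d>0. \<forall>h. 0 < h \<and> h < d \<longrightarrow>
     \<bar>(LBINT t:{x..x+h}. ?g q t) / h - ?g q x\<bar> < e) \<and> (\<forall>e>0. \<exists>d>0. \<forall>h. 0 < h \<and> h < d \<longrightarrow>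
     \<bar>(LBINT t:{x-h..x}. ?g q t) / h - ?g q x\<bar> < e)"
    using right_averages[OF poisson_integrable_affine_abs[OF assms]]
      left_averages[OF poisson_integrable_affine_abs[OF assms]]
    by (subst AE_ball_countable) (auto simp: countable_rat)
  then show ?thesis
  proof eventually_elim
    case (elim x)
    show ?case
      unfolding is_lebesgue_point_def
    proof (intro allI impI)
      fix e :: real assume "e > 0"
      \<comment> \<open>With q this close, each half interval contributes at most h * e/4 and
        replacing q by \<open>u x\<close> costs 2 * h * e/8, in total 3/4 * e * h.\<close>
      obtain q where q: "q \<in> \<rat>" "u x < q" "q < u x + e/8"
        using Rats_dense_in_real[of "u x" "u x + e/8"] \<open>e > 0\<close> by auto
      have e8: "e / 8 > 0" using \<open>e > 0\<close> by simp
      obtain d1 where d1: "d1 > 0" "\<And>h. 0 < h \<Longrightarrow> h < d1 \<Longrightarrow>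
          \<bar>(LBINT t:{x..x+h}. ?g q t) / h - ?g q x\<bar> < e/8"
        using conjunct1[OF bspec[OF elim q(1)], rule_format, OF e8] by blast
      obtain d2 where d2: "d2 > 0" "\<And>h. 0 < h \<Longrightarrow> h < d2 \<Longrightarrow>
          \<bar>(LBINT t:{x-h..x}. ?g q t) / h - ?g q x\<bar> < e/8"
        using conjunct2[OF bspec[OF elim q(1)], rule_format, OF e8] by blast
      have int: "set_integrable lborel {a..b} (?g q)" "set_integrable lborel {a..b} (?g (u x))"
        "set_integrable lborel {a..b} (\<lambda>_. c)" for a b and c :: real
        using poisson_integrable_affine_abs[OF assms] poisson_integrable_const
        by (auto intro!: poisson_integrable_locally)
      show "\<exists>d>0. \<forall>h. 0 < h \<and> h \<le> d \<longrightarrow> (LBINT t:{x-h..x+h}. \<bar>u t - u x\<bar>) \<le> e * h"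
      proof (intro exI[of _ "min d1 d2 / 2"] conjI allI impI)
        fix h assume h: "0 < h \<and> h \<le> min d1 d2 / 2"
        have "(LBINT t:{x-h..x+h}. \<bar>u t - u x\<bar>)
            \<le> (LBINT t. indicator {x-h..x} t *\<^sub>R ?g q t + indicator {x..x+h} t *\<^sub>R ?g q t
                 + indicator {x-h..x+h} t *\<^sub>R (e/8))"
          unfolding set_lebesgue_integral_def
        proof (rule integral_mono)
          fix t
          show "indicator {x - h..x + h} t *\<^sub>R \<bar>u t - u x\<bar>
             \<le> indicator {x-h..x} t *\<^sub>R ?g q t + indicator {x..x+h} t *\<^sub>R ?g q t
                 + indicator {x-h..x+h} t *\<^sub>R (e/8)"
            using q h by (auto simp: indicator_def)
        qed (use int in \<open>auto simp: set_integrable_def\<close>)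
        also have "\<dots> = (LBINT t:{x-h..x}. ?g q t) + (LBINT t:{x..x+h}. ?g q t) + 2 * h * (e/8)"
          using int h by (simp add: set_integrable_def set_lebesgue_integral_def)
        also have "(LBINT t:{x-h..x}. ?g q t) \<le> h * (e/4)"
        proof -
          have "\<bar>(LBINT t:{x-h..x}. ?g q t) / h - ?g q x\<bar> < e/8" by (rule d2(2)) (use h in auto)
          moreover have "?g q x \<le> e/8" using q by auto
          ultimately have "(LBINT t:{x-h..x}. ?g q t) / h \<le> e/4" by linarith
          then show ?thesis using h by (simp add: divide_simps mult.commute)
        qed
        also have "(LBINT t:{x..x+h}. ?g q t) \<le> h * (e/4)"
        proof -
          have "\<bar>(LBINT t:{x..x+h}. ?g q t) / h - ?g q x\<bar> < e/8" by (rule d1(2)) (use h in auto)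
          moreover have "?g q x \<le> e/8" using q by auto
          ultimately have "(LBINT t:{x..x+h}. ?g q t) / h \<le> e/4" by linarith
          then show ?thesis using h by (simp add: divide_simps mult.commute)
        qed
        finally show "(LBINT t:{x-h..x+h}. \<bar>u t - u x\<bar>) \<le> e * h"
          using mult_pos_pos[OF \<open>e > 0\<close>, of h] h by (simp add: mult_ac)
      qed (use d1 d2 in auto)
    qed
  qed
qed

text \<open>If k is the least index with s \<le> 2^k * y, then s exceeds 2^(k-1) * y unless k = 0,
  and the kernel is at most 4 / (y * 4^k); that single summand suffices. The intervals are cut at d
  because the estimate at a Lebesgue point is available only for radii up to d.\<close>

lemma dyadic_domination:
  fixes s y d :: real
  assumes "0 < y" "0 \<le> s" "s \<le> d" "d \<le> 2 ^ n * y"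
  shows "y / (s\<^sup>2 + y\<^sup>2) \<le> (\<Sum>k\<le>n. 4 / (y * 4 ^ k) * indicator {..min (2 ^ k * y) d} s)"
proof -
  have "\<exists>k. s \<le> 2 ^ k * y" using assms order_trans by blast
  define k where "k = (LEAST k. s \<le> 2 ^ k * y)"
  have k: "s \<le> 2 ^ k * y" unfolding k_def by (rule LeastI_ex) fact
  have kn: "k \<le> n" unfolding k_def using assms by (intro Least_le) auto
  have "y / (s\<^sup>2 + y\<^sup>2) \<le> 4 / (y * 4 ^ k)"
  proof (cases k)
    case 0
    have "y * y \<le> 4 * (s\<^sup>2 + y\<^sup>2)" by (simp add: power2_eq_square)
    then show ?thesis using 0 assms by (simp add: divide_simps power2_eq_square add_nonneg_pos)
  next
    case (Suc j)
    then have "2 ^ j * y < s" using not_less_Least[of j "\<lambda>k. s \<le> 2 ^ k * y"] by (auto simp: k_def)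
    then have "(2 ^ j * y)\<^sup>2 \<le> s\<^sup>2" using assms by (intro power_mono) auto
    moreover have "(2 ^ j * y)\<^sup>2 = 4 ^ j * y\<^sup>2" by (simp add: power_mult_distrib power2_eq_square flip: power_mult_distrib[of 2 2 j])
    ultimately have "4 ^ j * y\<^sup>2 \<le> s\<^sup>2" by simp
    then have "4 ^ j * y\<^sup>2 \<le> s\<^sup>2 + y\<^sup>2" by (rule order_trans) simp
    moreover have "0 < s\<^sup>2 + y\<^sup>2" using assms by (simp add: add_nonneg_pos)
    ultimately show ?thesis using Suc assms by (simp add: divide_simps power2_eq_square algebra_simps)
  qed
  also have "\<dots> = 4 / (y * 4 ^ k) * indicator {..min (2 ^ k * y) d} s"
    using k assms by simp
  also have "\<dots> \<le> (\<Sum>k\<le>n. 4 / (y * 4 ^ k) * indicator {..min (2 ^ k * y) d} s)"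
    using kn assms by (intro member_le_sum) auto
  finally show ?thesis .
qed

lemma inverse_square_bound:
  fixes x t d :: real
  assumes "0 < d" "d \<le> \<bar>x - t\<bar>"
  shows "1 / (x - t)\<^sup>2 \<le> (2 + (1 + 2 * x\<^sup>2) / d\<^sup>2) / (1 + t\<^sup>2)"
proof -
  have d: "d\<^sup>2 \<le> (x - t)\<^sup>2" using assms by (metis abs_ge_zero less_imp_le power2_abs power_mono)
  have "0 < (x - t)\<^sup>2" using assms by auto
  \<comment> \<open>Expanded, this is t^2 \<le> 2 * (x - t)^2 + 2 * x^2.\<close>
  have "0 \<le> (2 * x - t)\<^sup>2" by simp
  then have "1 + t\<^sup>2 \<le> 2 * (x - t)\<^sup>2 + (1 + 2 * x\<^sup>2) * 1"
    by (simp add: power2_eq_square algebra_simps)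
  also have "\<dots> \<le> 2 * (x - t)\<^sup>2 + (1 + 2 * x\<^sup>2) * ((x - t)\<^sup>2 / d\<^sup>2)"
    using d assms by (intro add_left_mono mult_left_mono) auto
  also have "\<dots> = (2 + (1 + 2 * x\<^sup>2) / d\<^sup>2) * (x - t)\<^sup>2"
    by (simp add: ring_distribs)
  finally show ?thesis
    using \<open>0 < (x - t)\<^sup>2\<close> one_plus_square_pos[of t] by (simp add: pos_divide_le_eq pos_le_divide_eq)
qed

text \<open>Within distance d, the interval of radius about 2^k * y carries mass at most e * 2^k * y
  and weight 4 / (y * 4^k), so the scales sum to a geometric series bounded by 8 * e. Beyond d the
  kernel is y times a function comparable to the Poisson density, and that part is O(y).\<close>

lemma poisson_kernel_lebesgue_point:
  assumes u: "poisson_integrable u" and x: "is_lebesgue_point u x"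
  shows "((\<lambda>y. LBINT t. y / ((x - t)\<^sup>2 + y\<^sup>2) * \<bar>u t - u x\<bar>) \<longlongrightarrow> 0) (at_right 0)"
proof (rule tendstoI)
  fix e0 :: real assume "e0 > 0"
  \<comment> \<open>The near part is at most 8 * e = e0 / 2, which leaves room for the O(y)
    term.\<close>
  define e where "e = e0 / 16"
  have "e > 0" using \<open>e0 > 0\<close> by (simp add: e_def)
  define g where "g t = \<bar>u t - u x\<bar>" for t
  have g: "poisson_integrable g" unfolding g_def by (rule poisson_integrable_affine_abs[OF u])
  have gm [measurable]: "g \<in> borel_measurable borel" using g by (simp add: poisson_integrable_def)
  have g0: "g t \<ge> 0" for t by (simp add: g_def)
  obtain d where d: "d > 0" "\<And>h. 0 < h \<Longrightarrow> h \<le> d \<Longrightarrow> (LBINT t:{x-h..x+h}. g t) \<le> e * h"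
    using x \<open>e > 0\<close> unfolding is_lebesgue_point_def g_def by meson
  define C where "C = 2 + (1 + 2 * x\<^sup>2) / d\<^sup>2"
  have "C > 0" unfolding C_def using d by (intro add_pos_nonneg) auto
  define I where "I = (LBINT t. g t / (1 + t\<^sup>2))"
  have main: "(LBINT t. y / ((x - t)\<^sup>2 + y\<^sup>2) * g t) \<le> 8 * e + y * C * I" if y: "y > 0" for y
  proof -
    obtain n where n: "d \<le> 2 ^ n * y"
    proof -
      obtain n where "d / y < 2 ^ n" using real_arch_pow[of 2 "d / y"] by auto
      then have "d \<le> 2 ^ n * y" using y by (simp add: pos_divide_less_eq less_imp_le)
      then show ?thesis using that by blast
    qed
    define r where "r k = min (2 ^ k * y) d" for k :: nat
    have r: "0 < r k" "r k \<le> d" "r k \<le> 2 ^ k * y" for k using d y by (auto simp: r_def)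
    have ig: "integrable lborel (\<lambda>t. indicator {x - r k..x + r k} t * g t)" for k
      using poisson_integrable_locally[OF g, of "x - r k" "x + r k"] by (simp add: set_integrable_def)
    have "(LBINT t. y / ((x - t)\<^sup>2 + y\<^sup>2) * g t) \<le> (LBINT t.
        (\<Sum>k\<le>n. 4 / (y * 4 ^ k) * (indicator {x - r k..x + r k} t * g t)) + y * C * (g t / (1 + t\<^sup>2)))"
    proof (rule integral_mono')
      show "integrable lborel (\<lambda>t. (\<Sum>k\<le>n. 4 / (y * 4 ^ k) * (indicator {x - r k..x + r k} t * g t))
          + y * C * (g t / (1 + t\<^sup>2)))"
        using ig g by (intro Bochner_Integration.integrable_add Bochner_Integration.integrable_sum integrable_mult_right)
          (auto simp: poisson_integrable_def)
      fix t
      have S0: "0 \<le> (\<Sum>k\<le>n. 4 / (y * 4 ^ k) * (indicator {x - r k..x + r k} t * g t))"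
        using g0 y by (intro sum_nonneg) auto
      have F0: "0 \<le> y * C * (g t / (1 + t\<^sup>2))"
        using g0 y \<open>C > 0\<close> one_plus_square_pos[of t] by (simp add: less_imp_le)
      have "y / ((x - t)\<^sup>2 + y\<^sup>2) * g t \<le> (\<Sum>k\<le>n. 4 / (y * 4 ^ k) * (indicator {x - r k..x + r k} t * g t))"
        if "\<bar>x - t\<bar> \<le> d"
      proof -
        have "y / (\<bar>x - t\<bar>\<^sup>2 + y\<^sup>2) \<le> (\<Sum>k\<le>n. 4 / (y * 4 ^ k) * indicator {..min (2 ^ k * y) d} \<bar>x - t\<bar>)"
          by (rule dyadic_domination) (use that n \<open>y > 0\<close> in auto)
        also have "\<dots> = (\<Sum>k\<le>n. 4 / (y * 4 ^ k) * indicator {x - r k..x + r k} t)"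
          by (intro sum.cong) (auto simp: indicator_def r_def)
        finally have "y / (\<bar>x - t\<bar>\<^sup>2 + y\<^sup>2) * g t
            \<le> (\<Sum>k\<le>n. 4 / (y * 4 ^ k) * indicator {x - r k..x + r k} t) * g t"
          by (rule mult_right_mono[OF _ g0])
        then show ?thesis by (simp add: sum_distrib_right mult.assoc)
      qed
      moreover have "y / ((x - t)\<^sup>2 + y\<^sup>2) * g t \<le> y * C * (g t / (1 + t\<^sup>2))" if "\<not> \<bar>x - t\<bar> \<le> d"
      proof -
        have "1 / ((x - t)\<^sup>2 + y\<^sup>2) \<le> 1 / (x - t)\<^sup>2"
          using that d by (intro divide_left_mono) (auto intro!: mult_pos_pos add_pos_nonneg)
        also have "\<dots> \<le> C / (1 + t\<^sup>2)"
          unfolding C_def by (rule inverse_square_bound) (use that d in auto)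
        finally have "1 / ((x - t)\<^sup>2 + y\<^sup>2) * (y * g t) \<le> C / (1 + t\<^sup>2) * (y * g t)"
          using g0 \<open>y > 0\<close> by (intro mult_right_mono) auto
        then show ?thesis by (simp add: mult_ac)
      qed
      ultimately show "y / ((x - t)\<^sup>2 + y\<^sup>2) * g t
         \<le> (\<Sum>k\<le>n. 4 / (y * 4 ^ k) * (indicator {x - r k..x + r k} t * g t)) + y * C * (g t / (1 + t\<^sup>2))"
        using S0 F0 by fastforce
      show "0 \<le> (\<Sum>k\<le>n. 4 / (y * 4 ^ k) * (indicator {x - r k..x + r k} t * g t)) + y * C * (g t / (1 + t\<^sup>2))"
        using S0 F0 by simp
    qed
    also have "\<dots> = (\<Sum>k\<le>n. 4 / (y * 4 ^ k) * (LBINT t:{x - r k..x + r k}. g t)) + y * C * I"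
      using ig g unfolding I_def set_lebesgue_integral_def
      by (subst Bochner_Integration.integral_add)
        (auto simp: poisson_integrable_def simp del: times_divide_eq_right)
    also have "(\<Sum>k\<le>n. 4 / (y * 4 ^ k) * (LBINT t:{x - r k..x + r k}. g t))
        \<le> (\<Sum>k\<le>n. 4 * e * (1/2) ^ k)"
    proof (rule sum_mono)
      fix k
      have "(LBINT t:{x - r k..x + r k}. g t) \<le> e * (2 ^ k * y)"
        using d(2)[of "r k"] r[of k] \<open>e > 0\<close> by (meson mult_left_mono less_imp_le order_trans)
      then have "4 / (y * 4 ^ k) * (LBINT t:{x - r k..x + r k}. g t) \<le> 4 / (y * 4 ^ k) * (e * (2 ^ k * y))"
        using y by (intro mult_left_mono) auto
      also have "\<dots> = 4 * e * (1/2) ^ k"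
      proof -
        have "(4::real) ^ k = 2 ^ k * 2 ^ k" by (simp flip: power_mult_distrib)
        then show ?thesis using y by (simp add: divide_simps)
      qed
      finally show "4 / (y * 4 ^ k) * (LBINT t:{x - r k..x + r k}. g t) \<le> 4 * e * (1/2) ^ k" .
    qed
    also have "\<dots> = 4 * e * (\<Sum>k\<le>n. (1/2) ^ k)" by (simp add: sum_distrib_left)
    also have "(\<Sum>k\<le>n. (1/2::real) ^ k) = 2 - (1/2) ^ n" by (induction n) auto
    finally have "(LBINT t. y / ((x - t)\<^sup>2 + y\<^sup>2) * g t) \<le> 4 * e * (2 - (1/2) ^ n) + y * C * I"
      by simp
    moreover have "4 * e * (2 - (1/2) ^ n) = 8 * e - 4 * (e * (1/2) ^ n)" by (simp add: algebra_simps)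
    moreover have "0 \<le> e * (1/2) ^ n" using \<open>e > 0\<close> by simp
    ultimately show ?thesis by linarith
  qed
  have "((\<lambda>y. 8 * e + y * C * I) \<longlongrightarrow> 8 * e + 0 * C * I) (at_right 0)"
    by (intro tendsto_intros)
  then have "eventually (\<lambda>y. 8 * e + y * C * I < e0) (at_right 0)"
    by (rule order_tendstoD) (use \<open>e0 > 0\<close> in \<open>simp add: e_def\<close>)
  moreover have "eventually (\<lambda>y::real. y > 0) (at_right 0)" by (simp add: eventually_at_right_less)
  ultimately show "eventually (\<lambda>y. dist (LBINT t. y / ((x - t)\<^sup>2 + y\<^sup>2) * \<bar>u t - u x\<bar>) 0 < e0) (at_right 0)"
  proof eventually_elim
    case (elim y)
    have "0 \<le> (LBINT t. y / ((x - t)\<^sup>2 + y\<^sup>2) * g t)"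
      using elim g0 by (intro integral_nonneg_AE AE_I2) auto
    then show ?case using main[OF elim(2)] elim by (simp add: g_def)
  qed
qed

section \<open>Integrals of holomorphic functions along horizontal lines\<close>

lemma uhp_open: "open upper_half_plane"
  unfolding upper_half_plane_def by (rule open_halfspace_Im_gt)

lemma uhp_convex: "convex upper_half_plane"
  unfolding upper_half_plane_def by (rule convex_halfspace_Im_gt)

lemma Complex_has_vector_derivative [derivative_intros]:
  "((\<lambda>t. Complex t y) has_vector_derivative 1) (at x within S)"
  "((\<lambda>t. Complex x t) has_vector_derivative \<i>) (at y within T)"
  by (auto simp: complex_eq_iff has_vector_derivative_def Complex_eq intro!: derivative_eq_intros)

lemma continuous_on_Complex_horizontal:
  assumes "continuous_on upper_half_plane H" "y > 0"
  shows "continuous_on UNIV (\<lambda>x. H (Complex x y))"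
  by (rule continuous_on_compose2[OF assms(1)])
    (use assms(2) in \<open>auto simp: upper_half_plane_def Complex_eq intro!: continuous_intros\<close>)

lemma continuous_on_Complex_vertical:
  assumes "continuous_on upper_half_plane H"
  shows "continuous_on {0<..} (\<lambda>y. H (Complex x y))"
  by (rule continuous_on_compose2[OF assms(1)])
    (auto simp: upper_half_plane_def Complex_eq intro!: continuous_intros)

text \<open>Cauchy's theorem for a rectangle: a primitive exists on the convex half-plane, so the
  difference of the horizontal sides equals that of the vertical ones. For negative R all horizontal
  intervals are empty.\<close>

lemma holomorphic_horizontal_shift:
  fixes H :: "complex \<Rightarrow> complex"
  assumes H: "H holomorphic_on upper_half_plane" and y: "0 < y1" "y1 < y2"
  shows "cmod ((LBINT x:{-R..R}. H (Complex x y1)) - (LBINT x:{-R..R}. H (Complex x y2)))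
    \<le> (LBINT y:{y1..y2}. cmod (H (Complex R y)) + cmod (H (Complex (-R) y)))"
proof (cases "R \<ge> 0")
  case True
  obtain P where P: "\<And>z. z \<in> upper_half_plane \<Longrightarrow> (P has_field_derivative H z) (at z within upper_half_plane)"
    using holomorphic_convex_primitive'[OF uhp_convex uhp_open H] by blast
  have P': "(P has_field_derivative H (Complex x y)) (at (Complex x y))" if "y > 0" for x y
  proof -
    have m: "Complex x y \<in> upper_half_plane" using that by (simp add: upper_half_plane_def)
    show ?thesis using P[OF m] unfolding at_within_open[OF m uhp_open] .
  qed
  have contH: "continuous_on upper_half_plane H" using H by (rule holomorphic_on_imp_continuous_on)
  have hor: "(LBINT x:{-R..R}. H (Complex x y)) = P (Complex R y) - P (Complex (-R) y)" if "y > 0" for y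
    unfolding set_lebesgue_integral_def
  proof (rule integral_FTC_Icc)
    show "- R \<le> R" using True by simp
    show "((\<lambda>x. P (Complex x y)) has_vector_derivative H (Complex x y)) (at x within {- R..R})" for x
      using field_vector_diff_chain_within[OF Complex_has_vector_derivative(1)
          has_field_derivative_at_within[OF P'[OF that]]] by (simp add: o_def)
    show "continuous_on {- R..R} (\<lambda>x. H (Complex x y))"
      by (rule continuous_on_subset[OF continuous_on_Complex_horizontal[OF contH that]]) simp
  qed
  have cv: "continuous_on {y1..y2} (\<lambda>y. H (Complex x y))" for x
    by (rule continuous_on_subset[OF continuous_on_Complex_vertical[OF contH]]) (use y in auto)
  have ver: "(LBINT y:{y1..y2}. \<i> * H (Complex x y)) = P (Complex x y2) - P (Complex x y1)" for x
    unfolding set_lebesgue_integral_def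
  proof (rule integral_FTC_Icc)
    show "y1 \<le> y2" using y by simp
    show "((\<lambda>y. P (Complex x y)) has_vector_derivative \<i> * H (Complex x v)) (at v within {y1..y2})"
      if "y1 \<le> v" "v \<le> y2" for v
      using field_vector_diff_chain_within[OF Complex_has_vector_derivative(2)
          has_field_derivative_at_within[OF P']] that y by (simp add: o_def)
    show "continuous_on {y1..y2} (\<lambda>y. \<i> * H (Complex x y))"
      by (intro continuous_intros cv)
  qed
  have intv: "set_integrable lborel {y1..y2} (\<lambda>y. cmod (H (Complex x y)))" for x
    by (intro borel_integrable_atLeastAtMost' continuous_intros cv)
  have bd: "cmod (P (Complex x y2) - P (Complex x y1)) \<le> (LBINT y:{y1..y2}. cmod (H (Complex x y)))" for x
    unfolding ver[symmetric] set_lebesgue_integral_def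
    by (rule order_trans[OF integral_norm_bound]) (simp add: norm_mult)
  have "cmod ((LBINT x:{-R..R}. H (Complex x y1)) - (LBINT x:{-R..R}. H (Complex x y2)))
     = cmod ((P (Complex (-R) y2) - P (Complex (-R) y1)) - (P (Complex R y2) - P (Complex R y1)))"
    using y by (simp add: hor algebra_simps)
  also have "\<dots> \<le> (LBINT y:{y1..y2}. cmod (H (Complex (-R) y))) + (LBINT y:{y1..y2}. cmod (H (Complex R y)))"
    by (intro order_trans[OF norm_triangle_ineq4] add_mono bd)
  also have "\<dots> = (LBINT y:{y1..y2}. cmod (H (Complex R y)) + cmod (H (Complex (-R) y)))"
    using set_integral_add(2)[OF intv[of R] intv[of "-R"]] by (simp add: add.commute)
  finally show ?thesis .
next
  case False
  have "0 \<le> (LBINT y:{y1..y2}. cmod (H (Complex R y)) + cmod (H (Complex (-R) y)))"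
    unfolding set_lebesgue_integral_def by (intro integral_nonneg_AE AE_I2) auto
  then show ?thesis using False by (simp add: set_lebesgue_integral_def)
qed

lemma emeasure_lborel_Ici: "emeasure lborel {a::real..} = \<infinity>"
proof -
  have "ennreal (real n) \<le> emeasure lborel {a..}" for n :: nat
  proof -
    have "ennreal (real n) = emeasure lborel {a..a + real n}" by simp
    also have "\<dots> \<le> emeasure lborel {a..}" by (intro emeasure_mono) auto
    finally show ?thesis .
  qed
  then show ?thesis
    by (metis ennreal_of_nat_eq_real_of_nat ennreal_SUP_of_nat_eq_top SUP_least top.extremum_uniqueI infinity_ennreal_def)
qed

text \<open>There is no pointwise decay to make the vertical sides vanish. Instead, the modulus of H
  is integrable over the strip by Tonelli, so the vertical contribution is an integrable function of
  R and cannot stay above D / 2 for all large R.\<close>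

lemma holomorphic_integral_horizontal_eq:
  fixes H :: "complex \<Rightarrow> complex"
  assumes H: "H holomorphic_on upper_half_plane" and y: "0 < y1" "y1 < y2"
    and bd: "\<And>y. 0 < y \<Longrightarrow> (\<integral>\<^sup>+ x. ennreal (cmod (H (Complex x y))) \<partial>lborel) \<le> ennreal B"
  shows "(LBINT x. H (Complex x y1)) = (LBINT x. H (Complex x y2))"
proof (rule ccontr)
  assume ne: "(LBINT x. H (Complex x y1)) \<noteq> (LBINT x. H (Complex x y2))"
  define D where "D = cmod ((LBINT x. H (Complex x y1)) - (LBINT x. H (Complex x y2)))"
  have "D > 0" using ne by (simp add: D_def)
  have contH: "continuous_on upper_half_plane H" using H by (rule holomorphic_on_imp_continuous_on)
  have int: "integrable lborel (\<lambda>x. H (Complex x y))" if "y > 0" for y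
  proof (rule integrableI_bounded)
    show "(\<lambda>x. H (Complex x y)) \<in> borel_measurable lborel"
      using continuous_on_Complex_horizontal[OF contH that] by (simp add: borel_measurable_continuous_onI)
    show "(\<integral>\<^sup>+ x. ennreal (cmod (H (Complex x y))) \<partial>lborel) < \<infinity>"
      using bd[OF that] by (rule le_less_trans) simp
  qed
  have lim: "((\<lambda>R. LBINT x:{-R..R}. H (Complex x y)) \<longlongrightarrow> (LBINT x. H (Complex x y))) at_top" if "y > 0" for y
    unfolding set_lebesgue_integral_def
  proof (rule integral_dominated_convergence_at_top[where w = "\<lambda>x. cmod (H (Complex x y))"])
    show "AE x in lborel. ((\<lambda>R. indicator {-R..R} x *\<^sub>R H (Complex x y)) \<longlongrightarrow> H (Complex x y)) at_top"
    proof (rule AE_I2)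
      fix x
      have "eventually (\<lambda>R. indicator {-R..R} x *\<^sub>R H (Complex x y) = H (Complex x y)) at_top"
        using eventually_ge_at_top[of "\<bar>x\<bar>"] by eventually_elim (auto simp: indicator_def)
      then show "((\<lambda>R. indicator {-R..R} x *\<^sub>R H (Complex x y)) \<longlongrightarrow> H (Complex x y)) at_top"
        by (rule tendsto_eventually)
    qed
    show "eventually (\<lambda>R. AE x in lborel. norm (indicator {-R..R} x *\<^sub>R H (Complex x y)) \<le> cmod (H (Complex x y))) at_top"
      by (auto simp: indicator_def)
  qed (use int[OF that] in \<open>auto intro: integrable_norm\<close>)
  have "((\<lambda>R. cmod ((LBINT x:{-R..R}. H (Complex x y1)) - (LBINT x:{-R..R}. H (Complex x y2)))) \<longlongrightarrow> D) at_top"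
    unfolding D_def by (intro tendsto_intros lim) (use y in auto)
  then have "eventually (\<lambda>R. D / 2 < cmod ((LBINT x:{-R..R}. H (Complex x y1)) - (LBINT x:{-R..R}. H (Complex x y2)))) at_top"
    by (rule order_tendstoD) (use \<open>D > 0\<close> in simp)
  then obtain R0 where R0: "\<And>R. R \<ge> R0 \<Longrightarrow> D / 2 < cmod ((LBINT x:{-R..R}. H (Complex x y1)) - (LBINT x:{-R..R}. H (Complex x y2)))"
    unfolding eventually_at_top_linorder by blast
  \<comment> \<open>The pair p consists of the abscissa R and a height; integrating \<phi> over the
    height gives the bound for the two vertical sides at R and -R.\<close>
  define \<phi> where "\<phi> p = indicator (UNIV \<times> {y1..y2}) p *\<^sub>R
      (cmod (H (Complex (fst p) (snd p))) + cmod (H (Complex (- fst p) (snd p))))" for p :: "real \<times> real"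
  have \<phi>0: "\<phi> p \<ge> 0" for p by (simp add: \<phi>_def)
  have "\<phi> \<in> borel_measurable borel"
    unfolding \<phi>_def
  proof (intro borel_measurable_continuous_on_indicator continuous_intros)
    show "UNIV \<times> {y1..y2} \<in> sets borel" by (intro borel_closed closed_Times) auto
    show "continuous_on (UNIV \<times> {y1..y2}) (\<lambda>p. H (Complex (fst p) (snd p)))"
      "continuous_on (UNIV \<times> {y1..y2}) (\<lambda>p. H (Complex (- fst p) (snd p)))"
      by (rule continuous_on_compose2[OF contH];
          use y in \<open>auto simp: upper_half_plane_def Complex_eq intro!: continuous_intros\<close>)+
  qed
  then have meas: "(\<lambda>p. ennreal (\<phi> p)) \<in> borel_measurable (lborel \<Otimes>\<^sub>M lborel)"
    by (simp add: lborel_prod)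
  have "\<infinity> = (\<integral>\<^sup>+ x. ennreal (D / 2) * indicator {R0..} x \<partial>lborel)"
    using \<open>D > 0\<close> by (simp add: nn_integral_cmult_indicator ennreal_mult_top emeasure_lborel_Ici)
  also have "\<dots> \<le> (\<integral>\<^sup>+ x. \<integral>\<^sup>+ v. ennreal (\<phi> (x, v)) \<partial>lborel \<partial>lborel)"
  proof (rule nn_integral_mono)
    fix x
    show "ennreal (D / 2) * indicator {R0..} x \<le> (\<integral>\<^sup>+ v. ennreal (\<phi> (x, v)) \<partial>lborel)"
    proof (cases "x \<ge> R0")
      case True
      have "D / 2 \<le> (LBINT v. \<phi> (x, v))"
        using less_le_trans[OF R0[OF True] holomorphic_horizontal_shift[OF H y]]
        by (simp add: set_lebesgue_integral_def \<phi>_def indicator_times)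
      moreover have "integrable lborel (\<lambda>v. \<phi> (x, v))"
      proof -
        have "set_integrable lborel {y1..y2} (\<lambda>v. cmod (H (Complex x v)) + cmod (H (Complex (- x) v)))"
          by (intro borel_integrable_atLeastAtMost' continuous_intros
              continuous_on_subset[OF continuous_on_Complex_vertical[OF contH]]) (use y in auto)
        then show ?thesis by (simp add: set_integrable_def \<phi>_def indicator_times)
      qed
      ultimately show ?thesis
        using True \<phi>0 by (simp add: nn_integral_eq_integral ennreal_leI)
    qed simp
  qed
  also have "\<dots> = (\<integral>\<^sup>+ v. \<integral>\<^sup>+ x. ennreal (\<phi> (x, v)) \<partial>lborel \<partial>lborel)"
    using lborel_pair.Fubini[OF meas] by simp
  also have "\<dots> \<le> (\<integral>\<^sup>+ v. 2 * ennreal B * indicator {y1..y2} v \<partial>lborel)"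
  proof (rule nn_integral_mono)
    fix v
    show "(\<integral>\<^sup>+ x. ennreal (\<phi> (x, v)) \<partial>lborel) \<le> 2 * ennreal B * indicator {y1..y2} v"
    proof (cases "v \<in> {y1..y2}")
      case True
      then have "v > 0" using y by auto
      have cont: "continuous_on UNIV (\<lambda>x. H (Complex x v))"
        by (rule continuous_on_Complex_horizontal[OF contH \<open>v > 0\<close>])
      have "continuous_on UNIV (\<lambda>x. H (Complex (- x) v))"
        by (rule continuous_on_compose2[OF cont]) (auto intro!: continuous_intros)
      note [measurable] = borel_measurable_continuous_onI[OF cont] borel_measurable_continuous_onI[OF this]
      have m: "(\<lambda>x. ennreal (cmod (H (Complex x v)))) \<in> borel_measurable borel"
        by measurable
      have m1: "(\<lambda>x. ennreal (cmod (H (Complex x v)))) \<in> borel_measurable lborel"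
        by measurable
      have m2: "(\<lambda>x. ennreal (cmod (H (Complex (0 + (-1) * x) v)))) \<in> borel_measurable lborel"
        unfolding add_0_left mult_minus1 by measurable
      have "(\<integral>\<^sup>+ x. ennreal (\<phi> (x, v)) \<partial>lborel)
          = (\<integral>\<^sup>+ x. ennreal (cmod (H (Complex x v))) + ennreal (cmod (H (Complex (0 + (-1) * x) v))) \<partial>lborel)"
        using True by (simp add: \<phi>_def indicator_times)
      also have "\<dots> = (\<integral>\<^sup>+ x. ennreal (cmod (H (Complex x v))) \<partial>lborel)
          + (\<integral>\<^sup>+ x. ennreal (cmod (H (Complex (0 + (-1) * x) v))) \<partial>lborel)"
        by (rule nn_integral_add[OF m1 m2])
      also have "(\<integral>\<^sup>+ x. ennreal (cmod (H (Complex (0 + (-1) * x) v))) \<partial>lborel)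
          = (\<integral>\<^sup>+ x. ennreal (cmod (H (Complex x v))) \<partial>lborel)"
        using nn_integral_real_affine[OF m, of "-1" 0] by simp
      also have "(\<integral>\<^sup>+ x. ennreal (cmod (H (Complex x v))) \<partial>lborel)
          + (\<integral>\<^sup>+ x. ennreal (cmod (H (Complex x v))) \<partial>lborel) \<le> ennreal B + ennreal B"
        by (rule add_mono[OF bd[OF \<open>v > 0\<close>] bd[OF \<open>v > 0\<close>]])
      also have "\<dots> = 2 * ennreal B * indicator {y1..y2} v"
        using True by (simp only: mult_2 indicator_simps mult_1_right)
      finally show ?thesis .
    qed (simp add: \<phi>_def)
  qed
  also have "\<dots> < \<infinity>"
    using y by (simp add: nn_integral_cmult_indicator ennreal_mult_less_top)
  finally show False by simp
qed

section \<open>Orthogonality in the Hardy space\<close>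

lemma integrable_japanese: "integrable lborel (\<lambda>x::real. C / (1 + \<bar>x\<bar>)\<^sup>2)"
proof (rule Bochner_Integration.integrable_bound)
  show "integrable lborel (\<lambda>x::real. \<bar>C\<bar> * (1 / (1 + x\<^sup>2)))"
    by (intro integrable_mult_right integrable_cauchy)
  show "AE x in lborel. norm (C / (1 + \<bar>x\<bar>)\<^sup>2) \<le> norm (\<bar>C\<bar> * (1 / (1 + x\<^sup>2)))"
  proof (rule AE_I2)
    fix x :: real
    have "1 + x\<^sup>2 \<le> (1 + \<bar>x\<bar>)\<^sup>2" by (simp add: power2_eq_square algebra_simps)
    then have "\<bar>C\<bar> / (1 + \<bar>x\<bar>)\<^sup>2 \<le> \<bar>C\<bar> / (1 + x\<^sup>2)"
      using one_plus_square_pos[of x] by (intro divide_left_mono) (auto intro!: mult_pos_pos)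
    then show "norm (C / (1 + \<bar>x\<bar>)\<^sup>2) \<le> norm (\<bar>C\<bar> * (1 / (1 + x\<^sup>2)))"
      using one_plus_square_pos[of x] by (simp add: abs_mult)
  qed
qed simp

lemma hardy2_bound:
  assumes "G \<in> hardy2"
  obtains M where "M \<ge> 0"
    "\<And>y. y > 0 \<Longrightarrow> integrable lborel (\<lambda>x. (cmod (G (Complex x y)))\<^sup>2)"
    "\<And>y. y > 0 \<Longrightarrow> (LBINT x. (cmod (G (Complex x y)))\<^sup>2) \<le> M"
proof -
  define S where "S = (SUP y\<in>{0<..}. \<integral>\<^sup>+ x. ennreal ((cmod (G (Complex x y)))\<^sup>2) \<partial>lebesgue)"
  have "S < \<infinity>" and hol: "G holomorphic_on upper_half_plane"
    using assms by (auto simp: hardy2_def S_def)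
  then obtain M where M: "S = ennreal M" "M \<ge> 0" by (cases S) auto
  have nn: "(\<integral>\<^sup>+ x. ennreal ((cmod (G (Complex x y)))\<^sup>2) \<partial>lborel) \<le> ennreal M" if "y > 0" for y
  proof -
    have "(\<integral>\<^sup>+ x. ennreal ((cmod (G (Complex x y)))\<^sup>2) \<partial>lebesgue) \<le> S"
      unfolding S_def by (rule SUP_upper) (use that in simp)
    then show ?thesis by (simp add: M nn_integral_completion)
  qed
  have meas: "(\<lambda>x. (cmod (G (Complex x y)))\<^sup>2) \<in> borel_measurable borel" if "y > 0" for y
    by (intro borel_measurable_continuous_onI continuous_intros
        continuous_on_Complex_horizontal[OF holomorphic_on_imp_continuous_on[OF hol] that])
  have int: "integrable lborel (\<lambda>x. (cmod (G (Complex x y)))\<^sup>2)" if "y > 0" for y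
  proof (rule integrableI_bounded)
    show "(\<integral>\<^sup>+ x. ennreal (norm ((cmod (G (Complex x y)))\<^sup>2)) \<partial>lborel) < \<infinity>"
      using le_less_trans[OF nn[OF that]] by simp
  qed (use meas[OF that] in simp)
  have "(LBINT x. (cmod (G (Complex x y)))\<^sup>2) \<le> M" if "y > 0" for y
    using nn[OF that] M(2) int[OF that]
    by (simp add: nn_integral_eq_integral)
  with int M(2) show ?thesis using that by blast
qed

text \<open>The integral is the same on every horizontal line, and its absolute version on the line
  of height v is O(1 / (1 + v)); raising the line forces the value 0.\<close>

lemma hardy2_mult_decay:
  assumes G: "G \<in> hardy2" and F: "F holomorphic_on upper_half_plane"
    and dec: "\<And>z. Im z > 0 \<Longrightarrow> cmod (F z) \<le> C / (1 + cmod z)\<^sup>2" and "y > 0"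
  shows "(LBINT x. F (Complex x y) * G (Complex x y)) = 0"
proof -
  obtain M where M: "M \<ge> 0"
    "\<And>y. y > 0 \<Longrightarrow> integrable lborel (\<lambda>x. (cmod (G (Complex x y)))\<^sup>2)"
    "\<And>y. y > 0 \<Longrightarrow> (LBINT x. (cmod (G (Complex x y)))\<^sup>2) \<le> M"
    using hardy2_bound[OF G] by blast
  have G': "G holomorphic_on upper_half_plane" using G by (simp add: hardy2_def)
  have C: "C \<ge> 0"
    using order_trans[OF norm_ge_zero dec[of \<i>]] by (simp add: zero_le_divide_iff)
  define H where "H z = F z * G z" for z
  have H: "H holomorphic_on upper_half_plane" unfolding H_def by (intro holomorphic_intros F G')
  define K where "K = (LBINT x::real. 1 / (1 + \<bar>x\<bar>)\<^sup>2)"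
  have "K \<ge> 0" unfolding K_def by (intro integral_nonneg_AE AE_I2) auto
  text \<open>Splitting the decay of \<open>F\<close> evenly between \<open>\<bar>x\<bar>\<close> and \<open>v\<close> leaves a factor that tends to \<open>0\<close> as
    \<open>v \<rightarrow> \<infinity>\<close>.\<close>
  have bnd: "integrable lborel (\<lambda>x. cmod (H (Complex x v)))"
     "(LBINT x. cmod (H (Complex x v))) \<le> (C\<^sup>2 * K + M) / (1 + v)" if "v > 0" for v
  proof -
    have pt: "cmod (H (Complex x v)) \<le> (C\<^sup>2 / (1 + v)) * (1 / (1 + \<bar>x\<bar>)\<^sup>2) + 1 / (1 + v) * (cmod (G (Complex x v)))\<^sup>2" for x
    proof -
      define a where "a = 1 + \<bar>x\<bar>" define b where "b = 1 + v" define g where "g = cmod (G (Complex x v))"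
      have ab: "a > 0" "b > 0" using that by (auto simp: a_def b_def)
      have "a \<le> 1 + cmod (Complex x v)" "b \<le> 1 + cmod (Complex x v)"
        using abs_Re_le_cmod[of "Complex x v"] abs_Im_le_cmod[of "Complex x v"] by (auto simp: a_def b_def)
      then have "a * b \<le> (1 + cmod (Complex x v))\<^sup>2"
        unfolding power2_eq_square using ab by (intro mult_mono) auto
      then have "C / (1 + cmod (Complex x v))\<^sup>2 \<le> C / (a * b)"
        using ab C by (intro divide_left_mono mult_pos_pos zero_less_power add_pos_nonneg) auto
      with dec[of "Complex x v"] that have "cmod (F (Complex x v)) \<le> C / (a * b)" by simp
      then have "cmod (H (Complex x v)) \<le> C / (a * b) * g"
        unfolding H_def norm_mult g_def by (rule mult_right_mono) simp
      also have "\<dots> = (C / a * g) / b" by simp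
      also have "C / a * g \<le> (C / a)\<^sup>2 + g\<^sup>2"
      proof -
        define c where "c = C / a"
        have "0 \<le> c * g" using C ab by (simp add: c_def g_def)
        then show ?thesis using sum_squares_bound[of c g] unfolding c_def[symmetric] by linarith
      qed
      also have "((C / a)\<^sup>2 + g\<^sup>2) / b = (C\<^sup>2 / b) * (1 / a\<^sup>2) + 1 / b * g\<^sup>2"
        by (simp add: power_divide add_divide_distrib)
      finally show ?thesis using ab by (simp add: a_def b_def g_def divide_right_mono)
    qed
    have intr: "integrable lborel (\<lambda>x. (C\<^sup>2 / (1 + v)) * (1 / (1 + \<bar>x\<bar>)\<^sup>2) + 1 / (1 + v) * (cmod (G (Complex x v)))\<^sup>2)"
      by (intro Bochner_Integration.integrable_add integrable_mult_right integrable_japanese M(2) that)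
    show i: "integrable lborel (\<lambda>x. cmod (H (Complex x v)))"
    proof (rule Bochner_Integration.integrable_bound[OF intr])
      have "continuous_on UNIV (\<lambda>x. cmod (H (Complex x v)))"
        by (intro continuous_intros continuous_on_Complex_horizontal holomorphic_on_imp_continuous_on H that)
      then show "(\<lambda>x. cmod (H (Complex x v))) \<in> borel_measurable lborel"
        using borel_measurable_continuous_onI by simp
      show "AE x in lborel. norm (cmod (H (Complex x v))) \<le>
          norm ((C\<^sup>2 / (1 + v)) * (1 / (1 + \<bar>x\<bar>)\<^sup>2) + 1 / (1 + v) * (cmod (G (Complex x v)))\<^sup>2)"
        unfolding real_norm_def abs_norm_cancel
        by (rule AE_I2, rule order_trans[OF pt abs_ge_self])
    qed
    have "(LBINT x. cmod (H (Complex x v))) \<le> (LBINT x. (C\<^sup>2 / (1 + v)) * (1 / (1 + \<bar>x\<bar>)\<^sup>2) + 1 / (1 + v) * (cmod (G (Complex x v)))\<^sup>2)"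
      by (intro integral_mono i intr pt)
    also have "\<dots> = (C\<^sup>2 / (1 + v)) * K + 1 / (1 + v) * (LBINT x. (cmod (G (Complex x v)))\<^sup>2)"
      unfolding K_def
      by (subst Bochner_Integration.integral_add)
         (auto intro!: integrable_mult_right integrable_japanese M(2) that
           simp del: times_divide_eq_left times_divide_eq_right)
    also have "\<dots> \<le> (C\<^sup>2 / (1 + v)) * K + 1 / (1 + v) * M"
      using M(3)[OF that] that by (intro add_left_mono mult_left_mono) auto
    also have "\<dots> = (C\<^sup>2 * K + M) / (1 + v)" by (simp add: add_divide_distrib)
    finally show "(LBINT x. cmod (H (Complex x v))) \<le> (C\<^sup>2 * K + M) / (1 + v)" .
  qed
  define B where "B = C\<^sup>2 * K + M"
  have "B \<ge> 0" using \<open>K \<ge> 0\<close> M(1) by (simp add: B_def)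
  have "cmod (LBINT x. H (Complex x y)) \<le> B / (1 + v)" if "v > y" for v
  proof -
    have "(LBINT x. H (Complex x y)) = (LBINT x. H (Complex x v))"
    proof (rule holomorphic_integral_horizontal_eq[OF H \<open>y > 0\<close> that])
      fix w :: real assume w: "w > 0"
      have "(\<integral>\<^sup>+ x. ennreal (cmod (H (Complex x w))) \<partial>lborel) = ennreal (LBINT x. cmod (H (Complex x w)))"
        by (rule nn_integral_eq_integral[OF bnd(1)[OF w]]) simp
      also have "\<dots> \<le> ennreal B"
      proof (rule ennreal_leI)
        have "B / (1 + w) \<le> B / 1" using w \<open>B \<ge> 0\<close> by (intro divide_left_mono) auto
        then show "(LBINT x. cmod (H (Complex x w))) \<le> B" using bnd(2)[OF w] by (simp add: B_def)
      qed
      finally show "(\<integral>\<^sup>+ x. ennreal (cmod (H (Complex x w))) \<partial>lborel) \<le> ennreal B" .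
    qed
    also have "cmod \<dots> \<le> (LBINT x. cmod (H (Complex x v)))" by (rule integral_norm_bound)
    also have "\<dots> \<le> B / (1 + v)" using bnd(2)[of v] that \<open>y > 0\<close> by (simp add: B_def)
    finally show ?thesis .
  qed
  moreover have "((\<lambda>v. B / (1 + v)) \<longlongrightarrow> 0) at_top"
    by (intro tendsto_divide_0[OF tendsto_const] filterlim_at_top_imp_at_infinity
        filterlim_tendsto_add_at_top[OF tendsto_const filterlim_ident])
  ultimately have "cmod (LBINT x. H (Complex x y)) \<le> 0"
    by (intro tendsto_lowerbound[of "\<lambda>v. B / (1 + v)" 0 at_top] eventually_at_top_dense[THEN iffD2]) auto
  then show ?thesis by (simp add: H_def)
qed

text \<open>No maximal function is used: \<open>G (x + \<i> y)\<close> is merely bounded in \<open>L\<^sup>2\<close> and convergent almost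
  everywhere, so its distance to the limit is truncated at a level \<open>l\<close>, and \<open>l \<rightarrow> \<infinity>\<close> at the end.\<close>

lemma hardy2_orthogonal:
  assumes G: "G \<in> hardy2" and F: "F holomorphic_on upper_half_plane"
    and dec: "\<And>z. Im z > 0 \<Longrightarrow> cmod (F z) \<le> C / (1 + cmod z)\<^sup>2"
    and f: "f \<in> borel_measurable borel" "AE x in lborel. ((\<lambda>y. F (Complex x y)) \<longlongrightarrow> f x) (at_right 0)"
    and g: "g \<in> borel_measurable borel" "AE x in lborel. ((\<lambda>y. G (Complex x y)) \<longlongrightarrow> g x) (at_right 0)"
  shows "(LBINT x. f x * g x) = 0"
proof -
  obtain M where M: "M \<ge> 0"
    "\<And>y. y > 0 \<Longrightarrow> integrable lborel (\<lambda>x. (cmod (G (Complex x y)))\<^sup>2)"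
    "\<And>y. y > 0 \<Longrightarrow> (LBINT x. (cmod (G (Complex x y)))\<^sup>2) \<le> M"
    using hardy2_bound[OF G] by blast
  have G': "G holomorphic_on upper_half_plane" using G by (simp add: hardy2_def)
  have C: "C \<ge> 0"
    using order_trans[OF norm_ge_zero dec[of \<i>]] by (simp add: zero_le_divide_iff)
  define w where "w x = C / (1 + \<bar>x\<bar>)\<^sup>2" for x :: real
  have w: "integrable lborel w" "w \<in> borel_measurable borel"
    using integrable_japanese[of C] unfolding w_def by auto
  have w0: "0 \<le> w x" "w x \<le> C" for x
  proof -
    show "0 \<le> w x" using C by (simp add: w_def)
    have "(1::real)\<^sup>2 \<le> (1 + \<bar>x\<bar>)\<^sup>2" by (intro power_mono) auto
    then have "C / (1 + \<bar>x\<bar>)\<^sup>2 \<le> C / 1" using C by (intro divide_left_mono) auto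
    then show "w x \<le> C" by (simp add: w_def)
  qed
  \<comment> \<open>A sequence of heights suffices, and Fatou's lemma and dominated convergence are
    applied along it.\<close>
  define \<epsilon> where "\<epsilon> n = 1 / (real n + 1)" for n :: nat
  have \<epsilon>: "\<epsilon> n > 0" for n by (simp add: \<epsilon>_def)
  have \<epsilon>lim: "filterlim \<epsilon> (at_right 0) sequentially"
    unfolding filterlim_at
  proof (intro conjI)
    have "\<epsilon> = (\<lambda>n. inverse (real (Suc n)))" by (auto simp: \<epsilon>_def inverse_eq_divide add.commute)
    then show "\<epsilon> \<longlonglongrightarrow> 0" using LIMSEQ_inverse_real_of_nat by simp
    show "eventually (\<lambda>n. \<epsilon> n \<in> {0<..} \<and> \<epsilon> n \<noteq> 0) sequentially"
      using \<epsilon> by (auto simp: less_imp_neq[symmetric] intro!: always_eventually)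
  qed
  define Fn where "Fn n x = F (Complex x (\<epsilon> n))" for n x
  define Gn where "Gn n x = G (Complex x (\<epsilon> n))" for n x
  have Fm: "Fn n \<in> borel_measurable borel" and Gm: "Gn n \<in> borel_measurable borel" for n
    using continuous_on_Complex_horizontal[OF holomorphic_on_imp_continuous_on[OF F] \<epsilon>]
      continuous_on_Complex_horizontal[OF holomorphic_on_imp_continuous_on[OF G'] \<epsilon>]
    by (auto simp: Fn_def Gn_def intro!: borel_measurable_continuous_onI)
  note [measurable] = Fm Gm f(1) g(1) w(2)
  have Flim: "AE x in lborel. (\<lambda>n. Fn n x) \<longlonglongrightarrow> f x"
    using f(2) by eventually_elim (unfold Fn_def, rule filterlim_compose[OF _ \<epsilon>lim])
  have Glim: "AE x in lborel. (\<lambda>n. Gn n x) \<longlonglongrightarrow> g x"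
    using g(2) by eventually_elim (unfold Gn_def, rule filterlim_compose[OF _ \<epsilon>lim])
  have Fw: "cmod (Fn n x) \<le> w x" for n x
  proof -
    have "(1 + \<bar>x\<bar>)\<^sup>2 \<le> (1 + cmod (Complex x (\<epsilon> n)))\<^sup>2"
      using abs_Re_le_cmod[of "Complex x (\<epsilon> n)"] by (intro power_mono) auto
    then have "C / (1 + cmod (Complex x (\<epsilon> n)))\<^sup>2 \<le> w x"
      unfolding w_def using C
      by (intro divide_left_mono mult_pos_pos zero_less_power add_pos_nonneg) auto
    then show ?thesis using dec[of "Complex x (\<epsilon> n)"] \<epsilon>[of n] by (simp add: Fn_def)
  qed
  have fw: "AE x in lborel. cmod (f x) \<le> w x"
    using Flim by eventually_elim (rule Lim_bounded[OF tendsto_norm], auto intro: Fw)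
  have Gnn: "(\<integral>\<^sup>+ x. ennreal ((cmod (Gn n x))\<^sup>2) \<partial>lborel) \<le> ennreal M" for n
    using nn_integral_eq_integral[OF M(2)[OF \<epsilon>[of n]]] M(3)[OF \<epsilon>[of n]]
    by (simp add: Gn_def ennreal_leI)
  \<comment> \<open>Fatou's lemma puts the boundary function of G in L2 with the bound M of the
    horizontal lines.\<close>
  have "(\<integral>\<^sup>+ x. ennreal ((cmod (g x))\<^sup>2) \<partial>lborel)
      = (\<integral>\<^sup>+ x. liminf (\<lambda>n. ennreal ((cmod (Gn n x))\<^sup>2)) \<partial>lborel)"
  proof (rule nn_integral_cong_AE)
    show "AE x in lborel. ennreal ((cmod (g x))\<^sup>2) = liminf (\<lambda>n. ennreal ((cmod (Gn n x))\<^sup>2))"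
      using Glim
    proof eventually_elim
      case (elim x)
      have "(\<lambda>n. ennreal ((cmod (Gn n x))\<^sup>2)) \<longlonglongrightarrow> ennreal ((cmod (g x))\<^sup>2)"
        by (intro tendsto_ennrealI tendsto_intros elim)
      then show ?case by (intro lim_imp_Liminf[symmetric]) auto
    qed
  qed
  also have "\<dots> \<le> liminf (\<lambda>n. \<integral>\<^sup>+ x. ennreal ((cmod (Gn n x))\<^sup>2) \<partial>lborel)"
    by (rule nn_integral_liminf) measurable
  also have "\<dots> \<le> ennreal M"
    by (rule order_trans[OF Liminf_le_Limsup Limsup_bounded]) (auto intro: Gnn always_eventually)
  finally have gnn: "(\<integral>\<^sup>+ x. ennreal ((cmod (g x))\<^sup>2) \<partial>lborel) \<le> ennreal M" .
  have gi: "integrable lborel (\<lambda>x. (cmod (g x))\<^sup>2)"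
  proof (rule integrableI_bounded)
    show "(\<integral>\<^sup>+ x. ennreal (norm ((cmod (g x))\<^sup>2)) \<partial>lborel) < \<infinity>"
      using le_less_trans[OF gnn] by simp
  qed measurable
  have gM: "(LBINT x. (cmod (g x))\<^sup>2) \<le> M"
    using gnn M(1) gi by (simp add: nn_integral_eq_integral)
  have wg: "integrable lborel (\<lambda>x. w x * cmod (g x))"
  proof (rule Bochner_Integration.integrable_bound)
    show "integrable lborel (\<lambda>x. C * w x + (cmod (g x))\<^sup>2)"
      by (intro Bochner_Integration.integrable_add integrable_mult_right w gi)
    show "AE x in lborel. norm (w x * cmod (g x)) \<le> norm (C * w x + (cmod (g x))\<^sup>2)"
    proof (rule AE_I2)
      fix x
      have "2 * w x * cmod (g x) \<le> w x * w x + (cmod (g x))\<^sup>2"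
        using sum_squares_bound[of "w x" "cmod (g x)"] by (simp add: power2_eq_square)
      also have "w x * w x \<le> C * w x" using w0[of x] by (intro mult_right_mono) auto
      finally have "2 * (w x * cmod (g x)) \<le> C * w x + (cmod (g x))\<^sup>2" by simp
      moreover have "0 \<le> w x * cmod (g x)" using w0 by simp
      ultimately show "norm (w x * cmod (g x)) \<le> norm (C * w x + (cmod (g x))\<^sup>2)"
        unfolding real_norm_def by linarith
    qed
  qed measurable
  have fg: "integrable lborel (\<lambda>x. f x * g x)"
  proof (rule Bochner_Integration.integrable_bound[OF wg])
    show "AE x in lborel. norm (f x * g x) \<le> norm (w x * cmod (g x))"
      using fw by eventually_elim (use w0 in \<open>auto simp: norm_mult abs_mult intro!: mult_right_mono\<close>)
  qed measurable
  define u where "u n x = cmod (Gn n x - g x)" for n x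
  have [measurable]: "u n \<in> borel_measurable borel" for n unfolding u_def by measurable
  have u0: "u n x \<ge> 0" for n x by (simp add: u_def)
  have u2: "(u n x)\<^sup>2 \<le> 2 * (cmod (Gn n x))\<^sup>2 + 2 * (cmod (g x))\<^sup>2" for n x
  proof -
    have "(u n x)\<^sup>2 \<le> (cmod (Gn n x) + cmod (g x))\<^sup>2"
      unfolding u_def by (intro power_mono norm_triangle_ineq4) simp
    also have "\<dots> \<le> 2 * (cmod (Gn n x))\<^sup>2 + 2 * (cmod (g x))\<^sup>2"
      using sum_squares_bound[of "cmod (Gn n x)" "cmod (g x)"] by (simp add: power2_sum)
    finally show ?thesis .
  qed
  have B: "(\<lambda>n. LBINT x. cmod (Fn n x - f x) * cmod (g x)) \<longlonglongrightarrow> (LBINT x::real. 0::real)"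
  proof (rule integral_dominated_convergence[where w = "\<lambda>x. 2 * (w x * cmod (g x))"])
    show "AE x in lborel. (\<lambda>n. cmod (Fn n x - f x) * cmod (g x)) \<longlonglongrightarrow> 0"
      using Flim by eventually_elim (auto intro!: tendsto_eq_intros)
    show "AE x in lborel. norm (cmod (Fn n x - f x) * cmod (g x)) \<le> 2 * (w x * cmod (g x))" for n
      using fw
    proof eventually_elim
      case (elim x)
      have "cmod (Fn n x - f x) \<le> 2 * w x"
        using norm_triangle_ineq4[of "Fn n x" "f x"] Fw[of n x] elim by simp
      from mult_right_mono[OF this norm_ge_zero[of "g x"]] show ?case by (simp add: mult_ac)
    qed
  qed (use wg in auto)
  have A: "(\<lambda>n. LBINT x. w x * min (u n x) l) \<longlonglongrightarrow> (LBINT x::real. 0::real)" if "l > 0" for l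
  proof (rule integral_dominated_convergence[where w = "\<lambda>x. l * w x"])
    show "AE x in lborel. (\<lambda>n. w x * min (u n x) l) \<longlonglongrightarrow> 0"
      using Glim
    proof eventually_elim
      case (elim x)
      have "(\<lambda>n. u n x) \<longlonglongrightarrow> 0" unfolding u_def using elim by (auto intro!: tendsto_eq_intros)
      then have "(\<lambda>n. w x * min (u n x) l) \<longlonglongrightarrow> w x * min 0 l" by (intro tendsto_intros)
      then show ?case using that by simp
    qed
    show "AE x in lborel. norm (w x * min (u n x) l) \<le> l * w x" for n
      using w0 u0 that by (intro AE_I2) (simp add: abs_mult mult.commute[of l] mult_left_mono)
  qed (use w in \<open>auto intro: integrable_mult_right\<close>)
  have main: "cmod (LBINT x. f x * g x) \<le> (LBINT x. w x * min (u n x) l) + 4 * C * M / l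
      + (LBINT x. cmod (Fn n x - f x) * cmod (g x))" if "l > 0" for n l
  proof -
    have iG: "integrable lborel (\<lambda>x. (cmod (Gn n x))\<^sup>2)" using M(2)[OF \<epsilon>] by (simp add: Gn_def)
    have MG: "(LBINT x. (cmod (Gn n x))\<^sup>2) \<le> M" using M(3)[OF \<epsilon>] by (simp add: Gn_def)
    have i1: "integrable lborel (\<lambda>x. w x * min (u n x) l)"
    proof (rule Bochner_Integration.integrable_bound[where f = "\<lambda>x. l * w x"])
      show "AE x in lborel. norm (w x * min (u n x) l) \<le> norm (l * w x)"
        using w0 u0 that by (intro AE_I2) (simp add: abs_mult mult.commute[of l] mult_left_mono)
    qed (use w in \<open>auto intro: integrable_mult_right\<close>)
    have i2: "integrable lborel (\<lambda>x. C / l * (2 * (cmod (Gn n x))\<^sup>2 + 2 * (cmod (g x))\<^sup>2))"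
      by (intro Bochner_Integration.integrable_add integrable_mult_right iG gi)
    have i3: "integrable lborel (\<lambda>x. cmod (Fn n x - f x) * cmod (g x))"
    proof (rule Bochner_Integration.integrable_bound[where f = "\<lambda>x. 2 * (w x * cmod (g x))"])
      show "AE x in lborel. norm (cmod (Fn n x - f x) * cmod (g x)) \<le> norm (2 * (w x * cmod (g x)))"
        using fw
      proof eventually_elim
        case (elim x)
        have "cmod (Fn n x - f x) \<le> 2 * w x"
          using norm_triangle_ineq4[of "Fn n x" "f x"] Fw[of n x] elim by simp
        from mult_right_mono[OF this norm_ge_zero[of "g x"]] w0[of x] show ?case by (simp add: mult_ac)
      qed
    qed (use wg in auto)
    \<comment> \<open>Chebyshev's argument: where u exceeds l it is at most u^2 / l, and the
      integral of u^2 is at most 4 * M uniformly in n. The truncated part has the integrable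
      majorant l * w.\<close>
    have pt: "w x * u n x \<le> w x * min (u n x) l + C / l * (2 * (cmod (Gn n x))\<^sup>2 + 2 * (cmod (g x))\<^sup>2)" for x
    proof (cases "u n x \<le> l")
      case True
      then show ?thesis using C that by simp
    next
      case False
      have "w x * u n x \<le> C * u n x" using w0 u0 by (intro mult_right_mono) auto
      also have "\<dots> = C / l * (l * u n x)" using that by simp
      also have "\<dots> \<le> C / l * (2 * (cmod (Gn n x))\<^sup>2 + 2 * (cmod (g x))\<^sup>2)"
      proof (rule mult_left_mono)
        have "l * u n x \<le> (u n x)\<^sup>2"
          unfolding power2_eq_square using False u0 by (intro mult_right_mono) auto
        then show "l * u n x \<le> 2 * (cmod (Gn n x))\<^sup>2 + 2 * (cmod (g x))\<^sup>2"
          using u2[of n x] by linarith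
      qed (use C that in simp)
      also have "\<dots> \<le> w x * min (u n x) l + \<dots>" using w0 u0 that by simp
      finally show ?thesis .
    qed
    have fgn: "integrable lborel (\<lambda>x. Fn n x * Gn n x)"
    proof (rule Bochner_Integration.integrable_bound[OF
          Bochner_Integration.integrable_add[OF Bochner_Integration.integrable_add[OF i1 i2] wg]])
      show "AE x in lborel. norm (Fn n x * Gn n x) \<le> norm (w x * min (u n x) l
          + C / l * (2 * (cmod (Gn n x))\<^sup>2 + 2 * (cmod (g x))\<^sup>2) + w x * cmod (g x))"
      proof (rule AE_I2)
        fix x
        have "cmod (Gn n x) \<le> u n x + cmod (g x)"
          unfolding u_def using norm_triangle_sub[of "Gn n x" "g x"] by simp
        then have "norm (Fn n x * Gn n x) \<le> w x * (u n x + cmod (g x))"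
          unfolding norm_mult using w0 by (intro mult_mono Fw) auto
        also have "\<dots> \<le> w x * min (u n x) l
          + C / l * (2 * (cmod (Gn n x))\<^sup>2 + 2 * (cmod (g x))\<^sup>2) + w x * cmod (g x)"
          using pt[of x] by (simp add: ring_distribs)
        finally show "norm (Fn n x * Gn n x) \<le> norm (w x * min (u n x) l
          + C / l * (2 * (cmod (Gn n x))\<^sup>2 + 2 * (cmod (g x))\<^sup>2) + w x * cmod (g x))"
          by simp
      qed
    qed measurable
    have "(LBINT x. Fn n x * Gn n x) = 0"
      unfolding Fn_def Gn_def by (rule hardy2_mult_decay[OF G F dec \<epsilon>])
    then have "cmod (LBINT x. f x * g x) = cmod (LBINT x. Fn n x * Gn n x - f x * g x)"
      using Bochner_Integration.integral_diff[OF fgn fg] by simp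
    also have "\<dots> \<le> (LBINT x. cmod (Fn n x * Gn n x - f x * g x))" by (rule integral_norm_bound)
    also have "\<dots> \<le> (LBINT x. (w x * min (u n x) l + C / l * (2 * (cmod (Gn n x))\<^sup>2 + 2 * (cmod (g x))\<^sup>2))
        + cmod (Fn n x - f x) * cmod (g x))"
    proof (rule integral_mono)
      fix x
      \<comment> \<open>The first product carries the weak convergence information on G against the
        majorant w; the second needs only dominated convergence against w * \<bar>g\<bar>.\<close>
      have "Fn n x * Gn n x - f x * g x = Fn n x * (Gn n x - g x) + (Fn n x - f x) * g x"
        by (simp add: algebra_simps)
      then have "cmod (Fn n x * Gn n x - f x * g x) \<le> cmod (Fn n x) * u n x + cmod (Fn n x - f x) * cmod (g x)"
        using norm_triangle_ineq[of "Fn n x * (Gn n x - g x)" "(Fn n x - f x) * g x"]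
        by (simp add: norm_mult u_def)
      also have "cmod (Fn n x) * u n x \<le> w x * u n x" by (intro mult_right_mono Fw u0)
      also note pt
      finally show "cmod (Fn n x * Gn n x - f x * g x) \<le> (w x * min (u n x) l + C / l * (2 * (cmod (Gn n x))\<^sup>2 + 2 * (cmod (g x))\<^sup>2))
        + cmod (Fn n x - f x) * cmod (g x)" by simp
    qed (intro integrable_norm Bochner_Integration.integrable_diff Bochner_Integration.integrable_add fgn fg i1 i2 i3)+
    also have "\<dots> = (LBINT x. w x * min (u n x) l)
       + C / l * (2 * (LBINT x. (cmod (Gn n x))\<^sup>2) + 2 * (LBINT x. (cmod (g x))\<^sup>2))
       + (LBINT x. cmod (Fn n x - f x) * cmod (g x))"
      using i1 i2 i3 iG gi
      by (simp add: Bochner_Integration.integral_add Bochner_Integration.integrable_add del: times_divide_eq_left)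
    also have "C / l * (2 * (LBINT x. (cmod (Gn n x))\<^sup>2) + 2 * (LBINT x. (cmod (g x))\<^sup>2)) \<le> C / l * (2 * M + 2 * M)"
      using C that MG gM by (intro mult_left_mono) auto
    also have "C / l * (2 * M + 2 * M) = 4 * C * M / l" by simp
    finally show ?thesis by simp
  qed
  have "cmod (LBINT x. f x * g x) \<le> 4 * C * M / l" if "l > 0" for l
  proof -
    have "(\<lambda>n. (LBINT x. w x * min (u n x) l) + 4 * C * M / l
      + (LBINT x. cmod (Fn n x - f x) * cmod (g x))) \<longlonglongrightarrow> (LBINT x::real. 0::real) + 4 * C * M / l + (LBINT x::real. 0::real)"
      by (intro tendsto_add tendsto_const A[OF that] B)
    from LIMSEQ_le_const[OF this] main[OF that] show ?thesis by auto
  qed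
  moreover have "((\<lambda>l. 4 * C * M / l) \<longlongrightarrow> 0) at_top"
    by (intro tendsto_divide_0[OF tendsto_const] filterlim_at_top_imp_at_infinity filterlim_ident)
  ultimately have "cmod (LBINT x. f x * g x) \<le> 0"
    by (intro tendsto_lowerbound[of "\<lambda>l. 4 * C * M / l" 0 at_top] eventually_at_top_dense[THEN iffD2]) auto
  then show ?thesis by simp
qed

section \<open>Schwarz integrals and their boundary values\<close>

text \<open>The compensating term is the one in the Hilbert transform, so the boundary values of the
  imaginary part of \<open>schwarz u\<close> are the Hilbert transform itself, with no additive
  constant left over.\<close>

definition schwarz_kernel :: "complex \<Rightarrow> real \<Rightarrow> complex" where
  "schwarz_kernel z t = 1 / (z - of_real t) + of_real (t / (1 + t\<^sup>2))"

definition schwarz :: "(real \<Rightarrow> real) \<Rightarrow> complex \<Rightarrow> complex" where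
  "schwarz u z = \<i> * (LBINT t. schwarz_kernel z t * of_real (u t)) / of_real pi"

text \<open>The kernel is (1 + z * t) / ((z - t) * (1 + t^2)), and 1 + z * t = (1 + z^2) - z * (z -
  t). The distance from z to t stays explicit because it is later bounded below by
  \<open>Im z\<close> as well as by horizontal distances.\<close>

lemma schwarz_kernel_bound:
  assumes "z \<noteq> of_real t"
  shows "cmod (schwarz_kernel z t) \<le> (cmod z + cmod (1 + z\<^sup>2) / cmod (z - of_real t)) / (1 + t\<^sup>2)"
proof -
  have "1 + (of_real t :: complex)\<^sup>2 = of_real (1 + t\<^sup>2)" by simp
  moreover have "1 + t\<^sup>2 \<noteq> 0" using one_plus_square_pos[of t] by linarith
  ultimately have "1 + (of_real t :: complex)\<^sup>2 \<noteq> 0" by (metis of_real_eq_0_iff)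
  then have nz: "z - of_real t \<noteq> 0" "1 + (of_real t :: complex)\<^sup>2 \<noteq> 0"
    using assms by simp_all
  have "schwarz_kernel z t = ((1 + z\<^sup>2) / (z - of_real t) - z) / of_real (1 + t\<^sup>2)"
    using nz unfolding schwarz_kernel_def
    by (simp add: divide_simps) (simp add: algebra_simps power2_eq_square)
  then have "cmod (schwarz_kernel z t) = cmod ((1 + z\<^sup>2) / (z - of_real t) - z) / (1 + t\<^sup>2)"
    using one_plus_square_pos[of t] by (simp only: norm_divide norm_of_real abs_of_pos)
  also have "\<dots> \<le> (cmod z + cmod (1 + z\<^sup>2) / cmod (z - of_real t)) / (1 + t\<^sup>2)"
    using norm_triangle_ineq4[of "(1 + z\<^sup>2) / (z - of_real t)" z] one_plus_square_pos[of t]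
    by (intro divide_right_mono) (simp_all add: norm_divide add.commute)
  finally show ?thesis .
qed

lemma Im_le_cmod_diff_real: "Im z \<le> cmod (z - of_real t)"
  using abs_Im_le_cmod[of "z - of_real t"] by simp

lemma schwarz_kernel_bound_Im:
  assumes "Im z > 0"
  shows "cmod (schwarz_kernel z t) \<le> (cmod z + cmod (1 + z\<^sup>2) / Im z) / (1 + t\<^sup>2)"
proof -
  have le: "Im z \<le> cmod (z - of_real t)" by (rule Im_le_cmod_diff_real)
  have "z \<noteq> of_real t" using assms by auto
  from schwarz_kernel_bound[OF this]
  show ?thesis
    by (rule order_trans, intro divide_right_mono add_left_mono divide_left_mono mult_pos_pos)
      (use assms le one_plus_square_pos[of t] less_le_trans[OF assms le] in auto)
qed

lemma schwarz_kernel_measurable [measurable]: "schwarz_kernel z \<in> borel_measurable borel"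
  unfolding schwarz_kernel_def by measurable

lemma schwarz_integrable:
  assumes "poisson_integrable u" "Im z > 0"
  shows "integrable lborel (\<lambda>t. schwarz_kernel z t * of_real (u t))"
proof (rule poisson_integrable_abs_bound[OF assms(1)])
  have [measurable]: "u \<in> borel_measurable borel" using assms(1) by (simp add: poisson_integrable_def)
  show "(\<lambda>t. schwarz_kernel z t * of_real (u t)) \<in> borel_measurable borel" by measurable
  show "norm (schwarz_kernel z t * of_real (u t))
      \<le> (cmod z + cmod (1 + z\<^sup>2) / Im z) / (1 + t\<^sup>2) * \<bar>u t\<bar>" for t
    unfolding norm_mult norm_of_real by (intro mult_right_mono schwarz_kernel_bound_Im assms(2)) simp
qed

lemma schwarz_kernel_Re: "Re (schwarz_kernel (Complex x y) t) = (x - t) / ((x - t)\<^sup>2 + y\<^sup>2) + t / (1 + t\<^sup>2)"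
  and schwarz_kernel_Im: "Im (schwarz_kernel (Complex x y) t) = - y / ((x - t)\<^sup>2 + y\<^sup>2)"
  by (simp_all add: schwarz_kernel_def Re_divide Im_divide del: of_real_divide of_real_add)

lemma Re_schwarz:
  assumes "poisson_integrable u" "y > 0"
  shows "Re (schwarz u (Complex x y)) = 1 / pi * (LBINT t. y / ((x - t)\<^sup>2 + y\<^sup>2) * u t)"
  using integral_Im[OF schwarz_integrable[OF assms(1), of "Complex x y"], symmetric] assms(2)
  by (simp add: schwarz_def schwarz_kernel_Im Re_divide_of_real)

lemma Im_schwarz:
  assumes "poisson_integrable u" "y > 0"
  shows "Im (schwarz u (Complex x y)) = 1 / pi * (LBINT t. ((x - t) / ((x - t)\<^sup>2 + y\<^sup>2) + t / (1 + t\<^sup>2)) * u t)"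
  using integral_Re[OF schwarz_integrable[OF assms(1), of "Complex x y"], symmetric] assms(2)
  by (simp add: schwarz_def schwarz_kernel_Re Im_divide_of_real)

lemma Re_schwarz_nonneg:
  assumes "poisson_integrable u" "\<And>t. 0 \<le> u t" "Im z > 0"
  shows "0 \<le> Re (schwarz u z)"
  using assms Re_schwarz[OF assms(1,3), of "Re z"]
  by (simp add: Bochner_Integration.integral_nonneg)

lemma inverse_cmod_square_bound:
  assumes "Im z > 0"
  shows "1 / (cmod (z - of_real t))\<^sup>2 \<le> (2 + (1 + 2 * (Re z)\<^sup>2) / (Im z)\<^sup>2) / (1 + t\<^sup>2)"
proof -
  have eq: "(cmod (z - of_real t))\<^sup>2 = (Re z - t)\<^sup>2 + (Im z)\<^sup>2" by (simp add: cmod_power2)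
  have "0 \<le> (2 * Re z - t)\<^sup>2" by simp
  then have "1 + t\<^sup>2 \<le> 2 * (Re z - t)\<^sup>2 + (1 + 2 * (Re z)\<^sup>2) * 1"
    by (simp add: power2_eq_square algebra_simps)
  also have "\<dots> \<le> 2 * ((Re z - t)\<^sup>2 + (Im z)\<^sup>2) + (1 + 2 * (Re z)\<^sup>2) * (((Re z - t)\<^sup>2 + (Im z)\<^sup>2) / (Im z)\<^sup>2)"
    using assms by (intro add_mono mult_left_mono) (auto simp: field_simps)
  also have "\<dots> = (2 + (1 + 2 * (Re z)\<^sup>2) / (Im z)\<^sup>2) * ((Re z - t)\<^sup>2 + (Im z)\<^sup>2)"
    by (simp add: ring_distribs add_divide_distrib)
  finally show ?thesis
    unfolding eq using assms one_plus_square_pos[of t]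
    by (simp add: pos_divide_le_eq pos_le_divide_eq add_nonneg_pos)
qed

lemma schwarz_holomorphic:
  assumes u: "poisson_integrable u"
  shows "schwarz u holomorphic_on upper_half_plane"
proof -
  have um [measurable]: "u \<in> borel_measurable borel" using u by (simp add: poisson_integrable_def)
  have "(\<lambda>z. LBINT t. schwarz_kernel z t * of_real (u t)) holomorphic_on upper_half_plane"
    unfolding holomorphic_on_open[OF uhp_open]
  proof (intro ballI exI)
    fix z0 assume "z0 \<in> upper_half_plane"
    then have y: "Im z0 > 0" by (simp add: upper_half_plane_def)
    \<comment> \<open>The distance from z0 to any real t is at least \<open>Im z0\<close>, so moving
      within this ball at most halves it; this yields one majorant for all difference
      quotients.\<close>
    define B where "B = ball z0 (Im z0 / 2)"
    define D where "D = 2 + (1 + 2 * (Re z0)\<^sup>2) / (Im z0)\<^sup>2"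
    let ?K = "\<lambda>z. LBINT t. schwarz_kernel z t * of_real (u t)"
    have far: "cmod (z0 - of_real t) / 2 \<le> cmod (z - of_real t)" if "z \<in> B" for z t
      using that Im_le_cmod_diff_real[of z0 t] norm_triangle_ineq3[of "z0 - of_real t" "z - of_real t"]
      by (simp add: B_def dist_norm)
    have Bpos: "Im z > 0" if "z \<in> B" for z
      using that abs_Im_le_cmod[of "z0 - z"] y by (simp add: B_def dist_norm)
    have "((\<lambda>z. (?K z - ?K z0) / (z - z0)) \<longlongrightarrow> (LBINT t. - 1 / (z0 - of_real t)\<^sup>2 * of_real (u t))) (at z0 within B)"
      unfolding tendsto_at_iff_sequentially
    proof (intro allI impI)
      fix X assume X: "\<forall>i. X i \<in> B - {z0}" "X \<longlonglongrightarrow> z0"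
      have XB: "X i \<in> B" "X i \<noteq> z0" for i using X(1) by auto
      have nz: "X i - of_real t \<noteq> 0" "z0 - of_real t \<noteq> 0" for i t
        using Bpos[OF XB(1)[of i]] y by auto
      have quot: "(?K (X i) - ?K z0) / (X i - z0)
          = (LBINT t. - 1 / ((X i - of_real t) * (z0 - of_real t)) * of_real (u t))" for i
      proof -
        have "?K (X i) - ?K z0 = (LBINT t. schwarz_kernel (X i) t * of_real (u t) - schwarz_kernel z0 t * of_real (u t))"
          using schwarz_integrable[OF u y] schwarz_integrable[OF u Bpos[OF XB(1)]] by simp
        then have "(?K (X i) - ?K z0) / (X i - z0)
           = (LBINT t. (schwarz_kernel (X i) t * of_real (u t) - schwarz_kernel z0 t * of_real (u t)) / (X i - z0))"
          by simp
        also have "\<dots> = (LBINT t. - 1 / ((X i - of_real t) * (z0 - of_real t)) * of_real (u t))"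
        proof (rule Bochner_Integration.integral_cong)
          fix t
          have "1 / (X i - of_real t) - 1 / (z0 - of_real t) = - (X i - z0) / ((X i - of_real t) * (z0 - of_real t))"
            using nz(1)[of i t] nz(2)[of t] by (simp add: divide_simps)
          then have d: "schwarz_kernel (X i) t - schwarz_kernel z0 t
              = - (X i - z0) / ((X i - of_real t) * (z0 - of_real t))"
            by (simp add: schwarz_kernel_def)
          have c: "(- a / b) / a = - 1 / b" if "a \<noteq> 0" for a b :: complex
            using that by simp
          have "(schwarz_kernel (X i) t - schwarz_kernel z0 t) / (X i - z0) = - 1 / ((X i - of_real t) * (z0 - of_real t))"
            unfolding d using XB(2)[of i] by (intro c) simp
          then show "(schwarz_kernel (X i) t * of_real (u t) - schwarz_kernel z0 t * of_real (u t)) / (X i - z0)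
             = - 1 / ((X i - of_real t) * (z0 - of_real t)) * of_real (u t)"
            by (metis left_diff_distrib times_divide_eq_left)
        qed simp
        finally show ?thesis .
      qed
      have "(\<lambda>i. LBINT t. - 1 / ((X i - of_real t) * (z0 - of_real t)) * of_real (u t))
          \<longlonglongrightarrow> (LBINT t. - 1 / (z0 - of_real t)\<^sup>2 * of_real (u t))"
      proof (rule integral_dominated_convergence[where w = "\<lambda>t. 2 * D * \<bar>u t / (1 + t\<^sup>2)\<bar>"])
        show "AE t in lborel. (\<lambda>i. - 1 / ((X i - of_real t) * (z0 - of_real t)) * of_real (u t))
            \<longlonglongrightarrow> - 1 / (z0 - of_real t)\<^sup>2 * of_real (u t)"
          unfolding power2_eq_square using nz
          by (intro AE_I2 tendsto_intros X(2)) auto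
        show "integrable lborel (\<lambda>t. 2 * D * \<bar>u t / (1 + t\<^sup>2)\<bar>)"
          using u unfolding poisson_integrable_def by (intro integrable_mult_right integrable_abs) simp
        show "AE t in lborel. norm (- 1 / ((X i - of_real t) * (z0 - of_real t)) * of_real (u t))
            \<le> 2 * D * \<bar>u t / (1 + t\<^sup>2)\<bar>" for i
        proof (rule AE_I2)
          fix t
          have p: "0 < cmod (z0 - of_real t)" using nz(2)[of t] by simp
          have "1 / (cmod (X i - of_real t) * cmod (z0 - of_real t)) \<le> 1 / (cmod (z0 - of_real t) / 2 * cmod (z0 - of_real t))"
            using far[OF XB(1)[of i], of t] p nz(1)[of i t] nz(2)[of t]
            by (intro divide_left_mono mult_right_mono mult_pos_pos) auto
          also have "\<dots> = 2 * (1 / (cmod (z0 - of_real t))\<^sup>2)" by (simp add: power2_eq_square)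
          also have "\<dots> \<le> 2 * (D / (1 + t\<^sup>2))"
            unfolding D_def by (intro mult_left_mono inverse_cmod_square_bound y) simp
          finally have "1 / (cmod (X i - of_real t) * cmod (z0 - of_real t)) * \<bar>u t\<bar> \<le> 2 * (D / (1 + t\<^sup>2)) * \<bar>u t\<bar>"
            by (rule mult_right_mono) simp
          then show "norm (- 1 / ((X i - of_real t) * (z0 - of_real t)) * of_real (u t)) \<le> 2 * D * \<bar>u t / (1 + t\<^sup>2)\<bar>"
            using one_plus_square_pos[of t] by (simp add: norm_mult norm_divide)
        qed
      qed measurable
      then show "((\<lambda>z. (?K z - ?K z0) / (z - z0)) \<circ> X) \<longlonglongrightarrow> (LBINT t. - 1 / (z0 - of_real t)\<^sup>2 * of_real (u t))"
        by (simp add: o_def quot)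
    qed
    moreover have "at z0 within B = at z0" using y by (intro at_within_open) (auto simp: B_def)
    ultimately show "(?K has_field_derivative (LBINT t. - 1 / (z0 - of_real t)\<^sup>2 * of_real (u t))) (at z0)"
      by (simp add: has_field_derivative_iff)
  qed
  then show ?thesis unfolding schwarz_def[abs_def] by (auto intro!: holomorphic_intros)
qed

section \<open>Vertical limits of the Poisson and the conjugate Poisson integral\<close>

lemma poisson_kernel_integral:
  assumes "y > 0"
  shows "(LBINT t. y / ((x - t)\<^sup>2 + y\<^sup>2)) = pi" "integrable lborel (\<lambda>t. y / ((x - t)\<^sup>2 + y\<^sup>2))"
proof -
  have eq: "y / ((x - (x + y * s))\<^sup>2 + y\<^sup>2) = 1 / y * (1 / (1 + s\<^sup>2))" for s
  proof -
    have "(x - (x + y * s))\<^sup>2 + y\<^sup>2 = y * (y * (1 + s\<^sup>2))" by (simp add: power2_eq_square algebra_simps)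
    then show ?thesis using assms by simp
  qed
  show "(LBINT t. y / ((x - t)\<^sup>2 + y\<^sup>2)) = pi"
  proof -
    have "(LBINT s. 1 / y * (1 / (1 + s\<^sup>2))) = 1 / y * pi"
      unfolding integral_mult_right_zero integral_cauchy ..
    then show ?thesis
      using lborel_integral_real_affine[of y "\<lambda>t. y / ((x - t)\<^sup>2 + y\<^sup>2)" x] assms
      unfolding eq by simp
  qed
  show "integrable lborel (\<lambda>t. y / ((x - t)\<^sup>2 + y\<^sup>2))"
    using lborel_integrable_real_affine_iff[of y "\<lambda>t. y / ((x - t)\<^sup>2 + y\<^sup>2)" x] assms
      integrable_mult_right[OF integrable_cauchy, of "1 / y"]
    unfolding eq by simp
qed

lemma poisson_kernel_mult_integrable:
  assumes "poisson_integrable u" "y > 0"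
  shows "integrable lborel (\<lambda>t. y / ((x - t)\<^sup>2 + y\<^sup>2) * u t)"
  using integrable_Im[OF schwarz_integrable[OF assms(1), of "Complex x y"]] assms(2)
  by (simp add: schwarz_kernel_Im)

lemma Re_schwarz_tendsto:
  assumes u: "poisson_integrable u" and x: "is_lebesgue_point u x"
  shows "((\<lambda>y. Re (schwarz u (Complex x y))) \<longlongrightarrow> u x) (at_right 0)"
proof -
  have "((\<lambda>y. Re (schwarz u (Complex x y)) - u x) \<longlongrightarrow> 0) (at_right 0)"
  proof (rule Lim_null_comparison)
    show "((\<lambda>y. 1 / pi * (LBINT t. y / ((x - t)\<^sup>2 + y\<^sup>2) * \<bar>u t - u x\<bar>)) \<longlongrightarrow> 0) (at_right 0)"
      by (rule tendsto_mult_right_zero[OF poisson_kernel_lebesgue_point[OF u x]])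
    show "eventually (\<lambda>y. norm (Re (schwarz u (Complex x y)) - u x)
        \<le> 1 / pi * (LBINT t. y / ((x - t)\<^sup>2 + y\<^sup>2) * \<bar>u t - u x\<bar>)) (at_right 0)"
      using eventually_at_right_less[of "0::real"]
    proof eventually_elim
      case (elim y)
      have "Re (schwarz u (Complex x y)) - u x
          = 1 / pi * ((LBINT t. y / ((x - t)\<^sup>2 + y\<^sup>2) * u t) - (LBINT t. y / ((x - t)\<^sup>2 + y\<^sup>2) * u x))"
        unfolding integral_mult_left_zero poisson_kernel_integral(1)[OF elim, of x] Re_schwarz[OF u elim]
        by (simp add: right_diff_distrib)
      also have "(LBINT t. y / ((x - t)\<^sup>2 + y\<^sup>2) * u t) - (LBINT t. y / ((x - t)\<^sup>2 + y\<^sup>2) * u x)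
          = (LBINT t. y / ((x - t)\<^sup>2 + y\<^sup>2) * (u t - u x))"
        unfolding right_diff_distrib
        by (rule Bochner_Integration.integral_diff[symmetric])
          (intro poisson_kernel_mult_integrable integrable_mult_left poisson_kernel_integral(2) u elim)+
      also have "\<bar>1 / pi * \<dots>\<bar> \<le> 1 / pi * (LBINT t. \<bar>y / ((x - t)\<^sup>2 + y\<^sup>2) * (u t - u x)\<bar>)"
        unfolding abs_mult[of "1 / pi"] by (intro mult_mono integral_abs_bound) auto
      also have "\<dots> = 1 / pi * (LBINT t. y / ((x - t)\<^sup>2 + y\<^sup>2) * \<bar>u t - u x\<bar>)"
        using elim by (simp add: abs_mult)
      finally show ?case by simp
    qed
  qed
  then show ?thesis by (rule LIM_zero_cancel)
qed

text \<open>Reflection at x preserves the integral, the default value 0 of a non-integrable k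
  included.\<close>

lemma lborel_integral_antisymmetric:
  fixes k :: "real \<Rightarrow> real"
  assumes "\<And>t. k (2 * x - t) = - k t"
  shows "(LBINT t. k t) = 0"
proof -
  have "(LBINT t. k t) = (LBINT t. k (2 * x + (-1) * t))"
    using lborel_integral_real_affine[of "-1" k "2 * x"] by simp
  also have "\<dots> = - (LBINT t. k t)" using assms by simp
  finally show ?thesis by simp
qed

text \<open>For \<bar>s\<bar> > y the difference is -(y^2 / s) / (s^2 + y^2), and y^2 /
  \<bar>s\<bar> < y; otherwise no singular term is present and the numerator s is at most y in
  modulus.\<close>

lemma truncation_kernel_bound:
  fixes s y :: real
  assumes "y > 0"
  shows "\<bar>s / (s\<^sup>2 + y\<^sup>2) - indicator {s. y < \<bar>s\<bar>} s / s\<bar> \<le> y / (s\<^sup>2 + y\<^sup>2)"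
proof -
  have p: "0 < s\<^sup>2 + y\<^sup>2" using assms by (simp add: add_nonneg_pos)
  show ?thesis
  proof (cases "y < \<bar>s\<bar>")
    case True
    then have "s \<noteq> 0" using assms by auto
    then have "s / (s\<^sup>2 + y\<^sup>2) - 1 / s = - (y\<^sup>2 / s) / (s\<^sup>2 + y\<^sup>2)"
      using p by (simp add: divide_simps) (simp add: algebra_simps power2_eq_square)
    then have "\<bar>s / (s\<^sup>2 + y\<^sup>2) - 1 / s\<bar> = (y\<^sup>2 / \<bar>s\<bar>) / (s\<^sup>2 + y\<^sup>2)"
      using p by (simp add: abs_divide abs_mult)
    also have "\<dots> \<le> y / (s\<^sup>2 + y\<^sup>2)"
      using p True assms by (intro divide_right_mono) (auto simp: divide_simps power2_eq_square)
    finally show ?thesis using True by simp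
  next
    case False
    then show ?thesis using p by (simp add: divide_right_mono)
  qed
qed

text \<open>The conjugate Poisson kernel minus the kernel truncated at height \<open>y\<close> is odd and
  dominated by the Poisson kernel.\<close>

lemma Im_schwarz_tendsto:
  assumes u: "poisson_integrable u" and x: "is_lebesgue_point u x" and v: "has_hilbert_transform_at u v x"
  shows "((\<lambda>y. Im (schwarz u (Complex x y))) \<longlongrightarrow> v) (at_right 0)"
proof -
  have um [measurable]: "u \<in> borel_measurable borel" using u by (simp add: poisson_integrable_def)
  define k where "k y t = (x - t) / ((x - t)\<^sup>2 + y\<^sup>2) - indicator {s. y < \<bar>s\<bar>} (x - t) / (x - t)" for y t
  define T where "T y = 1 / pi * (LINT t:{t. y < \<bar>x - t\<bar>}|lebesgue. (1 / (x - t) + t / (1 + t\<^sup>2)) * u t)" for y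
  have km [measurable]: "k y \<in> borel_measurable borel" for y unfolding k_def by measurable
  have kb: "\<bar>k y t\<bar> \<le> y / ((x - t)\<^sup>2 + y\<^sup>2)" if "y > 0" for y t
    unfolding k_def by (rule truncation_kernel_bound[OF that])
  have ku: "integrable lborel (\<lambda>t. k y t * w t)" if "y > 0" "poisson_integrable w" for y w
  proof (rule Bochner_Integration.integrable_bound)
    show "integrable lborel (\<lambda>t. y / ((x - t)\<^sup>2 + y\<^sup>2) * \<bar>w t\<bar>)"
      by (intro poisson_kernel_mult_integrable poisson_integrable_abs that)
    have "w \<in> borel_measurable borel" using that(2) by (simp add: poisson_integrable_def)
    then show "(\<lambda>t. k y t * w t) \<in> borel_measurable lborel"
      using km by simp
    show "AE t in lborel. norm (k y t * w t) \<le> norm (y / ((x - t)\<^sup>2 + y\<^sup>2) * \<bar>w t\<bar>)"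
      using kb[OF that(1)] that(1) by (intro AE_I2) (simp only: real_norm_def abs_mult abs_abs, intro mult_right_mono, auto)
  qed
  have T: "T y = 1 / pi * (LBINT t. indicator {t. y < \<bar>x - t\<bar>} t * ((1 / (x - t) + t / (1 + t\<^sup>2)) * u t))" for y
    unfolding T_def set_lebesgue_integral_def
    by (subst integral_completion) auto
  have diff: "\<bar>Im (schwarz u (Complex x y)) - T y\<bar>
      \<le> 1 / pi * (LBINT t. y / ((x - t)\<^sup>2 + y\<^sup>2) * \<bar>u t - u x\<bar>)
        + 1 / pi * ((LBINT t:{x-y..x+y}. \<bar>u t - u x\<bar>) + 2 * y * \<bar>u x\<bar>)" if y: "y > 0" for y
  proof -
    \<comment> \<open>The truncation also removes the compensating term on the interval of radius y;
      r is this missing piece.\<close>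
    define r where "r t = indicator {x-y..x+y} t * (t / (1 + t\<^sup>2) * u t)" for t
    have tb: "\<bar>t / (1 + t\<^sup>2)\<bar> \<le> 1" for t :: real
    proof -
      have "0 \<le> (\<bar>t\<bar> - 1)\<^sup>2" by simp
      then have "2 * \<bar>t\<bar> \<le> 1 + t\<^sup>2" by (simp add: power2_eq_square algebra_simps)
      then show ?thesis using one_plus_square_pos[of t] by (simp add: abs_divide)
    qed
    have iu: "integrable lborel (\<lambda>t. indicator {x-y..x+y} t * \<bar>u t - u x\<bar>)"
      using poisson_integrable_locally[OF poisson_integrable_affine_abs[OF u]] by (simp add: set_integrable_def)
    have ic: "integrable lborel (\<lambda>t. indicator {x-y..x+y} t * c)" for c :: real
      using poisson_integrable_locally[OF poisson_integrable_const] by (simp add: set_integrable_def)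
    have rb: "\<bar>r t\<bar> \<le> indicator {x-y..x+y} t * \<bar>u t - u x\<bar> + indicator {x-y..x+y} t * \<bar>u x\<bar>" for t
    proof -
      have "\<bar>t / (1 + t\<^sup>2) * u t\<bar> \<le> 1 * \<bar>u t\<bar>" unfolding abs_mult by (intro mult_right_mono tb) simp
      also have "\<dots> \<le> \<bar>u t - u x\<bar> + \<bar>u x\<bar>" by simp
      finally show ?thesis unfolding r_def by (auto simp: indicator_def)
    qed
    have ir: "integrable lborel r"
    proof (rule Bochner_Integration.integrable_bound[OF Bochner_Integration.integrable_add[OF iu ic[of "\<bar>u x\<bar>"]]])
      show "r \<in> borel_measurable lborel" unfolding r_def by measurable
      show "AE t in lborel. norm (r t) \<le> norm (indicator {x-y..x+y} t * \<bar>u t - u x\<bar> + indicator {x-y..x+y} t * \<bar>u x\<bar>)"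
        unfolding real_norm_def by (rule AE_I2, rule order_trans[OF rb abs_ge_self])
    qed
    let ?g = "\<lambda>t. indicator {t. y < \<bar>x - t\<bar>} t * ((1 / (x - t) + t / (1 + t\<^sup>2)) * u t)"
    have split: "((x - t) / ((x - t)\<^sup>2 + y\<^sup>2) + t / (1 + t\<^sup>2)) * u t = ?g t + (k y t * u t + r t)" for t
      using y by (auto simp: k_def r_def indicator_def algebra_simps)
    have isk: "integrable lborel (\<lambda>t. ((x - t) / ((x - t)\<^sup>2 + y\<^sup>2) + t / (1 + t\<^sup>2)) * u t)"
      using integrable_Re[OF schwarz_integrable[OF u, of "Complex x y"]] y by (simp add: schwarz_kernel_Re)
    have ikr: "integrable lborel (\<lambda>t. k y t * u t + r t)"
      by (intro Bochner_Integration.integrable_add ku[OF y u] ir)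
    have ig: "integrable lborel ?g"
      using Bochner_Integration.integrable_diff[OF isk ikr] unfolding split by simp
    have b1: "\<bar>LBINT t. k y t * (u t - u x)\<bar> \<le> (LBINT t. y / ((x - t)\<^sup>2 + y\<^sup>2) * \<bar>u t - u x\<bar>)"
    proof (rule order_trans[OF integral_abs_bound integral_mono])
      show "integrable lborel (\<lambda>t. \<bar>k y t * (u t - u x)\<bar>)"
        by (intro integrable_abs ku y poisson_integrable_diff u poisson_integrable_const)
      show "integrable lborel (\<lambda>t. y / ((x - t)\<^sup>2 + y\<^sup>2) * \<bar>u t - u x\<bar>)"
        by (intro poisson_kernel_mult_integrable poisson_integrable_affine_abs u y)
      show "\<bar>k y t * (u t - u x)\<bar> \<le> y / ((x - t)\<^sup>2 + y\<^sup>2) * \<bar>u t - u x\<bar>" for t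
        unfolding abs_mult by (intro mult_right_mono kb y) simp
    qed
    have "\<bar>LBINT t. r t\<bar> \<le> (LBINT t. indicator {x-y..x+y} t * \<bar>u t - u x\<bar> + indicator {x-y..x+y} t * \<bar>u x\<bar>)"
      by (rule order_trans[OF integral_abs_bound integral_mono])
        (intro integrable_abs ir Bochner_Integration.integrable_add iu ic rb)+
    also have "\<dots> = (LBINT t:{x-y..x+y}. \<bar>u t - u x\<bar>) + 2 * y * \<bar>u x\<bar>"
      using y by (subst Bochner_Integration.integral_add[OF iu ic]) (simp add: set_lebesgue_integral_def)
    finally have b2: "\<bar>LBINT t. r t\<bar> \<le> (LBINT t:{x-y..x+y}. \<bar>u t - u x\<bar>) + 2 * y * \<bar>u x\<bar>" .
    have "Im (schwarz u (Complex x y)) - T y = 1 / pi * ((LBINT t. k y t * u t) + (LBINT t. r t))"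
      unfolding Im_schwarz[OF u y] T split
      using Bochner_Integration.integral_add[OF ig ikr] Bochner_Integration.integral_add[OF ku[OF y u] ir]
      by (simp add: algebra_simps)
    \<comment> \<open>Oddness of k about x lets the constant \<open>u x\<close> be subtracted, which
      brings in the quantity controlled at a Lebesgue point.\<close>
    also have "(LBINT t. k y t * u t) = (LBINT t. k y t * (u t - u x))"
    proof -
      have "(LBINT t. k y t * u x) = 0"
      proof (rule lborel_integral_antisymmetric[of _ x])
        fix t
        define s where "s = x - t"
        have "x - (2 * x - t) = - s" by (simp add: s_def)
        then show "k y (2 * x - t) * u x = - (k y t * u x)"
          unfolding k_def s_def[symmetric] by (auto simp: indicator_def left_diff_distrib)
      qed
      moreover have "(LBINT t. k y t * (u t - u x)) = (LBINT t. k y t * u t) - (LBINT t. k y t * u x)"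
        unfolding right_diff_distrib
        by (rule Bochner_Integration.integral_diff) (intro ku y u poisson_integrable_const)+
      ultimately show ?thesis by simp
    qed
    also have "\<bar>1 / pi * ((LBINT t. k y t * (u t - u x)) + (LBINT t. r t))\<bar>
        \<le> 1 / pi * (\<bar>LBINT t. k y t * (u t - u x)\<bar> + \<bar>LBINT t. r t\<bar>)"
      unfolding abs_mult[of "1 / pi"] by (intro mult_mono abs_triangle_ineq) auto
    also have "\<dots> \<le> 1 / pi * ((LBINT t. y / ((x - t)\<^sup>2 + y\<^sup>2) * \<bar>u t - u x\<bar>)
        + ((LBINT t:{x-y..x+y}. \<bar>u t - u x\<bar>) + 2 * y * \<bar>u x\<bar>))"
      by (intro mult_left_mono add_mono b1 b2) simp
    finally show ?thesis by (simp only: distrib_left)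
  qed
  have loc: "((\<lambda>y. LBINT t:{x-y..x+y}. \<bar>u t - u x\<bar>) \<longlongrightarrow> 0) (at_right 0)"
  proof (rule tendstoI)
    fix e :: real assume "e > 0"
    obtain d where d: "d > 0" "\<And>h. 0 < h \<Longrightarrow> h \<le> d \<Longrightarrow> (LBINT t:{x-h..x+h}. \<bar>u t - u x\<bar>) \<le> 1 * h"
      using x unfolding is_lebesgue_point_def by (meson zero_less_one)
    have "eventually (\<lambda>y. y \<in> {0<..<min d e}) (at_right 0)"
      using d(1) \<open>e > 0\<close> by (intro eventually_at_right_real) simp
    then show "eventually (\<lambda>y. dist (LBINT t:{x-y..x+y}. \<bar>u t - u x\<bar>) 0 < e) (at_right 0)"
    proof eventually_elim
      case (elim y)
      have "0 \<le> (LBINT t:{x-y..x+y}. \<bar>u t - u x\<bar>)"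
        unfolding set_lebesgue_integral_def by (intro integral_nonneg_AE AE_I2) auto
      with d(2)[of y] elim show ?case by simp
    qed
  qed
  have "((\<lambda>y. Im (schwarz u (Complex x y)) - T y) \<longlongrightarrow> 0) (at_right 0)"
  proof (rule Lim_null_comparison)
    show "eventually (\<lambda>y. norm (Im (schwarz u (Complex x y)) - T y) \<le>
        1 / pi * (LBINT t. y / ((x - t)\<^sup>2 + y\<^sup>2) * \<bar>u t - u x\<bar>)
        + 1 / pi * ((LBINT t:{x-y..x+y}. \<bar>u t - u x\<bar>) + 2 * y * \<bar>u x\<bar>)) (at_right 0)"
      using eventually_at_right_less[of "0::real"]
      by eventually_elim (simp only: real_norm_def diff)
    have "((\<lambda>y. 1 / pi * (LBINT t. y / ((x - t)\<^sup>2 + y\<^sup>2) * \<bar>u t - u x\<bar>)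
        + 1 / pi * ((LBINT t:{x-y..x+y}. \<bar>u t - u x\<bar>) + 2 * y * \<bar>u x\<bar>)) \<longlongrightarrow> 1 / pi * 0 + 1 / pi * (0 + 2 * 0 * \<bar>u x\<bar>)) (at_right 0)"
      by (intro tendsto_intros poisson_kernel_lebesgue_point[OF u x] loc)
    then show "((\<lambda>y. 1 / pi * (LBINT t. y / ((x - t)\<^sup>2 + y\<^sup>2) * \<bar>u t - u x\<bar>)
        + 1 / pi * ((LBINT t:{x-y..x+y}. \<bar>u t - u x\<bar>) + 2 * y * \<bar>u x\<bar>)) \<longlongrightarrow> 0) (at_right 0)"
      by simp
  qed
  from tendsto_add[OF this v[unfolded has_hilbert_transform_at_def, folded T_def]] show ?thesis by simp
qed

text \<open>This serves the sawtooth \<beta>, for which no Hilbert transform is given. Only the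
  existence of the limit matters, since its value enters the modulus of the final function and not
  its phase. A Lipschitz bound at x makes the integrand bounded near x once \<open>u x\<close> is
  subtracted on a symmetric interval, so dominated convergence applies.\<close>

lemma Im_schwarz_convergent:
  assumes u: "poisson_integrable u" and d: "d > 0" and L: "\<And>t. \<bar>x - t\<bar> \<le> d \<Longrightarrow> \<bar>u t - u x\<bar> \<le> L * \<bar>x - t\<bar>"
  shows "\<exists>l. ((\<lambda>y. Im (schwarz u (Complex x y))) \<longlongrightarrow> l) (at_right 0)"
proof -
  have um [measurable]: "u \<in> borel_measurable borel" using u by (simp add: poisson_integrable_def)
  define A where "A = {x-d..x+d}"
  have [measurable]: "A \<in> sets borel" by (simp add: A_def)
  have "0 \<le> L * d"
    using order_trans[OF abs_ge_zero L[of "x + d"]] d by simp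
  then have "L \<ge> 0" using d by (simp add: zero_le_mult_iff)
  \<comment> \<open>Heights are kept below 1, so the modulus of the point is at most \<bar>x\<bar> +
    1; the kernel bound at distance at least d then gives this constant.\<close>
  define C where "C = (\<bar>x\<bar> + 1) + (1 + (\<bar>x\<bar> + 1)\<^sup>2) / d"
  \<comment> \<open>The subtracted term is odd about x and integrates to 0, so q y has the same
    integral as the original integrand for y > 0, but keeps an integrable majorant as y tends to
    0.\<close>
  define q where "q y t = (x - t) / ((x - t)\<^sup>2 + y\<^sup>2) * (u t - u x * indicator A t) + t / (1 + t\<^sup>2) * u t" for y t
  have Im_eq: "Im (schwarz u (Complex x y)) = 1 / pi * (LBINT t. q y t)" if y: "y > 0" for y
  proof -
    have i1: "integrable lborel (\<lambda>t. ((x - t) / ((x - t)\<^sup>2 + y\<^sup>2) + t / (1 + t\<^sup>2)) * u t)"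
      using integrable_Re[OF schwarz_integrable[OF u, of "Complex x y"]] y by (simp add: schwarz_kernel_Re)
    have i2: "integrable lborel (\<lambda>t. (x - t) / ((x - t)\<^sup>2 + y\<^sup>2) * (u x * indicator A t))"
    proof (rule Bochner_Integration.integrable_bound)
      show "integrable lborel (\<lambda>t. indicator {x-d..x+d} t *\<^sub>R (d / y\<^sup>2 * u x))"
        using poisson_integrable_locally[OF poisson_integrable_const] by (simp add: set_integrable_def)
      show "AE t in lborel. norm ((x - t) / ((x - t)\<^sup>2 + y\<^sup>2) * (u x * indicator A t)) \<le> norm (indicator {x-d..x+d} t *\<^sub>R (d / y\<^sup>2 * u x))"
      proof (rule AE_I2)
        fix t
        have "\<bar>x - t\<bar> / ((x - t)\<^sup>2 + y\<^sup>2) \<le> d / y\<^sup>2" if "\<bar>x - t\<bar> \<le> d"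
          using that y d by (intro frac_le) auto
        then have "\<bar>x - t\<bar> / ((x - t)\<^sup>2 + y\<^sup>2) * \<bar>u x\<bar> \<le> d / y\<^sup>2 * \<bar>u x\<bar>" if "\<bar>x - t\<bar> \<le> d"
          using that by (intro mult_right_mono) auto
        then show "norm ((x - t) / ((x - t)\<^sup>2 + y\<^sup>2) * (u x * indicator A t)) \<le> norm (indicator {x-d..x+d} t *\<^sub>R (d / y\<^sup>2 * u x))"
          using d y by (auto simp: A_def indicator_def abs_mult abs_divide abs_le_iff)
      qed
    qed measurable
    have "(LBINT t. (x - t) / ((x - t)\<^sup>2 + y\<^sup>2) * (u x * indicator A t)) = 0"
    proof (rule lborel_integral_antisymmetric[of _ x])
      fix t
      define s where "s = x - t"
      have "x - (2 * x - t) = - s" "indicator A (2 * x - t) = (indicator A t :: real)"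
        by (auto simp: s_def A_def indicator_def)
      then show "(x - (2 * x - t)) / ((x - (2 * x - t))\<^sup>2 + y\<^sup>2) * (u x * indicator A (2 * x - t))
          = - ((x - t) / ((x - t)\<^sup>2 + y\<^sup>2) * (u x * indicator A t))"
        unfolding s_def[symmetric] by simp
    qed
    moreover have "q y t = ((x - t) / ((x - t)\<^sup>2 + y\<^sup>2) + t / (1 + t\<^sup>2)) * u t
        - (x - t) / ((x - t)\<^sup>2 + y\<^sup>2) * (u x * indicator A t)" for t
    proof -
      have "c * (v - w) + e * v = (c + e) * v - c * w" for c e v w :: real by (simp add: algebra_simps)
      then show ?thesis unfolding q_def .
    qed
    ultimately show ?thesis
      using Bochner_Integration.integral_diff[OF i1 i2] by (simp add: Im_schwarz[OF u y])
  qed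
  have bound: "\<bar>q y t\<bar> \<le> indicator {x-d..x+d} t * L + indicator {x-d..x+d} t * \<bar>u t\<bar> + C * \<bar>u t / (1 + t\<^sup>2)\<bar>"
    if y: "0 < y" "y < 1" for y t
  proof (cases "t \<in> A")
    case True
    have C0: "0 \<le> C * \<bar>u t / (1 + t\<^sup>2)\<bar>" using d by (simp add: C_def)
    have a: "\<bar>x - t\<bar> \<le> d" using True by (auto simp: A_def)
    have p: "0 < (x - t)\<^sup>2 + y\<^sup>2" using y by (simp add: add_nonneg_pos)
    have "\<bar>(x - t) / ((x - t)\<^sup>2 + y\<^sup>2) * (u t - u x)\<bar> \<le> \<bar>x - t\<bar> / ((x - t)\<^sup>2 + y\<^sup>2) * (L * \<bar>x - t\<bar>)"
      unfolding abs_mult abs_divide using p by (intro mult_mono L a) auto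
    also have "\<dots> = L * ((x - t)\<^sup>2 / ((x - t)\<^sup>2 + y\<^sup>2))"
      by (simp add: power2_eq_square)
    also have "\<dots> \<le> L * 1" using p \<open>L \<ge> 0\<close> by (intro mult_left_mono) auto
    finally have 1: "\<bar>(x - t) / ((x - t)\<^sup>2 + y\<^sup>2) * (u t - u x)\<bar> \<le> L" by simp
    have "0 \<le> (\<bar>t\<bar> - 1)\<^sup>2" by simp
    then have "\<bar>t\<bar> \<le> 1 + t\<^sup>2" by (simp add: power2_eq_square algebra_simps)
    then have "\<bar>t / (1 + t\<^sup>2)\<bar> \<le> 1" using one_plus_square_pos[of t] by (simp add: abs_divide)
    then have "\<bar>t / (1 + t\<^sup>2) * u t\<bar> \<le> 1 * \<bar>u t\<bar>" unfolding abs_mult by (rule mult_right_mono) simp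
    with 1 have "\<bar>q y t\<bar> \<le> L + \<bar>u t\<bar>" using True unfolding q_def by (simp add: abs_triangle_ineq[THEN order_trans])
    then show ?thesis using True C0 unfolding A_def by simp
  next
    case False
    then have far: "d \<le> \<bar>x - t\<bar>" by (auto simp: A_def)
    let ?z = "Complex x y"
    have zt: "d \<le> cmod (?z - of_real t)" using abs_Re_le_cmod[of "?z - of_real t"] far by simp
    have zx: "cmod ?z \<le> \<bar>x\<bar> + 1" using cmod_le[of ?z] y by simp
    have "q y t = Re (schwarz_kernel ?z t) * u t" using False by (simp add: q_def schwarz_kernel_Re algebra_simps)
    then have "\<bar>q y t\<bar> \<le> cmod (schwarz_kernel ?z t) * \<bar>u t\<bar>"
      by (simp add: abs_mult mult_right_mono abs_Re_le_cmod)
    also have "\<dots> \<le> (cmod ?z + cmod (1 + ?z\<^sup>2) / cmod (?z - of_real t)) / (1 + t\<^sup>2) * \<bar>u t\<bar>"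
      using y by (intro mult_right_mono schwarz_kernel_bound) (auto simp: complex_eq_iff)
    also have "\<dots> \<le> C / (1 + t\<^sup>2) * \<bar>u t\<bar>"
    proof (intro mult_right_mono divide_right_mono)
      have "cmod (1 + ?z\<^sup>2) \<le> 1 + (cmod ?z)\<^sup>2" using norm_triangle_ineq[of 1 "?z\<^sup>2"] by (simp add: norm_power)
      also have "\<dots> \<le> 1 + (\<bar>x\<bar> + 1)\<^sup>2" using zx by (intro add_left_mono power_mono) auto
      finally have "cmod (1 + ?z\<^sup>2) / cmod (?z - of_real t) \<le> (1 + (\<bar>x\<bar> + 1)\<^sup>2) / d"
        using zt d by (intro frac_le) auto
      then show "cmod ?z + cmod (1 + ?z\<^sup>2) / cmod (?z - of_real t) \<le> C" using zx by (simp add: C_def)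
    qed (use one_plus_square_pos[of t] in auto)
    also have "\<dots> = C * \<bar>u t / (1 + t\<^sup>2)\<bar>" using one_plus_square_pos[of t] by (simp add: abs_divide)
    finally show ?thesis using False \<open>L \<ge> 0\<close> by (simp add: A_def)
  qed
  have "((\<lambda>y. Im (schwarz u (Complex x y))) \<longlongrightarrow> 1 / pi * (LBINT t. q 0 t)) (at_right 0)"
  proof (rule tendsto_at_right_sequentially[of 0 1])
    fix S :: "nat \<Rightarrow> real" assume S: "\<And>n. 0 < S n" "\<And>n. S n < 1" "S \<longlonglongrightarrow> 0"
    have "(\<lambda>n. LBINT t. q (S n) t) \<longlonglongrightarrow> (LBINT t. q 0 t)"
    proof (rule integral_dominated_convergence)
      show "integrable lborel (\<lambda>t. indicator {x-d..x+d} t * L + indicator {x-d..x+d} t * \<bar>u t\<bar> + C * \<bar>u t / (1 + t\<^sup>2)\<bar>)"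
        using poisson_integrable_locally[OF poisson_integrable_const, of "x-d" "x+d" L]
          poisson_integrable_locally[OF poisson_integrable_abs[OF u], of "x-d" "x+d"] u
        unfolding set_integrable_def poisson_integrable_def
        by (intro Bochner_Integration.integrable_add integrable_mult_right integrable_abs) simp_all
      show "AE t in lborel. norm (q (S n) t) \<le> indicator {x-d..x+d} t * L + indicator {x-d..x+d} t * \<bar>u t\<bar> + C * \<bar>u t / (1 + t\<^sup>2)\<bar>" for n
        unfolding real_norm_def by (intro AE_I2 bound S)
      show "AE t in lborel. (\<lambda>n. q (S n) t) \<longlonglongrightarrow> q 0 t"
        using AE_lborel_singleton[of x]
      proof eventually_elim
        case (elim t)
        then show ?case unfolding q_def by (intro tendsto_intros S(3)) auto
      qed
    qed (simp_all add: q_def[abs_def])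
    then have "(\<lambda>n. 1 / pi * (LBINT t. q (S n) t)) \<longlonglongrightarrow> 1 / pi * (LBINT t. q 0 t)"
      by (intro tendsto_intros)
    then show "(\<lambda>n. Im (schwarz u (Complex x (S n)))) \<longlonglongrightarrow> 1 / pi * (LBINT t. q 0 t)"
      by (simp add: Im_eq S)
  qed simp
  then show ?thesis by blast
qed

section \<open>Growth of the conjugate function under a one-sided increment bound\<close>

text \<open>For g supported on the positive half-line the symmetrised function is its even extension
  about x; one-sided antiderivatives thus yield majorants in \<bar>t - x\<bar>.\<close>

lemma lborel_integral_even:
  fixes g :: "real \<Rightarrow> real"
  assumes g: "integrable lborel g" and I: "(LBINT s. g s) = I"
  shows "integrable lborel (\<lambda>t. g (t - x) + g (x - t))" "(LBINT t. g (t - x) + g (x - t)) = 2 * I"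
proof -
  have i: "integrable lborel (\<lambda>t. g (t - x))" "integrable lborel (\<lambda>t. g (x - t))"
    using lborel_integrable_real_affine[OF g, of 1 "-x"] lborel_integrable_real_affine[OF g, of "-1" x]
    by (simp_all add: add.commute)
  then show "integrable lborel (\<lambda>t. g (t - x) + g (x - t))" by simp
  have "(LBINT t. g (t - x)) = I" "(LBINT t. g (x - t)) = I"
    using lborel_integral_real_affine[of 1 g "-x"] lborel_integral_real_affine[of "-1" g x] I
    by (simp_all add: add.commute)
  then show "(LBINT t. g (t - x) + g (x - t)) = 2 * I" using i by simp
qed

lemma integral_inverse_Icc:
  fixes a b :: real
  assumes "0 < a" "a \<le> b"
  shows "integrable lborel (\<lambda>s. 1 / s * indicator {a..b} s)"
    "(LBINT s. 1 / s * indicator {a..b} s) = ln b - ln a"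
proof -
  have D: "DERIV ln s :> 1 / s" if "a \<le> s" "s \<le> b" for s
    using that assms by (auto intro!: derivative_eq_intros)
  have c: "isCont (\<lambda>s. 1 / s) s" if "a \<le> s" "s \<le> b" for s
    using that assms by (intro continuous_intros) auto
  have n: "0 \<le> 1 / s" if "a \<le> s" "s \<le> b" for s using that assms by simp
  show "(LBINT s. 1 / s * indicator {a..b} s) = ln b - ln a"
    by (rule integral_FTC_Icc_real[OF assms(2) D c])
  show "integrable lborel (\<lambda>s. 1 / s * indicator {a..b} s)"
    using borel_integrable_atLeastAtMost[OF c] by (simp add: indicator_def if_distrib cong: if_cong)
qed

lemma integral_log_kernel_Icc:
  fixes b :: real
  assumes "0 \<le> b"
  shows "integrable lborel (\<lambda>s. s / (1 + s\<^sup>2) * indicator {0..b} s)"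
    "(LBINT s. s / (1 + s\<^sup>2) * indicator {0..b} s) = ln (1 + b\<^sup>2) / 2"
proof -
  have D: "DERIV (\<lambda>s. ln (1 + s\<^sup>2) / 2) s :> s / (1 + s\<^sup>2)" if "0 \<le> s" "s \<le> b" for s
  proof -
    have "1 + s\<^sup>2 \<noteq> 0" using one_plus_square_pos[of s] by simp
    then show ?thesis using one_plus_square_pos[of s]
      by (auto intro!: derivative_eq_intros simp: divide_simps)
  qed
  have c: "isCont (\<lambda>s. s / (1 + s\<^sup>2)) s" if "0 \<le> s" "s \<le> b" for s
    using one_plus_square_pos[of s] by (intro continuous_intros) auto
  show "(LBINT s. s / (1 + s\<^sup>2) * indicator {0..b} s) = ln (1 + b\<^sup>2) / 2"
    using integral_FTC_Icc_real[OF assms D c] by simp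
  show "integrable lborel (\<lambda>s. s / (1 + s\<^sup>2) * indicator {0..b} s)"
    using borel_integrable_atLeastAtMost[OF c] by (simp add: indicator_def if_distrib cong: if_cong)
qed

lemma integral_inverse_square_Ici:
  fixes R :: real
  assumes "0 < R"
  shows "integrable lborel (\<lambda>s. R / s\<^sup>2 * indicator {R..} s)"
    "(LBINT s. R / s\<^sup>2 * indicator {R..} s) = 1"
proof -
  have nn: "(\<integral>\<^sup>+ s. ennreal (R / s\<^sup>2) * indicator {R..} s \<partial>lborel) = ennreal (0 - (- (R / R)))"
  proof (rule nn_integral_FTC_atLeast[where F = "\<lambda>s. - (R / s)"])
    show "DERIV (\<lambda>s. - (R / s)) s :> R / s\<^sup>2" if "R \<le> s" for s
      using that assms by (auto intro!: derivative_eq_intros simp: power2_eq_square)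
    show "((\<lambda>s. - (R / s)) \<longlongrightarrow> 0) at_top"
      using tendsto_minus[OF tendsto_divide_0[OF tendsto_const[of R] filterlim_at_top_imp_at_infinity[OF filterlim_ident]]]
      by simp
  qed (use assms in auto)
  have eq: "ennreal (R / s\<^sup>2 * indicator {R..} s) = ennreal (R / s\<^sup>2) * indicator {R..} s" for s
    by (auto simp: indicator_def)
  have nn': "(\<integral>\<^sup>+ s. ennreal (R / s\<^sup>2 * indicator {R..} s) \<partial>lborel) = ennreal 1"
    unfolding eq nn using assms by simp
  have m: "(\<lambda>s. R / s\<^sup>2 * indicator {R..} s) \<in> borel_measurable lborel" by measurable
  have p: "AE s in lborel. 0 \<le> R / s\<^sup>2 * indicator {R..} s" using assms by (auto simp: indicator_def)
  show "integrable lborel (\<lambda>s. R / s\<^sup>2 * indicator {R..} s)"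
    by (rule integrableI_nn_integral_finite[OF m p nn'])
  show "(LBINT s. R / s\<^sup>2 * indicator {R..} s) = 1"
    using integral_eq_nn_integral[OF m p] nn' by simp
qed

lemma poisson_integrable_bounded:
  assumes "u \<in> borel_measurable borel" "\<And>t. \<bar>u t\<bar> \<le> M"
  shows "poisson_integrable u"
  unfolding poisson_integrable_def
proof (intro conjI assms(1))
  show "integrable lborel (\<lambda>t. u t / (1 + t\<^sup>2))"
  proof (rule poisson_integrable_abs_bound[OF poisson_integrable_const[of 1]])
    show "(\<lambda>t. u t / (1 + t\<^sup>2)) \<in> borel_measurable borel" using assms(1) by measurable
    show "norm (u t / (1 + t\<^sup>2)) \<le> M / (1 + t\<^sup>2) * \<bar>1\<bar>" for t
      using assms(2)[of t] one_plus_square_pos[of t] by (simp add: abs_divide divide_right_mono)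
  qed
qed

text \<open>Pairing t with 2 * x - t turns the odd kernel into s / (s^2 + y^2) times the symmetric
  increment of u. The kernel factor is positive, so an upper bound for the increment is enough, and
  s^2 / (s^2 + y^2) \<le> 1 makes the result independent of y. Large negative increments do no
  harm.\<close>

lemma near_diagonal_bound:
  fixes u :: "real \<Rightarrow> real"
  assumes u: "u \<in> borel_measurable borel" "\<And>t. \<bar>u t\<bar> \<le> M" and "y > 0" "d > 0"
    and inc: "\<And>s. 0 < s \<Longrightarrow> s \<le> d \<Longrightarrow> u (x + s) - u (x - s) \<le> L * s" and "L \<ge> 0"
  defines "a \<equiv> \<lambda>t. indicator {x-d..x+d} t * ((t - x) / ((t - x)\<^sup>2 + y\<^sup>2) * u t)"
  shows "integrable lborel a" "(LBINT t. a t) \<le> d * L"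
proof -
  note [measurable] = u(1)
  have D: "(t - x)\<^sup>2 + y\<^sup>2 > 0" for t
    using zero_less_power[OF \<open>y > 0\<close>, of 2] zero_le_power2[of "t - x"] by linarith
  show ia: "integrable lborel a"
  proof (rule Bochner_Integration.integrable_bound)
    show "integrable lborel (\<lambda>t. indicator {x-d..x+d} t *\<^sub>R (d / y\<^sup>2 * M))"
      using poisson_integrable_locally[OF poisson_integrable_const] by (simp add: set_integrable_def)
    show "AE t in lborel. norm (a t) \<le> norm (indicator {x-d..x+d} t *\<^sub>R (d / y\<^sup>2 * M))"
    proof (rule AE_I2)
      fix t
      have M: "M \<ge> 0" using u(2)[of t] by linarith
      have "\<bar>t - x\<bar> / ((t - x)\<^sup>2 + y\<^sup>2) * \<bar>u t\<bar> \<le> d / y\<^sup>2 * M" if "\<bar>t - x\<bar> \<le> d"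
        using that \<open>y > 0\<close> \<open>d > 0\<close> u(2) by (intro mult_mono frac_le) auto
      then show "norm (a t) \<le> norm (indicator {x-d..x+d} t *\<^sub>R (d / y\<^sup>2 * M))"
        using M D[of t] \<open>d > 0\<close> by (auto simp: a_def indicator_def abs_mult abs_divide abs_le_iff)
    qed
    show "a \<in> borel_measurable lborel" unfolding a_def by measurable
  qed
  have ir: "integrable lborel (\<lambda>t. a (2 * x - t))"
    using lborel_integrable_real_affine[OF ia, of "-1" "2 * x"] by simp
  have "(LBINT t. a (2 * x - t)) = (LBINT t. a t)"
    using lborel_integral_real_affine[of "-1" a "2 * x"] by simp
  then have "2 * (LBINT t. a t) = (LBINT t. a t + a (2 * x - t))" using ia ir by simp
  also have "\<dots> \<le> (LBINT t. indicator {x-d..x+d} t * L)"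
  proof (rule integral_mono)
    show "integrable lborel (\<lambda>t. a t + a (2 * x - t))" using ia ir by simp
    show "integrable lborel (\<lambda>t. indicator {x-d..x+d} t * L)"
      using poisson_integrable_locally[OF poisson_integrable_const, of "x-d" "x+d" L] by (simp add: set_integrable_def)
    have pos: "s / (s\<^sup>2 + y\<^sup>2) * (u (x + s) - u (x - s)) \<le> L" if "0 < s" "s \<le> d" for s
    proof -
      have "s / (s\<^sup>2 + y\<^sup>2) * (u (x + s) - u (x - s)) \<le> s / (s\<^sup>2 + y\<^sup>2) * (L * s)"
        using that by (intro mult_left_mono inc) auto
      also have "\<dots> = L * (s\<^sup>2 / (s\<^sup>2 + y\<^sup>2))" by (simp add: power2_eq_square)
      also have "\<dots> \<le> L * 1" using \<open>L \<ge> 0\<close> D[of "x + s"] by (intro mult_left_mono) auto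
      finally show ?thesis by simp
    qed
    fix t
    show "a t + a (2 * x - t) \<le> indicator {x-d..x+d} t * L"
    proof (cases "\<bar>t - x\<bar> \<le> d")
      case False
      then show ?thesis by (auto simp: a_def indicator_def abs_le_iff)
    next
      case True
      consider "t = x" | "t > x" | "t < x" by linarith
      then show ?thesis
      proof cases
        case 1 then show ?thesis using \<open>L \<ge> 0\<close> \<open>d > 0\<close> by (simp add: a_def)
      next
        case 2
        define s where "s = t - x"
        have s: "t = x + s" "2 * x - t = x - s" "0 < s" "s \<le> d" using 2 True by (auto simp: s_def)
        show ?thesis using pos[OF s(3,4)] s by (simp add: a_def s(1) s(2) right_diff_distrib)
      next
        case 3
        define s where "s = x - t"
        have s: "t = x - s" "2 * x - t = x + s" "0 < s" "s \<le> d" using 3 True by (auto simp: s_def)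
        show ?thesis using pos[OF s(3,4)] s by (simp add: a_def s(1) s(2) right_diff_distrib)
      qed
    qed
  qed
  also have "\<dots> = 2 * (d * L)" using \<open>d > 0\<close> by simp
  finally show "(LBINT t. a t) \<le> d * L" by simp
qed

text \<open>Boundedness of u alone costs logarithms. With r = 2 + \<bar>z\<bar>, the kernel 1 /
  \<bar>t - x\<bar> between the distances d and R gives 2 * (ln R - ln d), where -ln d is at most K
  * ln r; the compensating term gives about 2 * ln r. Together this is the factor 4 + 2 * K. The
  increment bound is used only below distance d.\<close>

lemma Im_schwarz_growth:
  fixes u :: "real \<Rightarrow> real"
  assumes u: "u \<in> borel_measurable borel" "\<And>t. \<bar>u t\<bar> \<le> M" and "K \<ge> 0" "B \<ge> 0"
    and inc: "\<And>x s. 0 < s \<Longrightarrow> s \<le> 1 \<Longrightarrow> u (x + s) - u (x - s) \<le> B * (2 + \<bar>x\<bar>) powr K * s"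
    and z: "Im z > 0"
  shows "- pi * Im (schwarz u z) \<le> M * (4 + 2 * K) * ln (2 + cmod z) + (M * (2 * ln 2 + ln 17 + 6) + B)"
proof -
  define x where "x = Re z" define y where "y = Im z"
  have zxy: "z = Complex x y" by (simp add: x_def y_def)
  have y: "y > 0" using z by (simp add: y_def)
  have M: "M \<ge> 0" using u(2)[of 0] by linarith
  note up = poisson_integrable_bounded[OF u]
  define r where "r = 2 + cmod z"
  \<comment> \<open>As R exceeds 2 * \<bar>x\<bar>, the condition \<bar>t - x\<bar> > R implies
    \<bar>t - x\<bar> \<le> 2 * \<bar>t\<bar>, and \<bar>t - x\<bar> \<le> R implies \<bar>t\<bar>
    \<le> 2 * R.\<close>
  define R where "R = 2 * r"
  \<comment> \<open>This radius cancels the polynomial factor of the increment bound, so the near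
    part is at most B; its logarithm is only of size K * ln r.\<close>
  define d where "d = (2 + \<bar>x\<bar>) powr (- K)"
  have r: "r \<ge> 2" "\<bar>x\<bar> \<le> r - 2" using abs_Re_le_cmod[of z] by (auto simp: r_def x_def)
  have R: "R > 0" "R \<ge> 2 * \<bar>x\<bar> + 4" using r by (auto simp: R_def)
  have d: "0 < d" "d \<le> 1" "d * (2 + \<bar>x\<bar>) powr K = 1"
    using \<open>K \<ge> 0\<close> by (auto simp: d_def powr_minus field_simps ge_one_powr_ge_zero)
  define a where "a t = indicator {x-d..x+d} t * ((t - x) / ((t - x)\<^sup>2 + y\<^sup>2) * u t)" for t
  have a: "integrable lborel a" "(LBINT t. a t) \<le> d * (B * (2 + \<bar>x\<bar>) powr K)"
  proof -
    have "u (x + s) - u (x - s) \<le> B * (2 + \<bar>x\<bar>) powr K * s" if "0 < s" "s \<le> d" for s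
      using that d by (intro inc) auto
    moreover have "0 \<le> B * (2 + \<bar>x\<bar>) powr K" using \<open>B \<ge> 0\<close> by simp
    ultimately show "integrable lborel a" "(LBINT t. a t) \<le> d * (B * (2 + \<bar>x\<bar>) powr K)"
      unfolding a_def using near_diagonal_bound[OF u y d(1), of x] by blast+
  qed
  \<comment> \<open>The three majorants: the singular kernel at middle distance, the compensating
    term for \<bar>t\<bar> up to 2 * R, and the whole kernel far away, where the two terms must be
    kept together because each alone decays only like 1 / \<bar>t\<bar>.\<close>
  define g1 where "g1 s = 1 / s * indicator {d..R} s" for s :: real
  define g2 where "g2 s = s / (1 + s\<^sup>2) * indicator {0..2 * R} s" for s :: real
  define g3 where "g3 s = R / s\<^sup>2 * indicator {R..} s" for s :: real
  define w where "w t = (g1 (t - x) + g1 (x - t)) + ((g2 (t - 0) + g2 (0 - t)) + 3 * (g3 (t - x) + g3 (x - t)))" for t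
  have dR: "d \<le> R" using d R by linarith
  have e1: "integrable lborel (\<lambda>t. g1 (t - x) + g1 (x - t))" "(LBINT t. g1 (t - x) + g1 (x - t)) = 2 * (ln R - ln d)"
    using lborel_integral_even[OF integral_inverse_Icc[OF d(1) dR], of x] by (simp_all only: g1_def)
  have e2: "integrable lborel (\<lambda>t. g2 (t - 0) + g2 (0 - t))" "(LBINT t. g2 (t - 0) + g2 (0 - t)) = 2 * (ln (1 + (2 * R)\<^sup>2) / 2)"
    using lborel_integral_even[OF integral_log_kernel_Icc[of "2 * R"], of 0] R by (simp_all only: g2_def)
  have e3: "integrable lborel (\<lambda>t. g3 (t - x) + g3 (x - t))" "(LBINT t. g3 (t - x) + g3 (x - t)) = 2 * 1"
    using lborel_integral_even[OF integral_inverse_square_Ici[OF R(1)], of x] by (simp_all only: g3_def)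
  have w: "integrable lborel w" "(LBINT t. w t) = 2 * (ln R - ln d) + ln (1 + (2 * R)\<^sup>2) + 6"
  proof -
    show "integrable lborel w" unfolding w_def
      by (intro Bochner_Integration.integrable_add integrable_mult_right e1 e2 e3)
    have "(LBINT t. w t) = (LBINT t. g1 (t - x) + g1 (x - t)) + ((LBINT t. g2 (t - 0) + g2 (0 - t)) + 3 * (LBINT t. g3 (t - x) + g3 (x - t)))"
      unfolding w_def
      by (subst Bochner_Integration.integral_add, intro e1,
          intro Bochner_Integration.integrable_add integrable_mult_right e2 e3,
          subst Bochner_Integration.integral_add, intro e2, intro integrable_mult_right e3,
          subst integral_mult_right_zero, rule refl)
    then show "(LBINT t. w t) = 2 * (ln R - ln d) + ln (1 + (2 * R)\<^sup>2) + 6" unfolding e1 e2 e3 by simp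
  qed
  have g0: "g1 s \<ge> 0" "g2 s \<ge> 0" "g3 s \<ge> 0" for s
    using d R one_plus_square_pos[of s] by (auto simp: g1_def g2_def g3_def indicator_def)
  have g2: "\<bar>t / (1 + t\<^sup>2)\<bar> \<le> g2 (t - 0) + g2 (0 - t)" if "\<bar>t\<bar> \<le> 2 * R" for t
    using that R one_plus_square_pos[of t] by (auto simp: g2_def indicator_def abs_divide)
  have w0: "w t \<ge> 0" for t using g0 by (simp add: w_def)
  define k where "k t = (x - t) / ((x - t)\<^sup>2 + y\<^sup>2) + t / (1 + t\<^sup>2)" for t
  have pt: "- (k t * u t) \<le> a t + M * w t" for t
  proof -
    have D: "(x - t)\<^sup>2 + y\<^sup>2 > 0" using y by (simp add: add_nonneg_pos)
    consider "\<bar>t - x\<bar> \<le> d" | "d < \<bar>t - x\<bar>" "\<bar>t - x\<bar> \<le> R" | "R < \<bar>t - x\<bar>" by linarith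
    then show ?thesis
    proof cases
      case 1
      then have "\<bar>t / (1 + t\<^sup>2)\<bar> \<le> w t" using g2[of t] g0 d R by (simp add: w_def add_nonneg_nonneg add_increasing add_increasing2)
      then have "\<bar>t / (1 + t\<^sup>2)\<bar> * \<bar>u t\<bar> \<le> w t * M" by (intro mult_mono u w0) auto
      then have "- (t / (1 + t\<^sup>2) * u t) \<le> M * w t"
        using abs_ge_minus_self[of "t / (1 + t\<^sup>2) * u t"] unfolding abs_mult mult.commute[of M]
        by (rule order_trans[rotated])
      moreover have "- (k t * u t) = a t - t / (1 + t\<^sup>2) * u t"
      proof -
        have "(x - t) / ((x - t)\<^sup>2 + y\<^sup>2) = - ((t - x) / ((t - x)\<^sup>2 + y\<^sup>2))"
          by (metis minus_diff_eq minus_divide_left power2_commute)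
        moreover have "indicator {x-d..x+d} t = (1::real)" using 1 by (auto simp: indicator_def)
        ultimately show ?thesis by (simp add: k_def a_def algebra_simps)
      qed
      ultimately show ?thesis by linarith
    next
      case 2
      have t2: "\<bar>t\<bar> \<le> 2 * R" using 2 R by linarith
      have "(x - t)\<^sup>2 = \<bar>t - x\<bar> * \<bar>t - x\<bar>" by (simp add: power2_eq_square algebra_simps)
      then have "\<bar>x - t\<bar> / ((x - t)\<^sup>2 + y\<^sup>2) \<le> \<bar>t - x\<bar> / (\<bar>t - x\<bar> * \<bar>t - x\<bar>)"
        using 2 d by (intro frac_le mult_pos_pos) auto
      also have "\<dots> = 1 / \<bar>t - x\<bar>"
        using 2 d by (subst nonzero_divide_mult_cancel_left) auto
      also have "\<dots> = g1 (t - x) + g1 (x - t)" using 2 d by (auto simp: g1_def indicator_def abs_if)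
      finally have "\<bar>k t\<bar> \<le> (g1 (t - x) + g1 (x - t)) + (g2 (t - 0) + g2 (0 - t))"
        using g2[OF t2] D abs_triangle_ineq[of "(x - t) / ((x - t)\<^sup>2 + y\<^sup>2)" "t / (1 + t\<^sup>2)"]
        by (simp add: k_def abs_divide)
      also have "\<dots> \<le> w t" using g0 by (simp add: w_def)
      finally have "\<bar>k t\<bar> * \<bar>u t\<bar> \<le> w t * M" by (intro mult_mono u w0) auto
      then have "- (k t * u t) \<le> M * w t"
        using abs_ge_minus_self[of "k t * u t"] unfolding abs_mult mult.commute[of M]
        by (rule order_trans[rotated])
      moreover have "a t = 0" using 2 by (auto simp: a_def indicator_def)
      ultimately show ?thesis by simp
    next
      case 3
      have zt: "R \<le> cmod (z - of_real t)" using 3 abs_Re_le_cmod[of "z - of_real t"] by (simp add: x_def)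
      have "z \<noteq> of_real t" using z by auto
      have "\<bar>k t\<bar> \<le> cmod (schwarz_kernel z t)"
        using abs_Re_le_cmod[of "schwarz_kernel z t"] by (simp add: zxy schwarz_kernel_Re k_def)
      also have "\<dots> \<le> (cmod z + cmod (1 + z\<^sup>2) / cmod (z - of_real t)) / (1 + t\<^sup>2)"
        by (rule schwarz_kernel_bound) fact
      \<comment> \<open>The modulus of z is at most r = R / 2 and the quotient at most r / 2 = R /
        4; the result is 3 * R / (t - x)^2, the origin of the factor 3 in \<open>w\<close>.\<close>
      also have "\<dots> \<le> (3 / 4 * R) / ((t - x)\<^sup>2 / 4)"
      proof (rule frac_le)
        have "cmod (1 + z\<^sup>2) \<le> 1 + (cmod z)\<^sup>2" using norm_triangle_ineq[of 1 "z\<^sup>2"] by (simp add: norm_power)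
        also have "\<dots> \<le> r\<^sup>2" by (simp add: r_def power2_eq_square algebra_simps)
        finally have "cmod (1 + z\<^sup>2) / cmod (z - of_real t) \<le> r\<^sup>2 / R" using zt R by (intro frac_le) auto
        also have "\<dots> = r / 2" using r by (simp add: R_def power2_eq_square)
        finally have q: "cmod (1 + z\<^sup>2) / cmod (z - of_real t) \<le> r / 2" .
        have "c + q \<le> 3 / 4 * (2 * (2 + c))" if "q \<le> (2 + c) / 2" for c q :: real using that by simp
        from this[OF q[unfolded r_def]]
        show "cmod z + cmod (1 + z\<^sup>2) / cmod (z - of_real t) \<le> 3 / 4 * R"
          unfolding R_def r_def .
        have "\<bar>t - x\<bar> \<le> 2 * \<bar>t\<bar>" using 3 R by linarith
        then have "\<bar>t - x\<bar>\<^sup>2 \<le> (2 * \<bar>t\<bar>)\<^sup>2" by (intro power_mono) auto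
        then show "(t - x)\<^sup>2 / 4 \<le> 1 + t\<^sup>2" by simp
        show "0 < (t - x)\<^sup>2 / 4" using 3 R by auto
        show "0 \<le> 3 / 4 * R" using R by simp
      qed
      also have "\<dots> = 3 * (g3 (t - x) + g3 (x - t))" using 3 R by (auto simp: g3_def indicator_def power2_commute)
      also have "\<dots> \<le> w t" using g0 by (simp add: w_def)
      finally have "\<bar>k t\<bar> * \<bar>u t\<bar> \<le> w t * M" by (intro mult_mono u w0) auto
      then have "- (k t * u t) \<le> M * w t"
        using abs_ge_minus_self[of "k t * u t"] unfolding abs_mult mult.commute[of M]
        by (rule order_trans[rotated])
      moreover have "a t = 0" using 3 R d by (auto simp: a_def indicator_def)
      ultimately show ?thesis by simp
    qed
  qed
  have ik: "integrable lborel (\<lambda>t. k t * u t)"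
    using integrable_Re[OF schwarz_integrable[OF up, of "Complex x y"]] y by (simp add: schwarz_kernel_Re k_def)
  have "- pi * Im (schwarz u z) = (LBINT t. - (k t * u t))"
    using Im_schwarz[OF up y, of x] by (simp add: zxy k_def)
  also have "\<dots> \<le> (LBINT t. a t + M * w t)"
    by (intro integral_mono pt Bochner_Integration.integrable_minus ik Bochner_Integration.integrable_add
        integrable_mult_right a w)
  also have "\<dots> = (LBINT t. a t) + M * (LBINT t. w t)"
    by (subst Bochner_Integration.integral_add) (auto intro!: a w)
  also have "\<dots> \<le> B + M * (2 * (ln R - ln d) + ln (1 + (2 * R)\<^sup>2) + 6)"
    using a(2) d(3) by (simp add: w(2) mult.left_commute)
  \<comment> \<open>The constants come from R = 2 * r, from 1 + (4 * r)^2 \<le> 17 * r^2, and from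
    three times the two-sided far integral.\<close>
  also have "\<dots> \<le> B + M * ((4 + 2 * K) * ln r + (2 * ln 2 + ln 17 + 6))"
  proof -
    have "ln R = ln 2 + ln r" using r by (simp add: R_def ln_mult)
    moreover have "- ln d = K * ln (2 + \<bar>x\<bar>)" by (simp add: d_def ln_powr)
    moreover have "K * ln (2 + \<bar>x\<bar>) \<le> K * ln r" using \<open>K \<ge> 0\<close> r by (intro mult_left_mono) auto
    moreover have "ln (1 + (2 * R)\<^sup>2) \<le> ln 17 + 2 * ln r"
    proof -
      have "1 \<le> r\<^sup>2" using r by (simp add: one_le_power)
      then have "1 + (2 * R)\<^sup>2 \<le> 17 * r\<^sup>2" by (simp add: R_def power2_eq_square)
      then have "ln (1 + (2 * R)\<^sup>2) \<le> ln (17 * r\<^sup>2)" using one_plus_square_pos[of "2 * R"] by (intro ln_mono) auto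
      also have "\<dots> = ln 17 + 2 * ln r" using r by (simp add: ln_mult ln_realpow)
      finally show ?thesis .
    qed
    ultimately have "2 * (ln R - ln d) + ln (1 + (2 * R)\<^sup>2) + 6 \<le> (4 + 2 * K) * ln r + (2 * ln 2 + ln 17 + 6)"
      by (simp add: ring_distribs)
    then show ?thesis using M by (intro add_left_mono mult_left_mono)
  qed
  finally show ?thesis by (simp add: r_def algebra_simps)
qed

section \<open>Sawtooth phases and membership in the model space\<close>

text \<open>Affine substitutions and Fubini are used on \<open>lborel\<close>, whereas \<Omega> is
  only Lebesgue measurable. Changing it on a null set alters no truncated integral, so the principal
  values survive; the maximum with 0 restores nonnegativity at every point.\<close>

lemma borel_representative:
  assumes \<Omega>: "integrable poisson_measure \<Omega>" "\<And>x. 0 \<le> \<Omega> x" and h: "is_hilbert_transform \<Omega> v"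
  obtains u where "poisson_integrable u" "\<And>x. 0 \<le> u x" "AE x in lborel. u x = \<Omega> x"
    "AE x in lborel. has_hilbert_transform_at u (v x) x"
proof -
  have \<Omega>m [measurable]: "\<Omega> \<in> borel_measurable lebesgue"
    using borel_measurable_integrable[OF \<Omega>(1)] by (simp add: poisson_measure_def)
  obtain g where g: "g \<in> borel_measurable lborel" "AE x in lborel. \<Omega> x = g x"
    using completion_ex_borel_measurable_real[OF \<Omega>m] by blast
  define u where "u x = max 0 (g x)" for x
  have um [measurable]: "u \<in> borel_measurable borel" using g(1) unfolding u_def by simp
  have ae: "AE x in lborel. u x = \<Omega> x"
    using g(2)
  proof eventually_elim
    case (elim x)
    then show ?case using \<Omega>(2)[of x] by (simp add: u_def)
  qed
  have aeL: "AE x in lebesgue. u x = \<Omega> x" using ae by (rule AE_completion)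
  have umL: "u \<in> borel_measurable lebesgue" using um by (simp add: measurable_completion)
  have "integrable lebesgue (\<lambda>t. (1 / (1 + t\<^sup>2)) *\<^sub>R \<Omega> t)"
    using \<Omega>(1) unfolding poisson_measure_def
    by (subst (asm) integrable_density) (auto simp: measurable_completion less_imp_le[OF one_plus_square_pos])
  then have "integrable lebesgue (\<lambda>t. u t / (1 + t\<^sup>2))"
  proof (rule integrable_cong_AE_imp)
    show "(\<lambda>t. u t / (1 + t\<^sup>2)) \<in> borel_measurable lebesgue" by (intro measurable_completion) measurable
    show "AE t in lebesgue. (1 / (1 + t\<^sup>2)) *\<^sub>R \<Omega> t = u t / (1 + t\<^sup>2)" using aeL by eventually_elim simp
  qed
  then have "integrable lborel (\<lambda>t. u t / (1 + t\<^sup>2))"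
    by (subst (asm) integrable_completion) auto
  then have pu: "poisson_integrable u" using um by (simp add: poisson_integrable_def)
  have "(LINT t:{t. e < \<bar>x - t\<bar>}|lebesgue. (1 / (x - t) + t / (1 + t\<^sup>2)) * \<Omega> t)
      = (LINT t:{t. e < \<bar>x - t\<bar>}|lebesgue. (1 / (x - t) + t / (1 + t\<^sup>2)) * u t)" for x e
    unfolding set_lebesgue_integral_def
  proof (rule integral_cong_AE)
    have k: "(\<lambda>t. indicator {t. e < \<bar>x - t\<bar>} t *\<^sub>R (1 / (x - t) + t / (1 + t\<^sup>2))) \<in> borel_measurable lebesgue"
      by (intro measurable_completion) measurable
    show "(\<lambda>t. indicator {t. e < \<bar>x - t\<bar>} t *\<^sub>R ((1 / (x - t) + t / (1 + t\<^sup>2)) * \<Omega> t)) \<in> borel_measurable lebesgue"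
      "(\<lambda>t. indicator {t. e < \<bar>x - t\<bar>} t *\<^sub>R ((1 / (x - t) + t / (1 + t\<^sup>2)) * u t)) \<in> borel_measurable lebesgue"
      using borel_measurable_times[OF k \<Omega>m] borel_measurable_times[OF k umL] by (simp_all add: mult.assoc)
    show "AE t in lebesgue. indicator {t. e < \<bar>x - t\<bar>} t *\<^sub>R ((1 / (x - t) + t / (1 + t\<^sup>2)) * \<Omega> t)
        = indicator {t. e < \<bar>x - t\<bar>} t *\<^sub>R ((1 / (x - t) + t / (1 + t\<^sup>2)) * u t)"
      using aeL by eventually_elim simp
  qed
  then have "AE x in lebesgue. has_hilbert_transform_at u (v x) x"
    using h by (simp add: is_hilbert_transform_def has_hilbert_transform_at_def)
  then have "AE x in lborel. has_hilbert_transform_at u (v x) x" by (simp add: AE_completion_iff)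
  moreover have "0 \<le> u x" for x by (simp add: u_def)
  ultimately show ?thesis using that[OF pu _ ae] by blast
qed

section \<open>Reduction of a phase modulo 2 pi\<close>

definition sawtooth :: "(real \<Rightarrow> real) \<Rightarrow> real \<Rightarrow> real" where
  "sawtooth a t = a t - 2 * pi * of_int \<lfloor>a t / (2 * pi)\<rfloor>"

lemma sawtooth_abs_le: "\<bar>sawtooth a t\<bar> \<le> 2 * pi"
proof -
  have "sawtooth a t = 2 * pi * frac (a t / (2 * pi))"
    by (simp add: sawtooth_def frac_def right_diff_distrib)
  then show ?thesis
    using frac_ge_0[of "a t / (2 * pi)"] frac_lt_1[of "a t / (2 * pi)"] by (simp add: abs_mult)
qed

lemma sawtooth_measurable:
  assumes [measurable]: "a \<in> borel_measurable borel"
  shows "sawtooth a \<in> borel_measurable borel"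
  unfolding sawtooth_def by measurable

text \<open>The floor is monotone, so between s and t the reduction can only subtract further
  periods. This is where the upper increment bound of an increasing phase passes to its
  sawtooth.\<close>

lemma sawtooth_increment:
  assumes "a s \<le> a t"
  shows "sawtooth a t - sawtooth a s \<le> a t - a s"
proof -
  have "\<lfloor>a s / (2 * pi)\<rfloor> \<le> \<lfloor>a t / (2 * pi)\<rfloor>"
    using assms by (intro floor_mono divide_right_mono) auto
  then have "2 * pi * of_int \<lfloor>a s / (2 * pi)\<rfloor> \<le> 2 * pi * (of_int \<lfloor>a t / (2 * pi)\<rfloor> :: real)"
    by (intro mult_left_mono) auto
  then show ?thesis by (simp add: sawtooth_def)
qed

lemma sawtooth_locally:
  assumes "isCont a x" "a x / (2 * pi) \<notin> \<int>"
  obtains d where "d > 0" "\<And>t. \<bar>x - t\<bar> \<le> d \<Longrightarrow> sawtooth a t - sawtooth a x = a t - a x"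
proof -
  define k where "k = \<lfloor>a x / (2 * pi)\<rfloor>"
  have "of_int k \<noteq> a x / (2 * pi)" using assms(2) by (metis Ints_of_int)
  then have k: "of_int k < a x / (2 * pi)" "a x / (2 * pi) < of_int k + 1"
    unfolding k_def by linarith+
  have t: "((\<lambda>t. a t / (2 * pi)) \<longlongrightarrow> a x / (2 * pi)) (nhds x)"
    using assms(1) by (intro tendsto_intros) (simp_all add: continuous_at_imp_continuous_at_within isCont_def tendsto_at_iff_tendsto_nhds)
  have "eventually (\<lambda>t. of_int k < a t / (2 * pi) \<and> a t / (2 * pi) < of_int k + 1) (nhds x)"
    by (intro eventually_conj order_tendstoD[OF t] k)
  then obtain e where e: "e > 0" "\<And>t. dist t x < e \<Longrightarrow> of_int k < a t / (2 * pi) \<and> a t / (2 * pi) < of_int k + 1"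
    unfolding eventually_nhds_metric by blast
  show ?thesis
  proof (rule that[of "e / 2"])
    show "e / 2 > 0" using e by simp
    fix t assume "\<bar>x - t\<bar> \<le> e / 2"
    then have "dist t x < e" using e(1) by (simp add: dist_real_def abs_minus_commute)
    then have "\<lfloor>a t / (2 * pi)\<rfloor> = k" using e(2)[of t] by (simp add: floor_eq_iff less_imp_le)
    then show "sawtooth a t - sawtooth a x = a t - a x" by (simp add: sawtooth_def k_def)
  qed
qed

text \<open>A strictly monotone function meets each multiple of 2 pi at most once, so the
  exceptional set is countable.\<close>

lemma AE_no_jump:
  fixes a :: "real \<Rightarrow> real"
  assumes "strict_mono a"
  shows "AE x in lborel. a x / (2 * pi) \<notin> \<int>"
proof -
  have "countable {x. a x / (2 * pi) \<in> \<int>}"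
  proof (rule countable_image_inj_on[where f = a])
    have "a ` {x. a x / (2 * pi) \<in> \<int>} \<subseteq> (\<lambda>k::int. 2 * pi * of_int k) ` UNIV"
    proof
      fix y assume "y \<in> a ` {x. a x / (2 * pi) \<in> \<int>}"
      then obtain k :: int where "y / (2 * pi) = of_int k" by (auto elim: Ints_cases)
      then show "y \<in> (\<lambda>k::int. 2 * pi * of_int k) ` UNIV" by (auto simp: field_simps)
    qed
    then show "countable (a ` {x. a x / (2 * pi) \<in> \<int>})" by (rule countable_subset) auto
    show "inj_on a {x. a x / (2 * pi) \<in> \<int>}" by (rule strict_mono_imp_inj_on[OF assms])
  qed
  then have "AE x in lborel. x \<notin> {x. a x / (2 * pi) \<in> \<int>}"
    by (intro AE_not_in countable_imp_null_set_lborel)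
  then show ?thesis by simp
qed

text \<open>This is the origin of the arctan in \<gamma>: dividing by the power 2 * m of x + \<i> a
  changes twice the argument by 4 * m * arctan (x / a) - 2 * pi * m, whose second term is a multiple
  of 2 pi.\<close>

lemma Complex_arctan_polar:
  assumes "a > 0"
  shows "Complex x a = of_real (a * sqrt (1 + (x / a)\<^sup>2)) * cis (pi / 2 - arctan (x / a))"
proof -
  have s: "sqrt (1 + (x / a)\<^sup>2) > 0" using one_plus_square_pos[of "x / a"] by simp
  then show ?thesis
    using assms by (auto simp: complex_eq_iff cos_diff sin_diff cos_arctan sin_arctan)
qed

text \<open>Twice the argument of the boundary values is the argument of \<open>\<Theta>\<close> up to a multiple of \<open>2\<pi>\<close>.\<close>

lemma phase_identity:
  fixes \<phi> v p x a b c \<beta> :: real and k :: int and m :: nat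
  assumes "a > 0" and \<beta>: "\<beta> = \<phi> + 2 * v - 4 * real m * arctan (x / a) - 2 * pi * of_int k"
  defines "f \<equiv> of_real c * exp (- (of_real p + \<i> * of_real v) + \<i> / 2 * (of_real \<beta> + \<i> * of_real b)) / Complex x a ^ (2 * m)"
  shows "f * cnj (exp (\<i> * of_real \<phi>)) = cnj f"
proof -
  define \<theta> where "\<theta> = arctan (x / a)"
  define \<rho> where "\<rho> = a * sqrt (1 + (x / a)\<^sup>2)"
  define \<psi> where "\<psi> = (\<beta> / 2 - v) - 2 * real m * (pi / 2 - \<theta>)"
  have e: "exp (- (of_real p + \<i> * of_real v) + \<i> / 2 * (of_real \<beta> + \<i> * of_real b))
      = of_real (exp (- p - b / 2)) * cis (\<beta> / 2 - v)"
  proof -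
    have "- (of_real p + \<i> * of_real v) + \<i> / 2 * (of_real \<beta> + \<i> * of_real b)
        = of_real (- p - b / 2) + \<i> * of_real (\<beta> / 2 - v)"
      by (simp add: complex_eq_iff)
    then show ?thesis by (simp only: exp_add cis_conv_exp exp_of_real)
  qed
  have "Complex x a ^ (2 * m) = of_real (\<rho> ^ (2 * m)) * cis (2 * real m * (pi / 2 - \<theta>))"
    unfolding Complex_arctan_polar[OF \<open>a > 0\<close>] \<rho>_def[symmetric] \<theta>_def[symmetric]
    by (simp only: power_mult_distrib Complex.DeMoivre of_real_power of_nat_mult of_nat_numeral)
  then have f: "f = of_real (c * exp (- p - b / 2) / \<rho> ^ (2 * m)) * cis \<psi>"
    unfolding f_def e \<psi>_def by (simp add: cis_divide[symmetric] mult_ac)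
  \<comment> \<open>The summand m in the integer collects the constant angles pi / 2 of the 2 * m
    denominator factors, counted twice.\<close>
  have "\<phi> = 2 * \<psi> + 2 * pi * of_int (k + int m)"
    unfolding \<psi>_def \<beta> \<theta>_def[symmetric] by (simp add: field_simps)
  then have "exp (\<i> * of_real \<phi>) = cis (2 * \<psi> + 2 * pi * of_int (k + int m))"
    by (simp add: cis_conv_exp)
  also have "\<dots> = cis (2 * \<psi>)"
    unfolding cis_mult[symmetric] by simp
  finally show ?thesis
    unfolding f by (simp add: cis_cnj mult.assoc cis_mult)
qed

section \<open>Vertical limits and a membership criterion for the model space\<close>

lemma Complex_at_right:
  "filterlim (\<lambda>y. Complex x y) (at (of_real x) within upper_half_plane) (at_right 0)"
  unfolding filterlim_at
proof
  show "((\<lambda>y. Complex x y) \<longlongrightarrow> of_real x) (at_right 0)"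
    unfolding Complex_eq by (auto intro!: tendsto_eq_intros)
  show "eventually (\<lambda>y. Complex x y \<in> upper_half_plane \<and> Complex x y \<noteq> of_real x) (at_right 0)"
    using eventually_at_right_less[of "0::real"]
    by eventually_elim (auto simp: upper_half_plane_def complex_eq_iff)
qed

text \<open>Limits along one fixed sequence of heights define a Borel function everywhere, and it
  agrees with the vertical limit wherever that exists.\<close>

lemma radial_limit_representative:
  assumes "F holomorphic_on upper_half_plane"
  obtains f where "f \<in> borel_measurable borel"
    "\<And>x l. ((\<lambda>y. F (Complex x y)) \<longlongrightarrow> l) (at_right 0) \<Longrightarrow> f x = l"
proof
  define f where "f x = lim (\<lambda>n. F (Complex x (inverse (real (Suc n)))))" for x
  show "f \<in> borel_measurable borel"
    unfolding f_def
    by (intro borel_measurable_lim_metric borel_measurable_continuous_onI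
        continuous_on_Complex_horizontal holomorphic_on_imp_continuous_on assms) simp
  have "filterlim (\<lambda>n. inverse (real (Suc n))) (at_right 0) sequentially"
    unfolding filterlim_at using LIMSEQ_inverse_real_of_nat by auto
  then show "f x = l" if "((\<lambda>y. F (Complex x y)) \<longlongrightarrow> l) (at_right 0)" for x l
    unfolding f_def using filterlim_compose[OF that] by (intro limI) blast
qed

text \<open>If h is the boundary function of \<Theta> G and g that of G, the phase condition gives
  \<open>f * cnj h = cnj (f * g)\<close>. The inner product is thus the conjugate of the integral of
  f * g, which vanishes because F decays and G is in H2.\<close>

lemma model_spaceI:
  assumes \<Theta>: "is_boundary_argument \<Theta> \<phi>" and F: "F holomorphic_on upper_half_plane"
    and dec: "\<And>z. Im z > 0 \<Longrightarrow> cmod (F z) \<le> 1 / (1 + cmod z)\<^sup>2"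
    and f: "f \<in> borel_measurable borel" "AE x in lborel. ((\<lambda>y. F (Complex x y)) \<longlongrightarrow> f x) (at_right 0)"
    and ph: "AE x in lborel. f x * cnj (exp (\<i> * of_real (\<phi> x))) = cnj (f x)"
  shows "f \<in> model_space \<Theta>"
proof -
  have fL: "f \<in> borel_measurable lebesgue" using f(1) by (simp add: measurable_completion)
  have "F \<in> hardy2"
    unfolding hardy2_def
  proof (intro CollectI conjI F)
    have "(SUP y\<in>{0<..}. \<integral>\<^sup>+ x. ennreal ((cmod (F (Complex x y)))\<^sup>2) \<partial>lebesgue) \<le> ennreal pi"
    proof (rule SUP_least)
      fix y :: real assume "y \<in> {0<..}"
      have "(\<integral>\<^sup>+ x. ennreal ((cmod (F (Complex x y)))\<^sup>2) \<partial>lborel) \<le> (\<integral>\<^sup>+ x. ennreal (1 / (1 + x\<^sup>2)) \<partial>lborel)"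
      proof (intro nn_integral_mono ennreal_leI)
        fix x
        let ?q = "1 + cmod (Complex x y)"
        have q: "1 + x\<^sup>2 \<le> ?q\<^sup>2" "1 \<le> ?q\<^sup>2"
        proof -
          have "x\<^sup>2 \<le> (cmod (Complex x y))\<^sup>2" by (simp add: cmod_power2)
          then show "1 + x\<^sup>2 \<le> ?q\<^sup>2" by (simp add: power2_eq_square algebra_simps add_increasing)
          then show "1 \<le> ?q\<^sup>2" by (smt (verit) zero_le_power2)
        qed
        have "(cmod (F (Complex x y)))\<^sup>2 \<le> (1 / ?q\<^sup>2)\<^sup>2"
          using dec[of "Complex x y"] \<open>y \<in> {0<..}\<close> by (intro power_mono) auto
        also have "\<dots> \<le> 1 / ?q\<^sup>2"
        proof -
          have "1 / ?q\<^sup>2 \<le> 1 / 1" using q(2) by (intro frac_le) auto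
          then show ?thesis unfolding power2_eq_square[of "1 / ?q\<^sup>2"] by (intro mult_left_le) simp_all
        qed
        also have "\<dots> \<le> 1 / (1 + x\<^sup>2)" using q one_plus_square_pos[of x] by (intro frac_le) auto
        finally show "(cmod (F (Complex x y)))\<^sup>2 \<le> 1 / (1 + x\<^sup>2)" .
      qed
      also have "\<dots> = ennreal pi"
        using nn_integral_eq_integral[OF integrable_cauchy] integral_cauchy one_plus_square_pos by (simp add: less_imp_le)
      finally show "(\<integral>\<^sup>+ x. ennreal ((cmod (F (Complex x y)))\<^sup>2) \<partial>lebesgue) \<le> ennreal pi"
        by (simp add: nn_integral_completion)
    qed
    then show "(SUP y\<in>{0<..}. \<integral>\<^sup>+ x. ennreal ((cmod (F (Complex x y)))\<^sup>2) \<partial>lebesgue) < \<infinity>"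
      by (rule le_less_trans) simp
  qed
  then have H: "f \<in> hardy2_boundary"
    unfolding hardy2_boundary_def has_boundary_function_def using f(2) fL by (auto intro: AE_completion)
  have "l2_inner f h = 0" if h: "h \<in> inner_hardy2_boundary \<Theta>" for h
  proof -
    from h obtain G where G: "G \<in> hardy2" and hm: "h \<in> borel_measurable lebesgue"
      and hl: "AE x in lborel. ((\<lambda>y. \<Theta> (Complex x y) * G (Complex x y)) \<longlongrightarrow> h x) (at_right 0)"
      unfolding inner_hardy2_boundary_def has_boundary_function_def by (auto simp: AE_completion_iff)
    have "G holomorphic_on upper_half_plane" using G by (simp add: hardy2_def)
    then obtain g where g: "g \<in> borel_measurable borel"
      "\<And>x l. ((\<lambda>y. G (Complex x y)) \<longlongrightarrow> l) (at_right 0) \<Longrightarrow> g x = l"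
      using radial_limit_representative by metis
    \<comment> \<open>Only the product \<Theta> G is known to have vertical limits. Those of G
      follow on division by \<Theta>, whose limit is unimodular, hence nonzero.\<close>
    have hg: "AE x in lborel. ((\<lambda>y. G (Complex x y)) \<longlongrightarrow> g x) (at_right 0) \<and> h x = exp (\<i> * of_real (\<phi> x)) * g x"
      using hl
    proof eventually_elim
      case (elim x)
      define e where "e = exp (\<i> * of_real (\<phi> x))"
      have "(\<Theta> \<longlongrightarrow> e) (at (of_real x) within upper_half_plane)"
        using \<Theta> by (simp add: is_boundary_argument_def e_def)
      from filterlim_compose[OF this Complex_at_right]
      have T: "((\<lambda>y. \<Theta> (Complex x y)) \<longlongrightarrow> e) (at_right 0)" .
      have e0: "e \<noteq> 0" by (simp add: e_def)
      have "eventually (\<lambda>y. \<Theta> (Complex x y) \<noteq> 0) (at_right 0)"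
        by (rule tendsto_imp_eventually_ne[OF T e0])
      then have "eventually (\<lambda>y. \<Theta> (Complex x y) * G (Complex x y) / \<Theta> (Complex x y) = G (Complex x y)) (at_right 0)"
        by eventually_elim simp
      from Lim_transform_eventually[OF tendsto_divide[OF elim T e0] this]
      have *: "((\<lambda>y. G (Complex x y)) \<longlongrightarrow> h x / e) (at_right 0)" .
      with g(2)[OF *] e0 show ?case by (simp add: e_def[symmetric])
    qed
    have fg: "(LBINT x. f x * g x) = 0"
      by (rule hardy2_orthogonal[OF G F dec f g(1)]) (use hg in \<open>auto elim: AE_mp\<close>)
    have fgm: "(\<lambda>x. f x * g x) \<in> borel_measurable lborel" using f(1) g(1) by simp
    have cm: "cnj \<in> borel_measurable borel"
      by (intro borel_measurable_continuous_onI continuous_intros)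
    have "l2_inner f h = (LINT x|lebesgue. cnj (f x * g x))"
      unfolding l2_inner_def
    proof (rule integral_cong_AE)
      have "AE x in lborel. f x * cnj (h x) = cnj (f x * g x)"
        using hg ph by eventually_elim (auto simp: mult.assoc[symmetric])
      then show "AE x in lebesgue. f x * cnj (h x) = cnj (f x * g x)" by (rule AE_completion)
      show "(\<lambda>x. f x * cnj (h x)) \<in> borel_measurable lebesgue"
        by (rule borel_measurable_times[OF fL measurable_compose[OF hm cm]])
      show "(\<lambda>x. cnj (f x * g x)) \<in> borel_measurable lebesgue"
        by (rule measurable_compose[OF measurable_completion[OF fgm] cm])
    qed
    also have "\<dots> = cnj (LBINT x. f x * g x)"
      by (subst Bochner_Integration.integral_cnj) (simp only: integral_completion[OF fgm])
    finally show ?thesis using fg by simp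
  qed
  with H show ?thesis by (simp add: model_space_def)
qed

lemma japanese_bracket_le: "japanese_bracket x \<le> 1 + \<bar>x\<bar>"
  unfolding japanese_bracket_def by (rule real_le_lsqrt) (auto simp: power2_eq_square algebra_simps)

text \<open>Lets powers of z + \<i> a absorb powers of 2 + \<bar>z\<bar>, at the cost of a factor 3
  per power and uniformly in a \<ge> 1.\<close>

lemma cmod_add_imaginary_ge:
  assumes "Im z > 0" "1 \<le> a"
  shows "2 + cmod z \<le> 3 * cmod (z + \<i> * of_real a)"
proof -
  have "(cmod z)\<^sup>2 + 1 \<le> (cmod (z + \<i> * of_real a))\<^sup>2"
  proof -
    have "(Im z)\<^sup>2 + 1\<^sup>2 \<le> (Im z + a)\<^sup>2"
    proof -
      have "1 \<le> a\<^sup>2" using assms(2) by (rule one_le_power)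
      moreover have "0 \<le> 2 * Im z * a" using assms by simp
      ultimately show ?thesis unfolding power2_sum one_power2 by linarith
    qed
    then show ?thesis by (simp add: cmod_power2)
  qed
  moreover have "0 \<le> (4 * cmod z - 1)\<^sup>2" by simp
  ultimately have "(2 + cmod z)\<^sup>2 \<le> (3 * cmod (z + \<i> * of_real a))\<^sup>2"
    by (simp add: power2_eq_square algebra_simps)
  then show ?thesis by (rule power2_le_imp_le) simp
qed

theorem theorem3:
  fixes \<Theta> :: "complex \<Rightarrow> complex"
    and arg\<Theta> \<omega> \<Omega> \<Omega>tilde \<alpha> :: "real \<Rightarrow> real"
  assumes "meromorphic_inner_function \<Theta>"
    and "is_boundary_argument \<Theta> arg\<Theta>"
    and "\<omega> \<in> borel_measurable lebesgue"
    and "\<And>x. 0 < \<omega> x \<and> \<omega> x \<le> 1"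
    and "\<And>x. \<omega> x = exp (- \<Omega> x)"
    and "integrable poisson_measure \<Omega>"
    and "is_hilbert_transform \<Omega> \<Omega>tilde"
    and "\<Omega>tilde C1_differentiable_on UNIV"
    and "\<And>x. \<alpha> x = arg\<Theta> x + 2 * \<Omega>tilde x"
    and "regular_locally_doubling \<alpha>"
    and "\<exists>c>0. \<forall>x. 1 \<le> c * deriv \<alpha> x"
    and "\<exists>K0\<ge>0. \<exists>C>0. \<forall>x. deriv \<alpha> x \<le> C * japanese_bracket x powr K0"
  shows "admissible_majorant \<omega> (model_space \<Theta>)"
proof -
  obtain c where c: "c > 0" "\<And>x. 1 \<le> c * deriv \<alpha> x" using assms(11) by blast
  obtain K C where K: "K \<ge> 0" and C: "C > 0" "\<And>x. deriv \<alpha> x \<le> C * japanese_bracket x powr K"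
    using assms(12) by blast
  have D\<alpha>: "DERIV \<alpha> x :> deriv \<alpha> x" for x
  proof -
    have "(deriv ^^ 0) \<alpha> differentiable_on UNIV"
      using assms(10) unfolding regular_locally_doubling_def smooth_real_def by blast
    then have "\<alpha> differentiable (at x)" by (simp add: differentiable_on_def)
    then show ?thesis by (simp add: DERIV_deriv_iff_real_differentiable)
  qed
  have \<alpha>_growth: "\<alpha> t - \<alpha> s \<le> C * (2 + \<bar>x\<bar>) powr K * (t - s)"
    if "s \<le> t" "\<bar>s - x\<bar> \<le> 1" "\<bar>t - x\<bar> \<le> 1" for s t x
  proof (cases "s = t")
    case False
    with that have "s < t" by simp
    from MVT2[OF this D\<alpha>] obtain \<xi> where \<xi>: "s < \<xi>" "\<xi> < t" "\<alpha> t - \<alpha> s = (t - s) * deriv \<alpha> \<xi>" by blast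
    have "japanese_bracket \<xi> \<le> 2 + \<bar>x\<bar>" using japanese_bracket_le[of \<xi>] \<xi> that by linarith
    then have "japanese_bracket \<xi> powr K \<le> (2 + \<bar>x\<bar>) powr K"
      using K by (intro powr_mono2) (auto simp: japanese_bracket_def)
    then have "deriv \<alpha> \<xi> \<le> C * (2 + \<bar>x\<bar>) powr K"
      using C(2)[of \<xi>] C(1) by (meson mult_left_mono less_imp_le order_trans)
    then have "(t - s) * deriv \<alpha> \<xi> \<le> (t - s) * (C * (2 + \<bar>x\<bar>) powr K)"
      using \<open>s < t\<close> by (intro mult_left_mono) auto
    then show ?thesis using \<xi>(3) by (simp add: mult_ac)
  qed simp
  \<comment> \<open>The growth exponent of \<open>exp ((\<i>/2) S \<beta>)\<close> will be 4 + 2 *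
    K; two further powers remain for the decay of F.\<close>
  define m where "m = nat \<lceil>K\<rceil> + 3"
  have m: "6 + 2 * K \<le> 2 * real m" using real_nat_ceiling_ge[of K] by (simp add: m_def)
  \<comment> \<open>The slope of 4 * m * arctan (x / a) is at most 4 * m / a = 1 / (2 * (c + 1)),
    below the lower bound 1 / c of the slope of \<alpha>. Using c + 1 also gives a \<ge> 1 for small
    c.\<close>
  define a where "a = 4 * real (2 * m) * (c + 1)"
  have a: "a \<ge> 1"
  proof -
    have "1 * 1 \<le> (4 * real (2 * m)) * (c + 1)" using c(1) by (intro mult_mono) (auto simp: m_def)
    then show ?thesis by (simp add: a_def)
  qed
  define \<gamma> where "\<gamma> x = \<alpha> x - 4 * real m * arctan (x / a)" for x
  have D\<gamma>: "DERIV \<gamma> x :> deriv \<alpha> x - 4 * real m * (1 / a / (1 + (x / a)\<^sup>2))" for x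
    unfolding \<gamma>_def using a one_plus_square_pos[of "x / a"]
    by (auto intro!: derivative_eq_intros D\<alpha> simp: divide_simps)
  have D\<gamma>_pos: "0 < deriv \<alpha> x - 4 * real m * (1 / a / (1 + (x / a)\<^sup>2))" for x
  proof -
    have "4 * real m * (1 / a / (1 + (x / a)\<^sup>2)) \<le> 4 * real m * (1 / a / 1)"
      using a one_plus_square_pos[of "x / a"] by (intro mult_left_mono divide_left_mono) auto
    also have "\<dots> = 1 / (2 * (c + 1))"
    proof -
      have "real m \<noteq> 0" "8 * c + 8 \<noteq> 0" "2 * c + 2 \<noteq> 0" using c(1) by (auto simp: m_def)
      then show ?thesis by (simp add: a_def frac_eq_eq)
    qed
    also have "\<dots> < 1 / c" using c(1) by (intro divide_strict_left_mono) auto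
    also have "\<dots> \<le> deriv \<alpha> x" using c(1) c(2)[of x] by (simp add: pos_divide_le_eq mult.commute)
    finally show ?thesis by simp
  qed
  have \<gamma>_mono: "strict_mono \<gamma>"
  proof (rule strict_monoI)
    fix s t :: real assume "s < t"
    then show "\<gamma> s < \<gamma> t" by (rule DERIV_pos_imp_increasing) (use D\<gamma> D\<gamma>_pos in blast)
  qed
  have \<gamma>_cont: "isCont \<gamma> x" for x using D\<gamma> by (rule DERIV_isCont)
  have \<gamma>_meas: "\<gamma> \<in> borel_measurable borel"
    using \<gamma>_cont by (intro borel_measurable_continuous_onI) (simp add: continuous_at_imp_continuous_on)
  \<comment> \<open>The subtracted arctan is increasing, so the bound for \<alpha> persists with
    constants free of m and a.\<close>
  have \<gamma>_growth: "\<gamma> t - \<gamma> s \<le> C * (2 + \<bar>x\<bar>) powr K * (t - s)"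
    if "s \<le> t" "\<bar>s - x\<bar> \<le> 1" "\<bar>t - x\<bar> \<le> 1" for s t x
  proof -
    have "arctan (s / a) \<le> arctan (t / a)" using that a by (simp add: arctan_le_iff divide_right_mono)
    then have "4 * real m * arctan (s / a) \<le> 4 * real m * arctan (t / a)" by (intro mult_left_mono) auto
    then show ?thesis using \<alpha>_growth[OF that] by (simp add: \<gamma>_def)
  qed
  define \<beta> where "\<beta> = sawtooth \<gamma>"
  have \<beta>_meas: "\<beta> \<in> borel_measurable borel" unfolding \<beta>_def by (rule sawtooth_measurable[OF \<gamma>_meas])
  have \<beta>_bound: "\<bar>\<beta> t\<bar> \<le> 2 * pi" for t unfolding \<beta>_def by (rule sawtooth_abs_le)
  have \<beta>_int: "poisson_integrable \<beta>" by (rule poisson_integrable_bounded[OF \<beta>_meas \<beta>_bound])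
  have \<beta>_inc: "\<beta> (x + s) - \<beta> (x - s) \<le> 2 * C * (2 + \<bar>x\<bar>) powr K * s" if "0 < s" "s \<le> 1" for x s
  proof -
    have "\<gamma> (x - s) \<le> \<gamma> (x + s)" using that \<gamma>_mono by (simp add: strict_mono_less_eq)
    then have "\<beta> (x + s) - \<beta> (x - s) \<le> \<gamma> (x + s) - \<gamma> (x - s)" unfolding \<beta>_def by (rule sawtooth_increment)
    also have "\<dots> \<le> C * (2 + \<bar>x\<bar>) powr K * ((x + s) - (x - s))" by (rule \<gamma>_growth) (use that in auto)
    finally show ?thesis by simp
  qed
  \<comment> \<open>The additive constant of \<open>Im_schwarz_growth\<close> for M = 2 * pi and B =
    2 * C, where the 2 in B reflects that x - s and x + s are 2 * s apart.\<close>
  define C1 where "C1 = 2 * pi * (2 * ln 2 + ln 17 + 6) + 2 * C"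
  have growth: "- Im (schwarz \<beta> z) / 2 \<le> (4 + 2 * K) * ln (2 + cmod z) + C1 / (2 * pi)" if "Im z > 0" for z
  proof -
    have "- pi * Im (schwarz \<beta> z) \<le> 2 * pi * (4 + 2 * K) * ln (2 + cmod z) + C1"
      unfolding C1_def by (rule Im_schwarz_growth[OF \<beta>_meas \<beta>_bound K _ \<beta>_inc that]) (use C in simp)
    then have "- pi * Im (schwarz \<beta> z) / (2 * pi) \<le> (2 * pi * (4 + 2 * K) * ln (2 + cmod z) + C1) / (2 * pi)"
      by (intro divide_right_mono) auto
    then show ?thesis by (simp add: add_divide_distrib)
  qed
  have \<Omega>0: "0 \<le> \<Omega> x" for x using assms(4)[of x] assms(5)[of x] by simp
  obtain u where u: "poisson_integrable u" "\<And>x. 0 \<le> u x" "AE x in lborel. u x = \<Omega> x"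
    "AE x in lborel. has_hilbert_transform_at u (\<Omega>tilde x) x"
    using borel_representative[OF assms(6) \<Omega>0 assms(7)] by blast
  \<comment> \<open>Normalised to cancel the constant in the growth of \<beta> and the factors 3
    lost in the denominator, so that the bound for F has constant 1.\<close>
  define \<kappa> where "\<kappa> = exp (- (C1 / (2 * pi))) / 3 ^ (2 * m)"
  have \<kappa>: "\<kappa> > 0" by (simp add: \<kappa>_def)
  define F where "F z = of_real \<kappa> * exp (- schwarz u z + \<i> / 2 * schwarz \<beta> z) / (z + \<i> * of_real a) ^ (2 * m)" for z
  have za: "z + \<i> * of_real a \<noteq> 0" if "Im z \<ge> 0" for z
  proof
    assume "z + \<i> * of_real a = 0"
    then have "Im (z + \<i> * of_real a) = 0" by simp
    then show False using that a by simp
  qed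
  have F_hol: "F holomorphic_on upper_half_plane"
    unfolding F_def
    by (intro holomorphic_intros schwarz_holomorphic u \<beta>_int)
      (use za in \<open>auto simp: upper_half_plane_def less_imp_le\<close>)
  \<comment> \<open>The factor with \<open>schwarz u\<close> is kept: its boundary value is \<omega>
    and gives the majorant, while bounding it by 1 gives the H2 decay.\<close>
  have F_bound: "cmod (F z) \<le> exp (- Re (schwarz u z)) / (1 + cmod z)\<^sup>2" if z: "Im z > 0" for z
  proof -
    define r where "r = 2 + cmod z"
    have r: "r \<ge> 2" by (simp add: r_def)
    have "r / 3 \<le> cmod (z + \<i> * of_real a)" using cmod_add_imaginary_ge[OF z a] by (simp add: r_def)
    then have den: "(r / 3) ^ (2 * m) \<le> cmod (z + \<i> * of_real a) ^ (2 * m)" using r by (intro power_mono) auto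
    have "exp (- Im (schwarz \<beta> z) / 2) \<le> exp ((4 + 2 * K) * ln r + C1 / (2 * pi))"
      using growth[OF z] by (simp add: r_def)
    also have "\<dots> = r powr (4 + 2 * K) * exp (C1 / (2 * pi))"
      using r by (simp add: exp_add powr_def)
    also have "r powr (4 + 2 * K) \<le> r powr (2 * real m - 2)"
      using r m by (intro powr_mono) auto
    also have "r powr (2 * real m - 2) = r ^ (2 * m) / r\<^sup>2"
    proof -
      have "r powr real (2 * m) = r ^ (2 * m)" "r powr real 2 = r\<^sup>2"
        by (rule powr_realpow, use r in simp)+
      moreover have "r powr (2 * real m - 2) = r powr real (2 * m) / r powr real 2"
        unfolding powr_diff[symmetric] by simp
      ultimately show ?thesis by simp
    qed
    finally have num: "exp (- Im (schwarz \<beta> z) / 2) \<le> r ^ (2 * m) / r\<^sup>2 * exp (C1 / (2 * pi))"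
      by simp
    have "cmod (F z) = \<kappa> * (exp (- Re (schwarz u z)) * exp (- Im (schwarz \<beta> z) / 2)) / cmod (z + \<i> * of_real a) ^ (2 * m)"
      using \<kappa> by (simp add: F_def norm_divide norm_mult norm_power exp_add[symmetric])
    also have "\<dots> \<le> \<kappa> * (exp (- Re (schwarz u z)) * (r ^ (2 * m) / r\<^sup>2 * exp (C1 / (2 * pi)))) / (r / 3) ^ (2 * m)"
      using den num \<kappa> r by (intro frac_le mult_left_mono) auto
    also have "\<dots> = exp (- Re (schwarz u z)) / r\<^sup>2"
      using r by (simp add: \<kappa>_def exp_minus power_divide field_simps)
    also have "\<dots> \<le> exp (- Re (schwarz u z)) / (1 + cmod z)\<^sup>2"
      by (intro divide_left_mono power_mono mult_pos_pos zero_less_power add_pos_nonneg) (auto simp: r_def add_pos_nonneg)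
    finally show ?thesis .
  qed
  have F_dec: "cmod (F z) \<le> 1 / (1 + cmod z)\<^sup>2" if "Im z > 0" for z
  proof -
    have "exp (- Re (schwarz u z)) \<le> 1" using Re_schwarz_nonneg[OF u(1,2) that] by simp
    then have "exp (- Re (schwarz u z)) / (1 + cmod z)\<^sup>2 \<le> 1 / (1 + cmod z)\<^sup>2" by (intro divide_right_mono) auto
    with F_bound[OF that] show ?thesis by linarith
  qed
  obtain f where f: "f \<in> borel_measurable borel"
    "\<And>x l. ((\<lambda>y. F (Complex x y)) \<longlongrightarrow> l) (at_right 0) \<Longrightarrow> f x = l"
    using radial_limit_representative[OF F_hol] by metis
  have main: "AE x in lborel. ((\<lambda>y. F (Complex x y)) \<longlongrightarrow> f x) (at_right 0) \<and> f x \<noteq> 0 \<and> cmod (f x) \<le> \<omega> x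
      \<and> f x * cnj (exp (\<i> * of_real (arg\<Theta> x))) = cnj (f x)"
    \<comment> \<open>The exceptional set consists of the points that are not Lebesgue points of u
      or \<beta>, those where u differs from \<Omega> or the principal value fails, and the points
      where \<gamma> is a multiple of 2 pi.\<close>
    using lebesgue_points[OF u(1)] lebesgue_points[OF \<beta>_int] u(3,4) AE_no_jump[OF \<gamma>_mono]
  proof eventually_elim
    case (elim x)
    have Su: "((\<lambda>y. schwarz u (Complex x y)) \<longlongrightarrow> Complex (\<Omega> x) (\<Omega>tilde x)) (at_right 0)"
      using Re_schwarz_tendsto[OF u(1) elim(1)] Im_schwarz_tendsto[OF u(1) elim(1) elim(4)] elim(3)
      by (intro tendsto_complex_iff[THEN iffD2]) simp
    obtain d where d: "d > 0" "\<And>t. \<bar>x - t\<bar> \<le> d \<Longrightarrow> \<beta> t - \<beta> x = \<gamma> t - \<gamma> x"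
      unfolding \<beta>_def using sawtooth_locally[OF \<gamma>_cont elim(5)] by metis
    have "\<exists>b. ((\<lambda>y. Im (schwarz \<beta> (Complex x y))) \<longlongrightarrow> b) (at_right 0)"
    proof (rule Im_schwarz_convergent[OF \<beta>_int])
      \<comment> \<open>Radius d avoids the jumps of \<beta>, and radius 1 is the range of the
        increment bound for \<gamma>.\<close>
      show "0 < min d 1" using d(1) by simp
      fix t assume t: "\<bar>x - t\<bar> \<le> min d 1"
      show "\<bar>\<beta> t - \<beta> x\<bar> \<le> C * (2 + \<bar>x\<bar>) powr K * \<bar>x - t\<bar>"
      proof (cases "x \<le> t")
        case True
        then have "\<gamma> x \<le> \<gamma> t" using \<gamma>_mono by (simp add: strict_mono_less_eq)
        then show ?thesis using d(2)[of t] t \<gamma>_growth[of x t x] True by simp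
      next
        case False
        then have "\<gamma> t \<le> \<gamma> x" using \<gamma>_mono by (simp add: strict_mono_less_eq)
        then show ?thesis using d(2)[of t] t \<gamma>_growth[of t x x] False by simp
      qed
    qed
    then obtain b where b: "((\<lambda>y. Im (schwarz \<beta> (Complex x y))) \<longlongrightarrow> b) (at_right 0)" by blast
    have S\<beta>: "((\<lambda>y. schwarz \<beta> (Complex x y)) \<longlongrightarrow> Complex (\<beta> x) b) (at_right 0)"
      using Re_schwarz_tendsto[OF \<beta>_int elim(2)] b by (intro tendsto_complex_iff[THEN iffD2]) simp
    have cx: "((\<lambda>y. Complex x y) \<longlongrightarrow> of_real x) (at_right 0)"
      unfolding Complex_eq by (auto intro!: tendsto_eq_intros)
    define l where "l = of_real \<kappa> * exp (- Complex (\<Omega> x) (\<Omega>tilde x) + \<i> / 2 * Complex (\<beta> x) b) / (of_real x + \<i> * of_real a) ^ (2 * m)"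
    have lim: "((\<lambda>y. F (Complex x y)) \<longlongrightarrow> l) (at_right 0)"
      unfolding F_def l_def using za[of "of_real x"] by (intro tendsto_intros Su S\<beta> cx) auto
    then have fl: "f x = l" by (rule f(2))
    have "l \<noteq> 0" using \<kappa> za[of "of_real x"] by (simp add: l_def)
    moreover have "cmod l \<le> \<omega> x"
    proof (rule tendsto_le[OF _ _ tendsto_norm[OF lim]])
      have "((\<lambda>y. exp (- Re (schwarz u (Complex x y)))) \<longlongrightarrow> exp (- Re (Complex (\<Omega> x) (\<Omega>tilde x)))) (at_right 0)"
        by (intro tendsto_intros Su)
      then show "((\<lambda>y. exp (- Re (schwarz u (Complex x y)))) \<longlongrightarrow> \<omega> x) (at_right 0)"
        using assms(5)[of x] by simp
      show "eventually (\<lambda>y. cmod (F (Complex x y)) \<le> exp (- Re (schwarz u (Complex x y)))) (at_right 0)"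
        using eventually_at_right_less[of "0::real"]
      proof eventually_elim
        case (elim y)
        have "1 \<le> (1 + cmod (Complex x y))\<^sup>2" by (simp add: one_le_power)
        then have "exp (- Re (schwarz u (Complex x y))) / (1 + cmod (Complex x y))\<^sup>2 \<le> exp (- Re (schwarz u (Complex x y))) / 1"
          by (intro frac_le) auto
        with F_bound[of "Complex x y"] elim show ?case by simp
      qed
    qed simp
    moreover have "l * cnj (exp (\<i> * of_real (arg\<Theta> x))) = cnj l"
    proof -
      have "\<beta> x = arg\<Theta> x + 2 * \<Omega>tilde x - 4 * real m * arctan (x / a) - 2 * pi * of_int \<lfloor>\<gamma> x / (2 * pi)\<rfloor>"
        by (simp add: \<beta>_def sawtooth_def \<gamma>_def assms(9))
      from phase_identity[OF _ this, of \<kappa> "\<Omega> x" b] a show ?thesis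
        unfolding l_def Complex_eq by simp
    qed
    ultimately show ?case using lim fl by simp
  qed
  have "f \<in> model_space \<Theta>"
    using main by (intro model_spaceI[OF assms(2) F_hol F_dec f(1)]) (auto elim: AE_mp)
  moreover have "AE x in lebesgue. cmod (f x) \<le> \<omega> x"
    using main by (intro AE_completion) (auto elim: AE_mp)
  moreover have "\<not> (AE x in lebesgue. f x = 0)"
  proof
    assume "AE x in lebesgue. f x = 0"
    then have "AE x in lborel. f x = 0" by (simp add: AE_completion_iff)
    with main have "AE x in (lborel :: real measure). False" by eventually_elim simp
    then show False
      using ae_filter_eq_bot_iff[of "lborel :: real measure"] by (simp add: eventually_False)
  qed
  ultimately show ?thesis unfolding admissible_majorant_def by blast
qed

end
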